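(* Let $G$ be a finite simple graph with vertex set $\{x_1,\dots,x_m\}$ and edge ideal $\mathcal{I}(G)\subseteq R=k[x_1,\dots,x_m]$, where $k$ is an arbitrary field. (i) Suppose $e=\{u,v\}$ is a splitting edge of $G$. Set $H=G\setminus(N(u)\cup N(v))$ and $n=|N(u)\cup N(v)|-2$. Then for all $i\ge 1$ and all $j\ge 0$ \[\beta_{i,j}(\mathcal{I}(G))=\beta_{i,j}(\mathcal{I}(G\setminus e))+\sum_{l=0}^{i}\binom{n}{l}\,\beta_{i-l-1,\,j-2-l}(\mathcal{I}(H)).\] (ii) Let $v$ be a splitting vertex of $G$ with $N(v)=\{v_1,\dots,v_d\}$ (distinct vertices). Set $G_i:=G\setminus(N(v)\cup N(v_i))$ for $i=1,\dots,d$, and let $G_{(v)}$ be the subgraph of $G$ consisting of all edges of $G$ incident to at least one of $v_1,\dots,v_d$, except those that are also incident to $v$. Then for all $i,j\ge 0$ \[\beta_{i,j}(\mathcal{I}(G))=\beta_{i,j}(\mathcal{I}(\mathcal{K}_{1,d}))+\beta_{i,j}(\mathcal{I}(G\setminus\{v\}))+\beta_{i-1,j}(L),\] where $L=v\,\mathcal{I}(G_{(v)})+vv_1\mathcal{I}(G_1)+\cdots+vv_d\mathcal{I}(G_d)$, and where for $i=0$ the term $\beta_{-1,j}(L)$ is read as $0$.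
   Context: Graphs are finite, undirected, without loops or multiple edges, not necessarily connected. The vertices $x_1,\dots,x_m$ of $G$ are identified with the variables of $R$, and $\mathcal{I}(G)=(\{x_ix_j \mid \{x_i,x_j\}\in E_G\})$ is the edge ideal; a graph without edges has edge ideal $(0)$. Edge ideals of subgraphs are viewed in the same ring $R$. $N(x)$ is the set of neighbors of $x$ in $G$. $G\setminus e$ is $G$ with the edge $e$ deleted (vertices kept); for a set $S$ of vertices, $G\setminus S$ is $G$ with the vertices of $S$ and all incident edges deleted. $\mathcal{K}_{1,d}$ is the complete bipartite graph with parts of sizes $1$ and $d$. Betti numbers: $\beta_{i,j}(I)=\dim_k \mathrm{Tor}_i^R(I,k)_j$ for $i\ge 0$. In (i) the convention is that for every ideal $I$ (including $(0)$), $\beta_{-1,0}(I)=1$ and $\beta_{-1,j}(I)=0$ for $j\neq 0$. Splittings: for a monomial ideal $I$, $\mathcal{G}(I)$ is its minimal set of monomial generators. An expression $I=J+K$ with $J,K$ nonzero monomial ideals is a splitting of $I$ if (1) $\mathcal{G}(I)$ is the disjoint union of $\mathcal{G}(J)$ and $\mathcal{G}(K)$, and (2) there is a function $\mathcal{G}(J\cap K)\to\mathcal{G}(J)\times\mathcal{G}(K)$, $w\mapsto(\phi(w),\psi(w))$, such that (a) $w=\mathrm{lcm}(\phi(w),\psi(w))$ for all $w\in\mathcal{G}(J\cap K)$, and (b) for every nonempty subset $S\subseteq\mathcal{G}(J\cap K)$, both $\mathrm{lcm}(\phi(S))$ and $\mathrm{lcm}(\psi(S))$ strictly divide $\mathrm{lcm}(S)$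 (i.e. divide it and are not equal to it). An edge $e=\{u,v\}$ of $G$ is a splitting edge if $\mathcal{I}(G)=(uv)+\mathcal{I}(G\setminus e)$ is a splitting. A vertex $v$ of $G$ is a splitting vertex if $\deg v>0$ and $G\setminus\{v\}$ has at least one edge. *)

theory Defs
  imports Complex_Main "HOL-Library.Poly_Mapping" "HOL-Library.Function_Algebras"
begin

section \<open>The polynomial ring\<close>

text \<open>A monomial is given by its exponent vector, and \<open>('v, 'k) mpoly\<close> is the monoid algebra of
  the exponent vectors over \<open>'k\<close>. For \<open>'v :: finite\<close> this is the polynomial ring over \<open>'k\<close> whose
  variables are the elements of \<open>'v\<close>. The order \<open>(\<le>)\<close> of the library on exponent vectors
  is lexicographic, so divisibility of monomials is introduced separately.\<close>

type_synonym 'v mono = "'v \<Rightarrow>\<^sub>0 nat"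
type_synonym ('v, 'k) mpoly = "('v \<Rightarrow>\<^sub>0 nat) \<Rightarrow>\<^sub>0 'k"

definition monomial :: "'v mono \<Rightarrow> ('v, 'k::field) mpoly" where
  "monomial t = Poly_Mapping.single t 1"

definition var :: "'v \<Rightarrow> ('v, 'k::field) mpoly" where
  "var x = monomial (Poly_Mapping.single x 1)"

definition mono_deg :: "'v mono \<Rightarrow> nat" where
  "mono_deg t = (\<Sum>x\<in>Poly_Mapping.keys t. Poly_Mapping.lookup t x)"

definition homogeneous :: "int \<Rightarrow> ('v, 'k::field) mpoly \<Rightarrow> bool" where
  "homogeneous d p \<longleftrightarrow> (\<forall>t\<in>Poly_Mapping.keys p. int (mono_deg t) = d)"

definition mono_dvd :: "'v mono \<Rightarrow> 'v mono \<Rightarrow> bool" where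
  "mono_dvd s t \<longleftrightarrow> (\<exists>u. t = s + u)"

text \<open>Least common multiple of a nonempty finite set of monomials.\<close>

definition mono_lcm :: "'v::finite mono set \<Rightarrow> 'v mono" where
  "mono_lcm S = Abs_poly_mapping (\<lambda>x. Max ((\<lambda>t. Poly_Mapping.lookup t x) ` S))"

definition ideal_gen :: "'a::comm_ring_1 set \<Rightarrow> 'a set" where
  "ideal_gen = module.span (*)"

definition monomial_ideal :: "('v, 'k::field) mpoly set \<Rightarrow> bool" where
  "monomial_ideal I \<longleftrightarrow> (\<exists>A. I = ideal_gen (monomial ` A))"

definition min_gens :: "('v, 'k::field) mpoly set \<Rightarrow> 'v mono set" where
  "min_gens I = {t. monomial t \<in> I \<and> (\<forall>s. monomial s \<in> I \<longrightarrow> mono_dvd s t \<longrightarrow> s = t)}"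


section \<open>Graded Betti numbers\<close>

text \<open>Elements of a free module of rank \<open>n\<close> are functions vanishing outside \<open>{..<n}\<close>.\<close>

definition free_module :: "nat \<Rightarrow> (nat \<Rightarrow> 'a::comm_ring_1) set" where
  "free_module n = {x. \<forall>b\<ge>n. x b = 0}"

definition mat_map ::
    "nat \<Rightarrow> nat \<Rightarrow> (nat \<Rightarrow> nat \<Rightarrow> 'a::comm_ring_1) \<Rightarrow> (nat \<Rightarrow> 'a) \<Rightarrow> (nat \<Rightarrow> 'a)" where
  "mat_map m n M x = (\<lambda>b. if b < m then (\<Sum>c<n. M b c * x c) else 0)"

text \<open>A complex of graded free modules
  \<open>\<dots> \<rightarrow> F\<^sub>2 \<rightarrow> F\<^sub>1 \<rightarrow> F\<^sub>0 \<rightarrow> R\<close> with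
  \<open>F\<^sub>i = \<Oplus>\<^sub>b R(- shift i b)\<close>, where \<open>b\<close> ranges over \<open>{..<rank i}\<close>. The map
  \<open>F\<^sub>0 \<rightarrow> R\<close> is given by the row \<open>aug\<close>, and \<open>F\<^bsub>i+1\<^esub> \<rightarrow> F\<^sub>i\<close> by the matrix \<open>dmat i\<close>.\<close>

record 'r free_complex =
  rank :: "nat \<Rightarrow> nat"
  shift :: "nat \<Rightarrow> nat \<Rightarrow> int"
  aug :: "nat \<Rightarrow> 'r"
  dmat :: "nat \<Rightarrow> nat \<Rightarrow> nat \<Rightarrow> 'r"

definition aug_map :: "('v, 'k::field) mpoly free_complex \<Rightarrow> (nat \<Rightarrow> ('v, 'k) mpoly) \<Rightarrow> ('v, 'k) mpoly"
  where "aug_map F x = (\<Sum>b<rank F 0. aug F b * x b)"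

definition diff_map ::
    "('v, 'k::field) mpoly free_complex \<Rightarrow> nat \<Rightarrow> (nat \<Rightarrow> ('v, 'k) mpoly) \<Rightarrow> (nat \<Rightarrow> ('v, 'k) mpoly)"
  where "diff_map F i = mat_map (rank F i) (rank F (Suc i)) (dmat F i)"

definition graded_free_resolution ::
    "('v, 'k::field) mpoly set \<Rightarrow> ('v, 'k) mpoly free_complex \<Rightarrow> bool" where
  "graded_free_resolution I F \<longleftrightarrow>
     (\<forall>b<rank F 0. homogeneous (shift F 0 b) (aug F b)) \<and>
     (\<forall>i. \<forall>b<rank F i. \<forall>c<rank F (Suc i).
        homogeneous (shift F (Suc i) c - shift F i b) (dmat F i b c)) \<and>
     aug_map F ` free_module (rank F 0) = I \<and>
     diff_map F 0 ` free_module (rank F (Suc 0)) = {x \<in> free_module (rank F 0). aug_map F x = 0} \<and>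
     (\<forall>i. diff_map F (Suc i) ` free_module (rank F (Suc (Suc i))) =
            {x \<in> free_module (rank F (Suc i)). diff_map F i x = 0})"

text \<open>The complex \<open>F \<otimes>\<^sub>R k\<close>, where \<open>k = R/(x\<^sub>1, \<dots>, x\<^sub>m)\<close>: the graded piece of degree \<open>j\<close>
  of \<open>F\<^sub>i \<otimes> k\<close> has as basis the basis elements of \<open>F\<^sub>i\<close> of degree \<open>j\<close>, and each matrix entry is
  replaced by its residue class in \<open>k\<close>, that is, by its constant coefficient.\<close>

definition tor_chains :: "('v, 'k::field) mpoly free_complex \<Rightarrow> nat \<Rightarrow> int \<Rightarrow> (nat \<Rightarrow> 'k) set" where
  "tor_chains F i j = {x \<in> free_module (rank F i). \<forall>b. x b \<noteq> 0 \<longrightarrow> shift F i b = j}"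

definition tor_diff :: "('v, 'k::field) mpoly free_complex \<Rightarrow> nat \<Rightarrow> (nat \<Rightarrow> 'k) \<Rightarrow> (nat \<Rightarrow> 'k)" where
  "tor_diff F i =
     mat_map (rank F i) (rank F (Suc i)) (\<lambda>b c. Poly_Mapping.lookup (dmat F i b c) 0)"

definition tor_cycles :: "('v, 'k::field) mpoly free_complex \<Rightarrow> nat \<Rightarrow> int \<Rightarrow> (nat \<Rightarrow> 'k) set" where
  "tor_cycles F i j = {x \<in> tor_chains F i j. case i of 0 \<Rightarrow> True | Suc i' \<Rightarrow> tor_diff F i' x = 0}"

definition tor_boundaries :: "('v, 'k::field) mpoly free_complex \<Rightarrow> nat \<Rightarrow> int \<Rightarrow> (nat \<Rightarrow> 'k) set" where
  "tor_boundaries F i j = tor_diff F i ` tor_chains F (Suc i) j"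

definition kdim :: "(nat \<Rightarrow> 'k::field) set \<Rightarrow> nat" where
  "kdim = vector_space.dim (\<lambda>c x b. c * x b)"

text \<open>For a graded free resolution \<open>F\<close> of \<open>I\<close>, the quotient of \<open>tor_cycles F i j\<close> by its subspace
  \<open>tor_boundaries F i j\<close> is the degree \<open>j\<close> piece of \<open>H\<^sub>i(F \<otimes> k) = Tor\<^sub>i(I, k)\<close>. Both spaces
  have finite dimension, so the subtraction is the dimension of that quotient; it does not depend
  on the choice of \<open>F\<close>.\<close>

definition betti :: "('v::finite, 'k::field) mpoly set \<Rightarrow> nat \<Rightarrow> int \<Rightarrow> nat" where
  "betti I i j =
     (let F = (SOME F. graded_free_resolution I F)
      in kdim (tor_cycles F i j) - kdim (tor_boundaries F i j))"

text \<open>Extension to homological index \<open>-1\<close> by the convention \<open>\<beta>\<^bsub>-1,0\<^esub>(I) = 1\<close> and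
  \<open>\<beta>\<^bsub>-1,j\<^esub>(I) = 0\<close> for \<open>j \<noteq> 0\<close>.\<close>

definition betti_ext :: "('v::finite, 'k::field) mpoly set \<Rightarrow> int \<Rightarrow> int \<Rightarrow> nat" where
  "betti_ext I i j =
     (if 0 \<le> i then betti I (nat i) j else if i = -1 \<and> j = 0 then 1 else 0)"


section \<open>Splittings of monomial ideals\<close>

definition splitting ::
    "('v::finite, 'k::field) mpoly set \<Rightarrow> ('v, 'k) mpoly set \<Rightarrow> ('v, 'k) mpoly set \<Rightarrow> bool" where
  "splitting I J K \<longleftrightarrow>
     monomial_ideal I \<and> monomial_ideal J \<and> monomial_ideal K \<and> J \<noteq> {0} \<and> K \<noteq> {0} \<and>
     I = {a + b | a b. a \<in> J \<and> b \<in> K} \<and>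
     min_gens I = min_gens J \<union> min_gens K \<and> min_gens J \<inter> min_gens K = {} \<and>
     (\<exists>\<phi> \<psi>.
        (\<forall>w\<in>min_gens (J \<inter> K).
           \<phi> w \<in> min_gens J \<and> \<psi> w \<in> min_gens K \<and> w = mono_lcm {\<phi> w, \<psi> w}) \<and>
        (\<forall>S. S \<subseteq> min_gens (J \<inter> K) \<longrightarrow> S \<noteq> {} \<longrightarrow>
           mono_dvd (mono_lcm (\<phi> ` S)) (mono_lcm S) \<and> mono_lcm (\<phi> ` S) \<noteq> mono_lcm S \<and>
           mono_dvd (mono_lcm (\<psi> ` S)) (mono_lcm S) \<and> mono_lcm (\<psi> ` S) \<noteq> mono_lcm S))"


section \<open>Graphs and edge ideals\<close>

record 'v graph =
  verts :: "'v set"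
  edges :: "'v set set"

definition simple_graph :: "'v graph \<Rightarrow> bool" where
  "simple_graph G \<longleftrightarrow> finite (verts G) \<and> (\<forall>e\<in>edges G. e \<subseteq> verts G \<and> card e = 2)"

definition neighbors :: "'v graph \<Rightarrow> 'v \<Rightarrow> 'v set" where
  "neighbors G x = {y. {x, y} \<in> edges G}"

definition delete_edge :: "'v graph \<Rightarrow> 'v set \<Rightarrow> 'v graph" where
  "delete_edge G e = \<lparr>verts = verts G, edges = edges G - {e}\<rparr>"

definition delete_verts :: "'v graph \<Rightarrow> 'v set \<Rightarrow> 'v graph" where
  "delete_verts G S = \<lparr>verts = verts G - S, edges = {e \<in> edges G. e \<inter> S = {}}\<rparr>"

definition complete_bipartite :: "'v set \<Rightarrow> 'v set \<Rightarrow> 'v graph" where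
  "complete_bipartite A B = \<lparr>verts = A \<union> B, edges = {{a, b} | a b. a \<in> A \<and> b \<in> B}\<rparr>"

text \<open>The edge ideal in the polynomial ring whose variables are all elements of \<open>'v\<close>, regardless
  of \<open>verts G\<close>. The first argument only fixes the coefficient field.\<close>

definition edge_ideal :: "'k::field itself \<Rightarrow> 'v::finite graph \<Rightarrow> ('v, 'k) mpoly set" where
  "edge_ideal k G = ideal_gen {var x * var y | x y. {x, y} \<in> edges G}"

definition splitting_edge :: "'k::field itself \<Rightarrow> 'v::finite graph \<Rightarrow> 'v \<Rightarrow> 'v \<Rightarrow> bool" where
  "splitting_edge k G u v \<longleftrightarrow> {u, v} \<in> edges G \<and>
     splitting (edge_ideal k G) (ideal_gen {var u * var v}) (edge_ideal k (delete_edge G {u, v}))"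

definition splitting_vertex :: "'v graph \<Rightarrow> 'v \<Rightarrow> bool" where
  "splitting_vertex G v \<longleftrightarrow>
     v \<in> verts G \<and> 0 < card (neighbors G v) \<and> edges (delete_verts G {v}) \<noteq> {}"

definition nbhd_subgraph :: "'v graph \<Rightarrow> 'v \<Rightarrow> 'v graph" where
  "nbhd_subgraph G v =
     \<lparr>verts = verts G, edges = {e \<in> edges G. e \<inter> neighbors G v \<noteq> {} \<and> v \<notin> e}\<rparr>"

text \<open>The ideal \<open>L = v I(G\<^bsub>(v)\<^esub>) + \<Sum>\<^sub>w v w I(G \ (N(v) \<union> N(w)))\<close>, where \<open>w\<close> ranges over
  \<open>N(v)\<close>; the sum of ideals is the ideal generated by their union.\<close>

definition L_ideal :: "'k::field itself \<Rightarrow> 'v::finite graph \<Rightarrow> 'v \<Rightarrow> ('v, 'k) mpoly set" where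
  "L_ideal k G v = ideal_gen
     ((\<lambda>p. var v * p) ` edge_ideal k (nbhd_subgraph G v) \<union>
      (\<Union>w\<in>neighbors G v. (\<lambda>p. var v * var w * p) `
          edge_ideal k (delete_verts G (neighbors G v \<union> neighbors G w))))"

end

theory Submission
  imports Defs "HOL-Library.FuncSet"
begin

text \<open>Tensoring a graded free resolution of \<open>I\<close> with the Koszul complex of the variables and shifting
  dimensions along the syzygies shows that \<open>\<beta>\<^bsub>i,j\<^esub>(I)\<close> is the dimension of the Koszul homology of \<open>I\<close>,
  whichever resolution is chosen; a resolution with finite ranks exists because the Koszul homology
  of a squarefree monomial ideal vanishes in all but finitely many degrees.

  For \<open>I = J + K\<close>, the Koszul complexes of \<open>J \<inter> K\<close>, \<open>J \<oplus> K\<close> and \<open>I\<close> form a Mayer-Vietoris sequence.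
  If every Koszul cycle of \<open>J \<inter> K\<close> is a boundary in \<open>J\<close> and in \<open>K\<close>, it splits into
  \<open>\<beta>\<^sub>i(I) = \<beta>\<^sub>i(J) + \<beta>\<^sub>i(K) + \<beta>\<^bsub>i-1\<^esub>(J \<inter> K)\<close>. In a multidegree \<open>a\<close>, a cycle \<open>z\<close> is the boundary of the cone
  \<open>e\<^sub>u \<and> z / u\<close> over any variable \<open>u\<close> dividing \<open>a\<close>, so it is enough to find a \<open>u\<close> such that the division
  by \<open>u\<close> leads from \<open>J \<inter> K\<close> into \<open>J\<close> (or \<open>K\<close>).

  For a splitting edge, \<open>J \<inter> K = u v (\<I>(H) + (y | y \<in> W))\<close> with \<open>W = N(u) \<union> N(v) - {u, v}\<close>, where no
  variable in \<open>W\<close> occurs in \<open>\<I>(H)\<close>, and adding such a variable \<open>y\<close> to an ideal \<open>I\<close> changes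
  \<open>\<beta>\<^bsub>i,j\<^esub>(I)\<close> into \<open>\<beta>\<^bsub>i,j\<^esub>(I) + \<beta>\<^bsub>i-1,j-1\<^esub>(I)\<close>. For a splitting vertex, \<open>J \<inter> K = L\<close>.\<close>


section \<open>Finite-dimensional subspaces\<close>

text \<open>\<open>betti\<close> takes an arbitrary resolution by \<open>SOME\<close>, so nothing
  can be read off a particular one, and nothing at all unless one exists. Koszul homology involves
  no choice: over a free module it is exact, so each passage to a syzygy module lowers the
  homological degree by one, until it meets \<open>Tor\<close> in degree 0. The obstacle in the
  splitting formulas is that a cone is a homotopy only if its apex depends on the multidegree alone,
  while many pairs of a coefficient monomial and a wedge share one multidegree. For a splitting
  edge, property (b) of the splitting function, applied to all generators of the intersection that
  divide the multidegree, yields one apex for all pairs. For a splitting vertex no splitting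
  function is given; the apex is found by cases on the multidegree. The restriction to positive
  homological degree in (i) comes from the generator \<open>u v\<close>, which counts only in degree
  0. All Betti numbers are those of the ideal and not of its quotient ring, so the convention at
  index -1 stands for the generator 1 of the quotient ring.\<close>

definition (in vector_space) fin_subspace :: "'b set \<Rightarrow> bool" where
  "fin_subspace V \<longleftrightarrow> subspace V \<and> (\<exists>B. finite B \<and> V \<subseteq> span B)"

context vector_space
begin

lemma fin_subspace_imp_subspace: "fin_subspace V \<Longrightarrow> subspace V"
  by (simp add: fin_subspace_def)

lemma fin_subspace_subset: "fin_subspace V \<Longrightarrow> subspace U \<Longrightarrow> U \<subseteq> V \<Longrightarrow> fin_subspace U"
  unfolding fin_subspace_def by blast

lemma fin_subspace_independent_finite:
  "fin_subspace V \<Longrightarrow> independent B \<Longrightarrow> B \<subseteq> V \<Longrightarrow> finite B"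
  unfolding fin_subspace_def using independent_span_bound[of _ B] by blast

text \<open>On an infinite basis \<open>card\<close>, and with it \<open>dim\<close>, is 0.
  Finiteness is therefore attached to each subspace of the infinite-dimensional function
  spaces.\<close>

lemma fin_subspace_dim_mono:
  assumes "fin_subspace V" "U \<subseteq> V"
  shows "dim U \<le> dim V"
proof -
  obtain B where B: "B \<subseteq> V" "independent B" "V \<subseteq> span B" "card B = dim V"
    by (rule basis_exists)
  have "finite B" using fin_subspace_independent_finite assms(1) B by blast
  then show ?thesis using dim_le_card[of U B] B assms(2) by auto
qed

lemma fin_subspace_sum:
  assumes "fin_subspace A" "fin_subspace B"
  shows "fin_subspace {a + b |a b. a \<in> A \<and> b \<in> B}"
proof -
  obtain SA SB where S: "finite SA" "A \<subseteq> span SA" "finite SB" "B \<subseteq> span SB"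
    using assms unfolding fin_subspace_def by blast
  have "{a + b |a b. a \<in> A \<and> b \<in> B} \<subseteq> span (SA \<union> SB)"
  proof clarify
    fix a b assume "a \<in> A" "b \<in> B"
    then have "a \<in> span (SA \<union> SB)" "b \<in> span (SA \<union> SB)"
      using S span_mono[of SA "SA \<union> SB"] span_mono[of SB "SA \<union> SB"] by auto
    then show "a + b \<in> span (SA \<union> SB)" by (rule span_add)
  qed
  moreover have "finite (SA \<union> SB)" using S by simp
  moreover have "subspace {a + b |a b. a \<in> A \<and> b \<in> B}"
    using subspace_sums assms unfolding fin_subspace_def by simp
  ultimately show ?thesis unfolding fin_subspace_def by blast
qed

end

section \<open>Rank-nullity and dimension counts\<close>

lemma (in vector_space_pair) fin_subspace_image:
  assumes f: "Vector_Spaces.linear s1 s2 f" and V: "vs1.fin_subspace V"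
  shows "vs2.fin_subspace (f ` V)"
proof -
  obtain B where B: "finite B" "V \<subseteq> vs1.span B" using V unfolding vs1.fin_subspace_def by blast
  have "f ` V \<subseteq> vs2.span (f ` B)"
    unfolding linear_span_image[OF f] using B(2) by (rule image_mono)
  moreover have "finite (f ` B)" using B(1) by simp
  moreover have "vs2.subspace (f ` V)"
    by (rule linear_subspace_image[OF f vs1.fin_subspace_imp_subspace[OF V]])
  ultimately show ?thesis
    unfolding vs2.fin_subspace_def by blast
qed

text \<open>A basis \<open>B0\<close> of the kernel is extended to a basis \<open>B\<close> of
  \<open>V\<close>; the added vectors map to a basis of the image.\<close>

lemma (in vector_space_pair) rank_nullity:
  assumes f: "Vector_Spaces.linear s1 s2 f" and V: "vs1.fin_subspace V"
  shows "vs1.dim V = vs2.dim (f ` V) + vs1.dim {x \<in> V. f x = 0}"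
proof -
  let ?K = "{x \<in> V. f x = 0}"
  have sV: "vs1.subspace V" using V vs1.fin_subspace_def by blast
  have sK: "vs1.subspace ?K"
    using vs1.subspace_inter[OF sV linear_subspace_kernel[OF f]] by (simp add: Int_def)
  obtain B0 where B0: "B0 \<subseteq> ?K" "vs1.independent B0" "?K \<subseteq> vs1.span B0" "card B0 = vs1.dim ?K"
    by (rule vs1.basis_exists)
  obtain B where B: "B0 \<subseteq> B" "B \<subseteq> V" "vs1.independent B" "V \<subseteq> vs1.span B"
    using vs1.maximal_independent_subset_extend[of B0 V] B0 by auto
  have finB: "finite B" using vs1.fin_subspace_independent_finite V B by blast
  let ?C = "B - B0"
  have BC: "B = B0 \<union> ?C" using B by blast
  have inter: "x = 0" if x: "x \<in> vs1.span ?C" "f x = 0" for x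
  proof -
    have "x \<in> V" using x vs1.span_minimal[of ?C V] sV B by blast
    then have xB0: "x \<in> vs1.span B0" using x B0 by blast
    \<comment> \<open>The coordinates of \<open>x\<close> in \<open>B\<close> are supported both in
      \<open>B0\<close> and in \<open>?C\<close>, which are disjoint.\<close>
    have "vs1.representation B x = vs1.representation B0 x"
      using vs1.representation_extend[OF B(3) xB0 B(1)] .
    moreover have "vs1.representation B x = vs1.representation ?C x"
      using vs1.representation_extend[OF B(3) x(1)] by blast
    ultimately have "vs1.representation B x = (\<lambda>_. 0)"
      using vs1.representation_ne_zero[of B0 x] vs1.representation_ne_zero[of ?C x] by fastforce
    moreover have "x \<in> vs1.span B" using B \<open>x \<in> V\<close> by blast
    ultimately show "x = 0"
      using vs1.sum_nonzero_representation_eq[OF B(3), of x] by simp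
  qed
  have inj: "inj_on f (vs1.span ?C)"
    using inter linear_inj_on_iff_eq_0[OF f vs1.subspace_span, of ?C] by blast
  have indC: "vs1.independent ?C" using B(3) vs1.independent_mono by blast
  have ind: "vs2.independent (f ` ?C)"
    by (rule linear_independent_injective_image[OF f indC inj])
  have span: "f ` V \<subseteq> vs2.span (f ` ?C)"
  proof
    fix y assume "y \<in> f ` V"
    then obtain x where x: "x \<in> V" "y = f x" by blast
    then have "x \<in> vs1.span (B0 \<union> ?C)" using B BC by auto
    then obtain a b where ab: "x = a + b" "a \<in> vs1.span B0" "b \<in> vs1.span ?C"
      unfolding vs1.span_Un by auto
    have "a \<in> ?K" using ab(2) vs1.span_minimal[OF B0(1) sK] by blast
    then have "y = f b" using x ab linear_add[OF f] by simp
    then show "y \<in> vs2.span (f ` ?C)" using ab(3) linear_span_image[OF f, of ?C] by auto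
  qed
  have "card (f ` ?C) = vs2.dim (f ` V)"
    using vs2.basis_card_eq_dim[OF _ span ind] B by auto
  moreover have "card (f ` ?C) = card ?C"
    using inj vs1.span_superset by (meson card_image inj_on_subset)
  moreover have "card B = vs1.dim V" using vs1.basis_card_eq_dim B by blast
  moreover have "card B = card ?C + card B0"
    using finB B(1) by (metis add.commute card_Diff_subset card_mono finite_subset le_add_diff_inverse)
  ultimately show ?thesis using B0 by simp
qed

lemma (in vector_space_pair) dim_image_of_inj:
  assumes "Vector_Spaces.linear s1 s2 f" "vs1.fin_subspace V" "inj_on f V"
  shows "vs2.dim (f ` V) = vs1.dim V"
proof -
  have "vs1.subspace V" using assms(2) vs1.fin_subspace_def by blast
  then have "{x \<in> V. f x = 0} = {0}"
    using linear_inj_on_iff_eq_0[OF assms(1), of V] assms(3) linear_0[OF assms(1)]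
      vs1.subspace_0 by auto
  then have "vs1.dim {x \<in> V. f x = 0} = 0"
    using vs1.dim_le_card[of "{0}" "{}"] by simp
  then show ?thesis using rank_nullity[OF assms(1,2)] by simp
qed

text \<open>Rank-nullity for a linear map \<open>f\<close> with kernel exactly \<open>B\<close>,
  obtained by killing a basis of \<open>B\<close> and fixing the other vectors of a basis of the
  whole space. It has the same image on \<open>A + B\<close> as on \<open>A\<close>, with kernels
  \<open>B\<close> and \<open>A \<inter> B\<close>.\<close>

lemma (in vector_space) dim_sum_Int:
  assumes A: "fin_subspace A" and B: "fin_subspace B"
  shows "dim {a + b |a b. a \<in> A \<and> b \<in> B} + dim (A \<inter> B) = dim A + dim B"
proof -
  interpret pair: vector_space_pair scale scale ..
  have sA: "subspace A" and sB: "subspace B" using A B fin_subspace_def by auto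
  obtain B0 where B0: "B0 \<subseteq> B" "independent B0" "B \<subseteq> span B0"
    by (rule basis_exists)
  then have B0': "span B0 = B" using span_minimal sB by blast
  obtain E where E: "B0 \<subseteq> E" "independent E" "UNIV \<subseteq> span E"
    using maximal_independent_subset_extend[of B0 UNIV] B0 by auto
  obtain f where f: "Vector_Spaces.linear scale scale f"
    and fE: "\<And>b. b \<in> E \<Longrightarrow> f b = (if b \<in> B0 then 0 else b)"
    using pair.linear_independent_extend[OF E(2), of "\<lambda>b. if b \<in> B0 then 0 else b"] by blast
  have f0: "f x = 0" if "x \<in> B" for x
  proof (rule pair.linear_eq_0_on_span[OF f])
    show "x \<in> span B0" using that B0' by simp
    show "f b = 0" if "b \<in> B0" for b using fE[of b] that E(1) by auto
  qed
  have fker: "x \<in> B" if "f x = 0" for x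
  proof -
    have "x \<in> span (B0 \<union> (E - B0))" using E by (simp add: Un_absorb1) blast
    then obtain a b where ab: "x = a + b" "a \<in> span B0" "b \<in> span (E - B0)"
      unfolding span_Un by auto
    have "f b = b"
      using pair.linear_eq_on[OF f linear_ident ab(3)] fE by auto
    moreover have "f x = f b" using ab pair.linear_add[OF f] f0 B0' by simp
    ultimately show ?thesis using that ab B0' by simp
  qed
  let ?S = "{a + b |a b. a \<in> A \<and> b \<in> B}"
  have "f ` ?S = f ` A"
  proof
    show "f ` ?S \<subseteq> f ` A" using pair.linear_add[OF f] f0 by auto
    have "A \<subseteq> ?S"
    proof
      fix x assume "x \<in> A"
      then show "x \<in> ?S" using subspace_0[OF sB] by (intro CollectI exI[of _ x] exI[of _ 0]) simp
    qed
    then show "f ` A \<subseteq> f ` ?S" by blast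
  qed
  moreover have "{x \<in> ?S. f x = 0} = B"
  proof -
    have "B \<subseteq> ?S"
    proof
      fix x assume "x \<in> B"
      then show "x \<in> ?S" using subspace_0[OF sA] by (intro CollectI exI[of _ 0] exI[of _ x]) simp
    qed
    then show ?thesis using f0 fker by blast
  qed
  moreover have "{x \<in> A. f x = 0} = A \<inter> B" using f0 fker by blast
  ultimately show ?thesis
    using pair.rank_nullity[OF f fin_subspace_sum[OF A B]] pair.rank_nullity[OF f A] by simp
qed

text \<open>A correspondence \<open>\<Gamma>\<close> that induces an isomorphism \<open>Z\<^sub>1/B\<^sub>1 \<cong> Z\<^sub>2/B\<^sub>2\<close>.\<close>

lemma dim_subquotient_eq:
  assumes f: "Vector_Spaces.linear s s1 f" and g: "Vector_Spaces.linear s s2 g"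
    and G: "vector_space.fin_subspace s \<Gamma>"
    and B: "module.subspace s1 B1" "module.subspace s2 B2"
    and BZ: "B1 \<subseteq> f ` \<Gamma>" "B2 \<subseteq> g ` \<Gamma>"
    and fg: "\<And>x. x \<in> \<Gamma> \<Longrightarrow> f x \<in> B1 \<longleftrightarrow> g x \<in> B2"
  shows "vector_space.dim s1 (f ` \<Gamma>) - vector_space.dim s1 B1 =
         vector_space.dim s2 (g ` \<Gamma>) - vector_space.dim s2 B2"
proof -
  interpret f: Vector_Spaces.linear s s1 f by fact
  interpret g: Vector_Spaces.linear s s2 g by fact
  interpret pf: vector_space_pair s s1 ..
  interpret pg: vector_space_pair s s2 ..
  let ?G = "{x \<in> \<Gamma>. f x \<in> B1}"
  have G': "f.vs1.fin_subspace ?G"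
  proof (rule f.vs1.fin_subspace_subset[OF G])
    have "f.vs1.subspace \<Gamma>" using G f.vs1.fin_subspace_def by blast
    then show "f.vs1.subspace ?G"
      using B(1) by (auto simp: f.vs1.subspace_def f.vs2.subspace_def f.add f.scale f.zero)
  qed auto
  have eqf: "{x \<in> ?G. f x = 0} = {x \<in> \<Gamma>. f x = 0}"
    using f.vs2.subspace_0[OF B(1)] by auto
  have eqg: "{x \<in> ?G. g x = 0} = {x \<in> \<Gamma>. g x = 0}"
    using g.vs2.subspace_0[OF B(2)] fg by auto
  have imf: "f ` ?G = B1" using BZ by auto
  have img: "g ` ?G = B2" using BZ fg by auto
  show ?thesis
    using pf.rank_nullity[OF f G] pf.rank_nullity[OF f G'] pg.rank_nullity[OF g G]
      pg.rank_nullity[OF g G'] unfolding eqf eqg imf img by linarith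
qed

text \<open>The hypothesis \<open>null\<close> says that the homology of the intersection maps to
  zero in that of \<open>A\<close> and of \<open>B\<close>, so the long exact sequence falls apart
  into short ones with the homology of \<open>A + B\<close> in the middle. Only dimensions are
  counted; no connecting map is built.\<close>

lemma (in vector_space) Mayer_Vietoris_dims:
  fixes d :: "'b \<Rightarrow> 'b" and A B :: "nat \<Rightarrow> 'b set"
  defines "S \<equiv> \<lambda>p. {a + b |a b. a \<in> A p \<and> b \<in> B p}"
    and "H \<equiv> \<lambda>X p. dim {x \<in> X p. d x = 0} - dim (d ` X (Suc p))"
  assumes d: "Vector_Spaces.linear scale scale d" and dd: "\<And>x. d (d x) = 0"
    and fin: "\<And>p. fin_subspace (A p)" "\<And>p. fin_subspace (B p)"
    and dA: "\<And>p. d ` A (Suc p) \<subseteq> A p" "\<And>x. x \<in> A 0 \<Longrightarrow> d x = 0"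
    and dB: "\<And>p. d ` B (Suc p) \<subseteq> B p" "\<And>x. x \<in> B 0 \<Longrightarrow> d x = 0"
    and null: "\<And>p x. x \<in> A p \<Longrightarrow> x \<in> B p \<Longrightarrow> d x = 0 \<Longrightarrow> x \<in> d ` A (Suc p) \<and> x \<in> d ` B (Suc p)"
  shows "H S p = H A p + H B p + (case p of 0 \<Rightarrow> 0 | Suc q \<Rightarrow> H (\<lambda>i. A i \<inter> B i) q)"
proof -
  interpret pair: vector_space_pair scale scale ..
  let ?z = "\<lambda>X p. dim {x \<in> X p. d x = 0}" and ?b = "\<lambda>X p. dim (d ` X (Suc p))"
  let ?c = "\<lambda>X p. dim (X p)"
  let ?C = "\<lambda>i. A i \<inter> B i"
  have finS: "fin_subspace (S p)" for p unfolding S_def using fin_subspace_sum fin by blast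
  have finC: "fin_subspace (?C p)" for p
    using fin_subspace_subset[OF fin(1)[of p]] fin subspace_inter fin_subspace_def by auto
  have finim: "fin_subspace (d ` X)" if "fin_subspace X" for X
    using pair.fin_subspace_image[OF d] that by blast
  have dC: "d ` ?C (Suc p) \<subseteq> ?C p" for p using dA dB by blast
  have dS: "d ` S (Suc p) = {a + b |a b. a \<in> d ` A (Suc p) \<and> b \<in> d ` B (Suc p)}" (is "?L = ?R") for p
  proof
    show "?L \<subseteq> ?R" unfolding S_def using pair.linear_add[OF d] by blast
    show "?R \<subseteq> ?L"
    proof
      fix x assume "x \<in> ?R"
      then obtain a b where ab: "a \<in> A (Suc p)" "b \<in> B (Suc p)" "x = d a + d b" by blast
      then have "x = d (a + b)" using pair.linear_add[OF d] by simp
      then show "x \<in> ?L" unfolding S_def using ab by blast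
    qed
  qed
  \<comment> \<open>Nullity is used here: the two boundary spaces meet in all cycles of the
    intersection, not only in some of them.\<close>
  have Int: "d ` A (Suc p) \<inter> d ` B (Suc p) = {x \<in> ?C p. d x = 0}" for p
    using dA(1)[of p] dB(1)[of p] dd null by blast
  have cS: "?c S p + ?c ?C p = ?c A p + ?c B p" for p
    unfolding S_def using dim_sum_Int fin by blast
  have bS: "?b S p + ?z ?C p = ?b A p + ?b B p" for p
    using dim_sum_Int[OF finim[OF fin(1)] finim[OF fin(2)], of "Suc p" "Suc p"]
    unfolding dS Int .
  have rn: "fin_subspace (X (Suc p)) \<Longrightarrow> ?c X (Suc p) = ?b X p + ?z X (Suc p)" for p and X :: "nat \<Rightarrow> 'b set"
    using pair.rank_nullity[OF d, of "X (Suc p)"] by simp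
  \<comment> \<open>The differences in \<open>H\<close> are truncated, so boundaries have to be
    compared with cycles before the equations can be added.\<close>
  have bz: "?b X p \<le> ?z X p" if "\<And>p. fin_subspace (X p)" "\<And>p. d ` X (Suc p) \<subseteq> X p" for p and X :: "nat \<Rightarrow> 'b set"
  proof (rule fin_subspace_dim_mono)
    show "fin_subspace {x \<in> X p. d x = 0}"
      by (rule fin_subspace_subset[OF that(1)[of p]])
        (use fin_subspace_imp_subspace[OF that(1)[of p]] in
          \<open>auto simp: subspace_def pair.linear_add[OF d] pair.linear_scale[OF d] pair.linear_0[OF d]\<close>)
    show "d ` X (Suc p) \<subseteq> {x \<in> X p. d x = 0}" using that(2) dd by blast
  qed
  have dS': "d ` S (Suc p) \<subseteq> S p" for p
    unfolding dS using dA(1)[of p] dB(1)[of p] unfolding S_def by blast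
  have bzs: "?b A p \<le> ?z A p" "?b B p \<le> ?z B p" "?b ?C p \<le> ?z ?C p" "?b S p \<le> ?z S p" for p
    using bz[of A p] bz[of B p] bz[of ?C p] bz[of S p] fin dA dB finC dC finS dS' by blast+
  show ?thesis
  proof (cases p)
    case 0
    have z0: "{x \<in> A 0. d x = 0} = A 0" "{x \<in> B 0. d x = 0} = B 0"
      "{x \<in> ?C 0. d x = 0} = ?C 0" "{x \<in> S 0. d x = 0} = S 0"
      unfolding S_def using dA(2) dB(2) pair.linear_add[OF d] by auto
    show ?thesis
      using bzs[of 0] bS[of 0] cS[of 0] unfolding H_def 0 z0 by simp
  next
    case (Suc q)
    then show ?thesis
      using bzs[of p] bzs[of q] bS[of p] cS[of p] bS[of q]
        rn[of A q, OF fin(1)] rn[of B q, OF fin(2)] rn[of ?C q, OF finC] rn[of S q, OF finS]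
      unfolding H_def by simp
  qed
qed



section \<open>Monomials\<close>

abbreviation "lookup \<equiv> Poly_Mapping.lookup"
abbreviation "keys \<equiv> Poly_Mapping.keys"

declare One_nat_def [simp del]

lemma mono_dvd_iff: "mono_dvd s t \<longleftrightarrow> (\<forall>x. lookup s x \<le> lookup t x)"
proof
  assume "\<forall>x. lookup s x \<le> lookup t x"
  then have "t = s + (t - s)"
    by (intro poly_mapping_eqI) (simp add: lookup_add lookup_minus)
  then show "mono_dvd s t" unfolding mono_dvd_def by blast
qed (auto simp: mono_dvd_def lookup_add)

lemma mono_dvd_refl [simp]: "mono_dvd s s"
  by (simp add: mono_dvd_iff)

lemma mono_dvd_trans: "mono_dvd s t \<Longrightarrow> mono_dvd t u \<Longrightarrow> mono_dvd s u"
  by (meson mono_dvd_iff order_trans)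

lemma mono_deg_eq_sum_UNIV: "mono_deg (t :: 'v::finite mono) = (\<Sum>x\<in>UNIV. lookup t x)"
  unfolding mono_deg_def by (rule sum.mono_neutral_left) (auto simp: in_keys_iff)

lemma mono_deg_add: "mono_deg (s + t) = mono_deg s + mono_deg (t :: 'v::finite mono)"
  by (simp add: mono_deg_eq_sum_UNIV lookup_add sum.distrib)

lemma mono_deg_zero [simp]: "mono_deg 0 = 0"
  by (simp add: mono_deg_def)

lemma mono_deg_single [simp]: "mono_deg (Poly_Mapping.single (w :: 'v::finite) n) = n"
  by (simp add: mono_deg_eq_sum_UNIV lookup_single when_def)

lemma mono_deg_eq_0_iff: "mono_deg (t :: 'v::finite mono) = 0 \<longleftrightarrow> t = 0"
  by (auto simp: mono_deg_eq_sum_UNIV intro: poly_mapping_eqI)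

text \<open>Both the squarefree monomial with support \<open>\<sigma>\<close> and the multidegree of
  the wedge over \<open>\<sigma>\<close>; a coefficient monomial \<open>t\<close> at
  \<open>\<sigma>\<close> has multidegree \<open>t + indicator_mono \<sigma>\<close>.\<close>

definition indicator_mono :: "'v::finite set \<Rightarrow> 'v mono" where
  "indicator_mono \<sigma> = (\<Sum>w\<in>\<sigma>. Poly_Mapping.single w 1)"

lemma lookup_indicator_mono: "lookup (indicator_mono \<sigma>) x = (if x \<in> \<sigma> then 1 else 0)"
  by (simp add: indicator_mono_def lookup_sum lookup_single when_def)

lemma mono_deg_indicator_mono: "mono_deg (indicator_mono \<sigma>) = card \<sigma>"
  by (simp add: mono_deg_eq_sum_UNIV lookup_indicator_mono flip: sum.inter_filter)

lemma finite_mono_deg_eq: "finite {t :: 'v::finite mono. mono_deg t = d}"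
proof -
  have "lookup ` {t :: 'v mono. mono_deg t = d} \<subseteq> (UNIV \<rightarrow>\<^sub>E {..d})"
  proof clarify
    fix t :: "'v mono" assume d: "d = mono_deg t"
    have "lookup t x \<le> mono_deg t" for x
      unfolding mono_deg_eq_sum_UNIV by (rule member_le_sum) auto
    then show "lookup t \<in> UNIV \<rightarrow>\<^sub>E {..mono_deg t}" by auto
  qed
  moreover have "finite (UNIV \<rightarrow>\<^sub>E {..d} :: ('v \<Rightarrow> nat) set)"
    by (rule finite_PiE) auto
  ultimately have "finite (lookup ` {t :: 'v mono. mono_deg t = d})"
    by (rule finite_subset)
  moreover have "inj_on lookup {t :: 'v mono. mono_deg t = d}"
    by (rule inj_onI) (rule poly_mapping_eqI, simp)
  ultimately show ?thesis by (rule finite_imageD)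
qed

lemma lookup_single_mult_add:
  "lookup (Poly_Mapping.single s c * p) (s + u) = c * lookup p (u :: 'v mono)"
proof -
  have "lookup (Poly_Mapping.single s c * p) (s + u) =
      (\<Sum>l. (c when s = l) * (\<Sum>q. lookup p q when s + u = l + q))"
    unfolding lookup_mult lookup_single ..
  also have "\<dots> = (\<Sum>l. (c * (\<Sum>q. lookup p q when s + u = s + q)) when l = s)"
    by (rule Sum_any.cong) (auto simp: when_def)
  also have "\<dots> = c * lookup p u" by simp
  finally show ?thesis .
qed

lemma lookup_single_mult_not_dvd:
  fixes s t :: "'a mono"
  assumes "\<not> mono_dvd s t"
  shows "lookup (Poly_Mapping.single s c * p) t = 0"
proof -
  have "lookup (Poly_Mapping.single s c * p) t =
      (\<Sum>l. (c when s = l) * (\<Sum>q. lookup p q when t = l + q))"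
    unfolding lookup_mult lookup_single ..
  also have "\<dots> = (\<Sum>l::'a mono. 0)"
  proof (rule Sum_any.cong)
    show "(c when s = l) * (\<Sum>q. lookup p q when t = l + q) = 0" for l
      using assms by (cases "s = l") (simp_all add: when_def mono_dvd_def)
  qed
  finally show ?thesis by simp
qed

lemma lookup_const_mult [simp]: "lookup (Poly_Mapping.single 0 c * p) (t :: 'v mono) = c * lookup p t"
  using lookup_single_mult_add[of 0 c p t] by simp

lemma lookup_var_mult:
  "lookup (Poly_Mapping.single (Poly_Mapping.single w 1) c * p) (t :: 'v mono) =
     (if lookup t w = 0 then 0 else c * lookup p (t - Poly_Mapping.single w 1))"
proof (cases "lookup t w = 0")
  case True
  then have "\<not> mono_dvd (Poly_Mapping.single w 1) t"
    unfolding mono_dvd_iff by (intro notI) (auto dest!: spec[of _ w] simp: lookup_single)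
  then show ?thesis using True by (simp add: lookup_single_mult_not_dvd)
next
  case False
  then have "t = Poly_Mapping.single w 1 + (t - Poly_Mapping.single w 1)"
    by (intro poly_mapping_eqI) (auto simp: lookup_add lookup_minus lookup_single when_def)
  then show ?thesis
    using lookup_single_mult_add[of "Poly_Mapping.single w 1" c p "t - Poly_Mapping.single w 1"] False
    by simp
qed

text \<open>The exponent vector 0 is a sum only as 0 + 0. Hence reducing a matrix to its constant
  coefficients, as \<open>tor_diff\<close> does, is compatible with applying it.\<close>

lemma lookup_times_zero:
  fixes p q :: "('v, 'k::field) mpoly"
  shows "lookup (p * q) 0 = lookup p 0 * lookup q 0"
proof -
  have zero: "0 = l + m \<longleftrightarrow> l = 0 \<and> m = 0" for l m :: "'v mono"
    by (auto simp: poly_mapping_eq_iff plus_poly_mapping.rep_eq fun_eq_iff)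
  have "lookup (p * q) 0 = (\<Sum>l. lookup p l * (\<Sum>m. lookup q m when 0 = l + m))"
    by (simp add: lookup_mult)
  also have "\<dots> = (\<Sum>l::'v mono. (lookup p 0 * (\<Sum>m::'v mono. lookup q 0 when m = 0)) when l = 0)"
  proof (rule Sum_any.cong)
    show "lookup p l * (\<Sum>m. lookup q m when 0 = l + m) =
        (lookup p 0 * (\<Sum>m::'v mono. lookup q 0 when m = 0) when l = 0)" for l
      by (cases "l = 0") (simp_all add: zero)
  qed
  finally show ?thesis by simp
qed


section \<open>The Koszul complex\<close>

text \<open>A Koszul chain with coefficients in a free module assigns a vector of polynomials to each set
  \<open>\<sigma>\<close> of variables, the coefficient of \<open>\<And>\<^bsub>w\<in>\<sigma>\<^esub> e\<^sub>w\<close>. Signs refer to an arbitrary numbering of the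
  variables.\<close>

definition var_index :: "'v::finite \<Rightarrow> nat" where
  "var_index = (SOME f. inj f)"

lemma inj_var_index: "inj (var_index :: 'v::finite \<Rightarrow> nat)"
proof -
  have "\<exists>f :: 'v \<Rightarrow> nat. inj f"
    using finite_imp_inj_to_nat_seg[OF finite_UNIV] by metis
  then show ?thesis unfolding var_index_def by (rule someI_ex)
qed

definition koszul_sign :: "'v::finite \<Rightarrow> 'v set \<Rightarrow> 'k::field" where
  "koszul_sign w \<tau> = (- 1) ^ card {t \<in> \<tau>. var_index t < var_index w}"

lemma koszul_sign_insert:
  assumes "u \<notin> \<tau>"
  shows "koszul_sign w (insert u \<tau>) =
    (if var_index u < var_index w then - koszul_sign w \<tau> else (koszul_sign w \<tau> :: 'k::field))"
proof (cases "var_index u < var_index w")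
  case True
  then have "{t \<in> insert u \<tau>. var_index t < var_index w} = insert u {t \<in> \<tau>. var_index t < var_index w}"
    by auto
  then show ?thesis using True assms by (simp add: koszul_sign_def)
next
  case False
  then have "{t \<in> insert u \<tau>. var_index t < var_index w} = {t \<in> \<tau>. var_index t < var_index w}"
    by auto
  then show ?thesis using False by (simp add: koszul_sign_def)
qed

lemma koszul_sign_square [simp]: "koszul_sign w \<tau> * koszul_sign w \<tau> = (1 :: 'k::field)"
  by (simp add: koszul_sign_def flip: power_mult_distrib)

lemma koszul_sign_anticommute:
  assumes "u \<notin> \<tau>" "w \<notin> \<tau>" "u \<noteq> w"
  shows "koszul_sign w \<tau> * koszul_sign u (insert w \<tau>) =
    - (koszul_sign u \<tau> * koszul_sign w (insert u \<tau>) :: 'k::field)"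
  using assms injD[OF inj_var_index, of u w]
  by (auto simp: koszul_sign_insert mult.commute)

lemma koszul_sign_anticommute':
  assumes "u \<notin> \<tau>" "w \<notin> \<tau>" "u \<noteq> w"
  shows "koszul_sign w (insert u \<tau>) * koszul_sign u (insert w \<tau>) =
    - (koszul_sign u \<tau> * koszul_sign w \<tau> :: 'k::field)"
  using assms injD[OF inj_var_index, of u w]
  by (auto simp: koszul_sign_insert mult.commute)

definition koszul_diff :: "('v::finite set \<Rightarrow> nat \<Rightarrow> ('v, 'k::field) mpoly) \<Rightarrow> 'v set \<Rightarrow> nat \<Rightarrow> ('v, 'k) mpoly"
  where "koszul_diff z = (\<lambda>\<tau> b. \<Sum>w\<in>-\<tau>.
    Poly_Mapping.single (Poly_Mapping.single w 1) (koszul_sign w \<tau>) * z (insert w \<tau>) b)"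

lemma koszul_diff_zero [simp]: "koszul_diff 0 = 0"
  by (simp add: koszul_diff_def fun_eq_iff)

lemma koszul_diff_add: "koszul_diff (x + y) = koszul_diff x + koszul_diff y"
  by (simp add: koszul_diff_def fun_eq_iff distrib_left sum.distrib)

lemma koszul_diff_diff: "koszul_diff (x - y) = koszul_diff x - koszul_diff y"
  by (simp add: koszul_diff_def fun_eq_iff right_diff_distrib sum_subtractf fun_diff_def)

lemma lookup_koszul_diff:
  "lookup (koszul_diff z \<tau> b) t = (\<Sum>w\<in>-\<tau>. if lookup t w = 0 then 0 else
     koszul_sign w \<tau> * lookup (z (insert w \<tau>) b) (t - Poly_Mapping.single w 1))"
  by (simp add: koszul_diff_def lookup_sum lookup_var_mult)

text \<open>The terms at \<open>(u, w)\<close> and \<open>(w, u)\<close> cancel in pairs. The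
  shortcut that the sum equals its own negative would prove nothing in characteristic 2.\<close>

lemma sum_antisymmetric_eq_0:
  fixes f :: "'a::finite \<Rightarrow> 'a \<Rightarrow> 'b::ab_group_add"
  assumes "\<And>u w. u \<in> A \<Longrightarrow> w \<in> A \<Longrightarrow> u \<noteq> w \<Longrightarrow> f u w = - f w u"
  shows "(\<Sum>u\<in>A. \<Sum>w\<in>A - {u}. f u w) = 0"
proof -
  let ?L = "{(u, w). u \<in> A \<and> w \<in> A \<and> var_index u < var_index w}"
  let ?R = "{(u, w). u \<in> A \<and> w \<in> A \<and> var_index w < var_index u}"
  have eq: "Sigma A (\<lambda>u. A - {u}) = ?L \<union> ?R"
  proof -
    have "var_index u < var_index w \<or> var_index w < var_index u" if "u \<noteq> w" for u w :: 'a
      using that injD[OF inj_var_index, of u w] by (meson linorder_neqE_nat)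
    then show ?thesis by auto
  qed
  have "(\<Sum>u\<in>A. \<Sum>w\<in>A - {u}. f u w) = sum (\<lambda>(u, w). f u w) (?L \<union> ?R)"
    by (subst sum.Sigma) (auto simp: eq)
  also have "\<dots> = sum (\<lambda>(u, w). f u w) ?L + sum (\<lambda>(u, w). f u w) ?R"
    by (rule sum.union_disjoint) auto
  also have "sum (\<lambda>(u, w). f u w) ?R = sum (\<lambda>(u, w). - f u w) ?L"
  proof -
    have R: "?R = prod.swap ` ?L" by (auto simp: image_def)
    have "sum (\<lambda>(u, w). f u w) ?R = sum (\<lambda>(u, w). f w u) ?L"
      unfolding R by (subst sum.reindex) (auto simp: inj_on_def intro!: sum.cong)
    also have "\<dots> = sum (\<lambda>(u, w). - f u w) ?L"
    proof (rule sum.cong)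
      fix x assume x: "x \<in> ?L"
      obtain u w where [simp]: "x = (u, w)" by fastforce
      have "f w u = - f u w" using x by (intro assms) auto
      then show "(case x of (u, w) \<Rightarrow> f w u) = (case x of (u, w) \<Rightarrow> - f u w)" by simp
    qed simp
    finally show ?thesis .
  qed
  also have "\<dots> = - sum (\<lambda>(u, w). f u w) ?L"
    by (simp add: case_prod_unfold sum_negf)
  finally show ?thesis by simp
qed

lemma koszul_diff_koszul_diff [simp]: "koszul_diff (koszul_diff z) = 0"
proof (intro ext)
  fix \<tau> :: "'a set" and b :: nat
  let ?x = "\<lambda>w \<tau>. Poly_Mapping.single (Poly_Mapping.single w 1) (koszul_sign w \<tau>) :: ('a, 'b) mpoly"
  let ?f = "\<lambda>u w. ?x u \<tau> * (?x w (insert u \<tau>) * z (insert w (insert u \<tau>)) b)"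
  have "koszul_diff (koszul_diff z) \<tau> b = (\<Sum>u\<in>-\<tau>. \<Sum>w\<in>-\<tau> - {u}. ?f u w)"
    by (auto simp: koszul_diff_def sum_distrib_left intro!: sum.cong)
  also have "\<dots> = 0"
  proof (rule sum_antisymmetric_eq_0)
    fix u w assume uw: "u \<in> -\<tau>" "w \<in> -\<tau>" "u \<noteq> w"
    have "?x u \<tau> * ?x w (insert u \<tau>) = - (?x w \<tau> * ?x u (insert w \<tau>))"
      using koszul_sign_anticommute[of w \<tau> u, where 'k = 'b] uw
      by (simp add: mult_single single_uminus add.commute)
    then show "?f u w = - ?f w u"
      by (simp add: insert_commute flip: mult.assoc)
  qed
  finally show "koszul_diff (koszul_diff z) \<tau> b = 0 \<tau> b" by simp
qed

text \<open>The wedge product with \<open>e\<^sub>u\<close>, divided by the variable \<open>u\<close>, where \<open>u = U a\<close> may depend on the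
  multidegree \<open>a\<close>.\<close>

definition koszul_cone :: "('v::finite mono \<Rightarrow> 'v) \<Rightarrow> ('v set \<Rightarrow> nat \<Rightarrow> ('v, 'k::field) mpoly) \<Rightarrow>
    'v set \<Rightarrow> nat \<Rightarrow> ('v, 'k) mpoly" where
  "koszul_cone U z = (\<lambda>\<sigma> b. Abs_poly_mapping (\<lambda>t.
     let u = U (t + indicator_mono \<sigma>) in
     if u \<in> \<sigma> then koszul_sign u (\<sigma> - {u}) * lookup (z (\<sigma> - {u}) b) (t + Poly_Mapping.single u 1)
     else 0))"

lemma lookup_koszul_cone:
  "lookup (koszul_cone U z \<sigma> b) t =
    (let u = U (t + indicator_mono \<sigma>) in
     if u \<in> \<sigma> then koszul_sign u (\<sigma> - {u}) * lookup (z (\<sigma> - {u}) b) (t + Poly_Mapping.single u 1)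
     else 0)"
proof -
  let ?g = "\<lambda>t. let u = U (t + indicator_mono \<sigma>) in
     if u \<in> \<sigma> then koszul_sign u (\<sigma> - {u}) * lookup (z (\<sigma> - {u}) b) (t + Poly_Mapping.single u 1)
     else 0"
  \<comment> \<open>\<open>Abs_poly_mapping\<close> is meaningful only for finite support. The apex
    varies with \<open>t\<close>, but there are finitely many variables, and each contributes
    shifted monomials of one coefficient of \<open>z\<close>.\<close>
  have "{t. ?g t \<noteq> 0} \<subseteq> (\<Union>u. (\<lambda>t. t - Poly_Mapping.single u 1) ` keys (z (\<sigma> - {u}) b))"
  proof
    fix t assume "t \<in> {t. ?g t \<noteq> 0}"
    then have "t + Poly_Mapping.single (U (t + indicator_mono \<sigma>)) 1 \<in>
        keys (z (\<sigma> - {U (t + indicator_mono \<sigma>)}) b)"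
      by (auto simp: Let_def in_keys_iff split: if_splits)
    moreover have "t = (t + Poly_Mapping.single u 1) - Poly_Mapping.single u 1" for u
      by simp
    ultimately show "t \<in> (\<Union>u. (\<lambda>t. t - Poly_Mapping.single u 1) ` keys (z (\<sigma> - {u}) b))"
      by blast
  qed
  then have "finite {t. ?g t \<noteq> 0}" by (rule finite_subset) simp
  then show ?thesis unfolding koszul_cone_def by (subst lookup_Abs_poly_mapping) auto
qed

text \<open>The differential preserves the multidegree, so on each multidegree the apex is a fixed
  variable \<open>u\<close>, and wedging with its generator and dividing by \<open>u\<close> is the
  usual contraction of a Koszul complex in which \<open>u\<close> is invertible. The hypothesis on
  \<open>U\<close> makes the division possible where it is needed.\<close>

lemma koszul_cone_homotopy:
  fixes z :: "'v::finite set \<Rightarrow> nat \<Rightarrow> ('v, 'k::field) mpoly"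
  assumes U: "\<And>\<sigma> b t. lookup (z \<sigma> b) t \<noteq> 0 \<Longrightarrow>
    lookup (t + indicator_mono \<sigma>) (U (t + indicator_mono \<sigma>)) \<noteq> 0"
  shows "koszul_diff (koszul_cone U z) + koszul_cone U (koszul_diff z) = z"
proof (intro ext poly_mapping_eqI)
  fix \<tau> b t
  define u where "u = U (t + indicator_mono \<tau>)"
  let ?v = "\<lambda>w. Poly_Mapping.single w (1::nat)"
  have deg1: "(t - ?v w) + indicator_mono (insert w \<tau>) = t + indicator_mono \<tau>"
    if "w \<in> -\<tau>" "lookup t w \<noteq> 0" for w
    using that by (intro poly_mapping_eqI)
      (auto simp: lookup_add lookup_minus lookup_single lookup_indicator_mono when_def)
  let ?A = "\<lambda>w. koszul_sign w \<tau> * (if u \<in> insert w \<tau>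
    then koszul_sign u (insert w \<tau> - {u}) * lookup (z (insert w \<tau> - {u}) b) (t - ?v w + ?v u) else 0)"
  have 1: "lookup (koszul_diff (koszul_cone U z) \<tau> b) t =
      (\<Sum>w\<in>-\<tau>. if lookup t w = 0 then 0 else ?A w)"
    unfolding lookup_koszul_diff lookup_koszul_cone
    by (rule sum.cong) (use deg1 in \<open>auto simp: Let_def u_def\<close>)
  have 2: "lookup (koszul_cone U (koszul_diff z) \<tau> b) t = (if u \<in> \<tau> then
      koszul_sign u (\<tau> - {u}) * lookup (koszul_diff z (\<tau> - {u}) b) (t + ?v u) else 0)"
    unfolding lookup_koszul_cone by (simp add: Let_def u_def)
  show "lookup ((koszul_diff (koszul_cone U z) + koszul_cone U (koszul_diff z)) \<tau> b) t = lookup (z \<tau> b) t"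
  proof (cases "u \<in> \<tau>")
    case False
    \<comment> \<open>Only \<open>w = u\<close> puts \<open>u\<close> into
      \<open>insert w \<tau>\<close>; the cone of the boundary has no term here, as
      \<open>u \<notin> \<tau>\<close>.\<close>
    have "(\<Sum>w\<in>-\<tau>. if lookup t w = 0 then 0 else ?A w) =
        (\<Sum>w\<in>{u}. if lookup t w = 0 then 0 else ?A w)"
      by (rule sum.mono_neutral_right) (use False in auto)
    also have "\<dots> = lookup (z \<tau> b) t"
    proof (cases "lookup t u = 0")
      case True
      then have "lookup (t + indicator_mono \<tau>) u = 0"
        using False by (simp add: lookup_add lookup_indicator_mono)
      then show ?thesis using True U[of \<tau> b t] u_def by auto
    next
      case ne: False
      then have "t - ?v u + ?v u = t"
        by (intro poly_mapping_eqI) (auto simp: lookup_add lookup_minus lookup_single when_def)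
      moreover have "insert u \<tau> - {u} = \<tau>" using False by auto
      ultimately show ?thesis using ne by (simp flip: mult.assoc)
    qed
    finally show ?thesis using 1 2 False by (simp add: lookup_add)
  next
    case True
    define \<rho> where "\<rho> = \<tau> - {u}"
    have \<tau>: "\<tau> = insert u \<rho>" "u \<notin> \<rho>" using True by (auto simp: \<rho>_def)
    \<comment> \<open>The summand \<open>w = u\<close> returns \<open>z\<close>; the others are the
      negatives of the terms in the boundary of the cone.\<close>
    have "lookup (koszul_diff z \<rho> b) (t + ?v u) =
        (\<Sum>w\<in>insert u (-\<tau>). if lookup (t + ?v u) w = 0 then 0 else
          koszul_sign w \<rho> * lookup (z (insert w \<rho>) b) (t + ?v u - ?v w))"
      unfolding lookup_koszul_diff by (rule sum.cong) (auto simp: \<tau>)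
    also have "\<dots> = koszul_sign u \<rho> * lookup (z \<tau> b) t + (\<Sum>w\<in>-\<tau>. if lookup t w = 0 then 0 else
          koszul_sign w \<rho> * lookup (z (insert w \<rho>) b) (t + ?v u - ?v w))"
      using True by (subst sum.insert)
        (auto simp: lookup_add lookup_single when_def \<tau>(1)[symmetric] intro!: sum.cong)
    finally have "koszul_sign u \<rho> * lookup (koszul_diff z \<rho> b) (t + ?v u) =
        (koszul_sign u \<rho> * koszul_sign u \<rho>) * lookup (z \<tau> b) t + (\<Sum>w\<in>-\<tau>. koszul_sign u \<rho> *
          (if lookup t w = 0 then 0 else
          koszul_sign w \<rho> * lookup (z (insert w \<rho>) b) (t + ?v u - ?v w)))"
      by (simp only: distrib_left sum_distrib_left mult.assoc)
    also have "\<dots> = lookup (z \<tau> b) t + (\<Sum>w\<in>-\<tau>. if lookup t w = 0 then 0 else - ?A w)"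
    proof -
      have "koszul_sign u \<rho> * (if lookup t w = 0 then 0 else
          koszul_sign w \<rho> * lookup (z (insert w \<rho>) b) (t + ?v u - ?v w)) =
          (if lookup t w = 0 then 0 else - ?A w)" if w: "w \<in> -\<tau>" for w
      proof -
        have [simp]: "insert w \<tau> - {u} = insert w \<rho>" using w \<tau> by auto
        have "t + ?v u - ?v w = t - ?v w + ?v u" if "lookup t w \<noteq> 0"
          using that w True by (intro poly_mapping_eqI)
            (auto simp: lookup_add lookup_minus lookup_single when_def)
        moreover have "koszul_sign w \<tau> * koszul_sign u (insert w \<rho>) = - (koszul_sign u \<rho> * koszul_sign w \<rho> :: 'k)"
          unfolding \<tau>(1) using w \<tau> by (intro koszul_sign_anticommute') auto
        ultimately show ?thesis using True by (simp flip: mult.assoc)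
      qed
      then show ?thesis
        unfolding koszul_sign_square mult_1_left
        by (intro arg_cong2[of _ _ _ _ "(+)"] refl sum.cong)
    qed
    also have "(\<Sum>w\<in>-\<tau>. if lookup t w = 0 then 0 else - ?A w) =
        - (\<Sum>w\<in>-\<tau>. if lookup t w = 0 then 0 else ?A w)"
      unfolding sum_negf[symmetric] by (rule sum.cong) auto
    finally show ?thesis
      using 1 2 True by (simp add: lookup_add \<rho>_def)
  qed
qed



section \<open>Graded modules\<close>

lemma sum_fun_apply: "(\<Sum>i\<in>A. f i) x = (\<Sum>i\<in>A. f i x)"
  by (induction A rule: infinite_finite_induct) auto

lemma homogeneous_iff: "homogeneous d p \<longleftrightarrow> (\<forall>t. lookup p t \<noteq> 0 \<longrightarrow> int (mono_deg t) = d)"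
  by (auto simp: homogeneous_def in_keys_iff)

lemma homogeneous_zero [simp]: "homogeneous d 0"
  by (simp add: homogeneous_iff)

lemma homogeneous_add: "homogeneous d p \<Longrightarrow> homogeneous d q \<Longrightarrow> homogeneous d (p + q)"
  unfolding homogeneous_iff lookup_add by (metis add.left_neutral)

lemma homogeneous_mult:
  fixes p q :: "('v::finite, 'k::field) mpoly"
  assumes "homogeneous d p" "homogeneous e q"
  shows "homogeneous (d + e) (p * q)"
  unfolding homogeneous_def
proof
  fix t assume "t \<in> keys (p * q)"
  then obtain a b where "t = a + b" "a \<in> keys p" "b \<in> keys q"
    using keys_mult[of p q] by blast
  then show "int (mono_deg t) = d + e"
    using assms unfolding homogeneous_def by (simp add: mono_deg_add)
qed

section \<open>Homogeneous components\<close>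

definition restrict_poly :: "'v mono set \<Rightarrow> ('v, 'k::field) mpoly \<Rightarrow> ('v, 'k) mpoly" where
  "restrict_poly M p = Abs_poly_mapping (\<lambda>t. if t \<in> M then lookup p t else 0)"

lemma lookup_restrict_poly: "lookup (restrict_poly M p) t = (if t \<in> M then lookup p t else 0)"
proof -
  have "{t. (if t \<in> M then lookup p t else 0) \<noteq> 0} \<subseteq> keys p"
    by (auto simp: in_keys_iff)
  then have "finite {t. (if t \<in> M then lookup p t else 0) \<noteq> 0}"
    by (rule finite_subset) simp
  then show ?thesis by (simp add: restrict_poly_def)
qed

definition hom_component :: "int \<Rightarrow> ('v, 'k::field) mpoly \<Rightarrow> ('v, 'k) mpoly" where
  "hom_component d p = restrict_poly {t. int (mono_deg t) = d} p"

lemma lookup_hom_component: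
  "lookup (hom_component d p) t = (if int (mono_deg t) = d then lookup p t else 0)"
  by (simp add: hom_component_def lookup_restrict_poly)

lemma hom_component_zero [simp]: "hom_component d 0 = 0"
  by (intro poly_mapping_eqI) (simp add: lookup_hom_component)

lemma hom_component_add: "hom_component d (p + q) = hom_component d p + hom_component d q"
  by (intro poly_mapping_eqI) (simp add: lookup_hom_component lookup_add)

lemma hom_component_sum: "hom_component d (sum f A) = (\<Sum>i\<in>A. hom_component d (f i))"
  by (induction A rule: infinite_finite_induct) (auto simp: hom_component_add)

lemma homogeneous_hom_component: "homogeneous d (hom_component d p)"
  by (simp add: homogeneous_iff lookup_hom_component)

lemma hom_component_homogeneous: "homogeneous d p \<Longrightarrow> hom_component d p = p"
  by (intro poly_mapping_eqI) (auto simp: homogeneous_iff lookup_hom_component)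

lemma hom_component_mult:
  fixes p h :: "('v::finite, 'k::field) mpoly"
  assumes h: "homogeneous e h"
  shows "hom_component d (h * p) = h * hom_component (d - e) p"
proof -
  define q where "q = p - hom_component (d - e) p"
  have "hom_component d (h * q) = 0"
  proof (rule poly_mapping_eqI)
    fix t
    have "t \<notin> keys (h * q)" if "int (mono_deg t) = d"
    proof
      assume "t \<in> keys (h * q)"
      then obtain a b where ab: "t = a + b" "a \<in> keys h" "b \<in> keys q"
        using keys_mult[of h q] by blast
      then have "int (mono_deg b) = d - e"
        using that h unfolding homogeneous_def by (simp add: mono_deg_add)
      then show False using ab(3) by (simp add: in_keys_iff q_def lookup_minus lookup_hom_component)
    qed
    then show "lookup (hom_component d (h * q)) t = lookup 0 t"
      by (auto simp: lookup_hom_component in_keys_iff)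
  qed
  moreover have "homogeneous d (h * hom_component (d - e) p)"
    using homogeneous_mult[OF h homogeneous_hom_component, of "d - e" p] by simp
  moreover have "h * p = h * q + h * hom_component (d - e) p"
    by (simp add: q_def distrib_left right_diff_distrib)
  ultimately show ?thesis by (simp add: hom_component_add hom_component_homogeneous)
qed

text \<open>Component of degree \<open>j\<close> of an element of \<open>\<Oplus>\<^sub>b R(- s b)\<close>.\<close>

definition vec_component :: "(nat \<Rightarrow> int) \<Rightarrow> int \<Rightarrow> (nat \<Rightarrow> ('v, 'k::field) mpoly) \<Rightarrow> nat \<Rightarrow> ('v, 'k) mpoly"
  where "vec_component s j x = (\<lambda>b. hom_component (j - s b) (x b))"

lemma vec_component_homogeneous:
  "(\<And>b. homogeneous (j - s b) (x b)) \<Longrightarrow> vec_component s j x = x"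
  by (simp add: vec_component_def hom_component_homogeneous)

lemma vec_component_zero [simp]: "vec_component s j 0 = 0"
  by (simp add: vec_component_def fun_eq_iff)

locale graded_submodule =
  fixes n :: nat and s :: "nat \<Rightarrow> int" and Z :: "(nat \<Rightarrow> ('v::finite, 'k::field) mpoly) set"
  assumes in_free: "Z \<subseteq> free_module n"
    and zero_mem: "0 \<in> Z"
    and add_mem: "x \<in> Z \<Longrightarrow> y \<in> Z \<Longrightarrow> x + y \<in> Z"
    and mult_mem: "x \<in> Z \<Longrightarrow> (\<lambda>b. p * x b) \<in> Z"
    and component_mem: "x \<in> Z \<Longrightarrow> vec_component s j x \<in> Z"
begin

lemma sum_mem: "(\<And>i. i \<in> A \<Longrightarrow> f i \<in> Z) \<Longrightarrow> sum f A \<in> Z"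
  by (induction A rule: infinite_finite_induct) (auto intro: add_mem zero_mem)

end

lemma graded_submodule_free_module: "graded_submodule n s (free_module n)"
  by unfold_locales (auto simp: free_module_def vec_component_def)

text \<open>A coefficient at \<open>\<sigma>\<close> and \<open>b\<close> has degree
  \<open>j\<close> minus the degree \<open>s b\<close> of the basis element and minus
  \<open>p\<close> for the wedge of \<open>p\<close> variables.\<close>

definition koszul_chains :: "(nat \<Rightarrow> ('v::finite, 'k::field) mpoly) set \<Rightarrow> (nat \<Rightarrow> int) \<Rightarrow> nat \<Rightarrow> int \<Rightarrow>
    ('v set \<Rightarrow> nat \<Rightarrow> ('v, 'k) mpoly) set" where
  "koszul_chains Z s p j = {z. \<forall>\<sigma>. z \<sigma> \<in> Z \<and> (card \<sigma> \<noteq> p \<longrightarrow> z \<sigma> = 0) \<and>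
     (\<forall>b. homogeneous (j - s b - int p) (z \<sigma> b))}"

text \<open>In homological degree \<open>0\<close> only the elements of \<open>(x\<^sub>1, \<dots>, x\<^sub>m) F\<close>, where \<open>F\<close> is the ambient free
  module, count as cycles. With this convention, the complex of a free module is exact.\<close>

definition koszul_cycles :: "(nat \<Rightarrow> ('v::finite, 'k::field) mpoly) set \<Rightarrow> (nat \<Rightarrow> int) \<Rightarrow> nat \<Rightarrow> int \<Rightarrow>
    ('v set \<Rightarrow> nat \<Rightarrow> ('v, 'k) mpoly) set" where
  "koszul_cycles Z s p j =
     {z \<in> koszul_chains Z s p j. koszul_diff z = 0 \<and> (\<forall>b. lookup (z {} b) 0 = 0)}"

definition koszul_boundaries :: "(nat \<Rightarrow> ('v::finite, 'k::field) mpoly) set \<Rightarrow> (nat \<Rightarrow> int) \<Rightarrow> nat \<Rightarrow> int \<Rightarrow>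
    ('v set \<Rightarrow> nat \<Rightarrow> ('v, 'k) mpoly) set" where
  "koszul_boundaries Z s p j = koszul_diff ` koszul_chains Z s (Suc p) j"

definition chain_scale :: "'k::field \<Rightarrow> ('i \<Rightarrow> nat \<Rightarrow> ('v, 'k) mpoly) \<Rightarrow> 'i \<Rightarrow> nat \<Rightarrow> ('v, 'k) mpoly" where
  "chain_scale c z = (\<lambda>\<sigma> b. Poly_Mapping.single 0 c * z \<sigma> b)"

lemma vector_space_chain_scale:
  "vector_space (chain_scale :: 'k::field \<Rightarrow> ('i \<Rightarrow> nat \<Rightarrow> ('v, 'k) mpoly) \<Rightarrow> 'i \<Rightarrow> nat \<Rightarrow> ('v, 'k) mpoly)"
proof
  fix a b :: 'k and x y :: "'i \<Rightarrow> nat \<Rightarrow> ('v, 'k) mpoly"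
  show "chain_scale a (x + y) = chain_scale a x + chain_scale a y"
    by (simp add: chain_scale_def fun_eq_iff distrib_left)
  show "chain_scale (a + b) x = chain_scale a x + chain_scale b x"
    by (simp add: chain_scale_def fun_eq_iff single_add distrib_right)
  show "chain_scale a (chain_scale b x) = chain_scale (a * b) x"
    by (simp add: chain_scale_def fun_eq_iff mult_single flip: mult.assoc)
  show "chain_scale 1 x = x"
    by (simp add: chain_scale_def)
qed

interpretation chain: vector_space chain_scale by (rule vector_space_chain_scale)

interpretation chain: vector_space_pair chain_scale chain_scale ..

lemma linear_koszul_diff:
  "Vector_Spaces.linear chain_scale chain_scale
     (koszul_diff :: ('v::finite set \<Rightarrow> nat \<Rightarrow> ('v, 'k::field) mpoly) \<Rightarrow> _)"
  unfolding Vector_Spaces.linear_iff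
proof (intro conjI allI)
  show "koszul_diff (x + y) = koszul_diff x + koszul_diff y" for x y :: "'v set \<Rightarrow> nat \<Rightarrow> ('v, 'k) mpoly"
    by (rule koszul_diff_add)
  show "koszul_diff (chain_scale c x) = chain_scale c (koszul_diff x)"
    for c and x :: "'v set \<Rightarrow> nat \<Rightarrow> ('v, 'k) mpoly"
    by (simp add: koszul_diff_def chain_scale_def fun_eq_iff sum_distrib_left ac_simps)
qed (rule vector_space_chain_scale)+

definition koszul_dim :: "(nat \<Rightarrow> ('v::finite, 'k::field) mpoly) set \<Rightarrow> (nat \<Rightarrow> int) \<Rightarrow> nat \<Rightarrow> int \<Rightarrow> nat" where
  "koszul_dim Z s p j = chain.dim (koszul_cycles Z s p j) - chain.dim (koszul_boundaries Z s p j)"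

lemma koszul_chainsD:
  assumes "z \<in> koszul_chains Z s p j"
  shows "z \<sigma> \<in> Z" "card \<sigma> \<noteq> p \<Longrightarrow> z \<sigma> = 0" "homogeneous (j - s b - int p) (z \<sigma> b)"
    "lookup (z \<sigma> b) t \<noteq> 0 \<Longrightarrow> card \<sigma> = p \<and> int (mono_deg t) = j - s b - int p"
proof -
  show "z \<sigma> \<in> Z" and 0: "card \<sigma> \<noteq> p \<Longrightarrow> z \<sigma> = 0" and h: "homogeneous (j - s b - int p) (z \<sigma> b)"
    using assms by (simp_all add: koszul_chains_def)
  show "card \<sigma> = p \<and> int (mono_deg t) = j - s b - int p" if "lookup (z \<sigma> b) t \<noteq> 0"
    using 0 h that unfolding homogeneous_iff by (cases "card \<sigma> = p") auto
qed

lemma koszul_chainsI: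
  assumes "\<And>\<sigma>. z \<sigma> \<in> Z"
    and "\<And>\<sigma> b t. lookup (z \<sigma> b) t \<noteq> 0 \<Longrightarrow> card \<sigma> = p \<and> int (mono_deg t) = j - s b - int p"
  shows "z \<in> koszul_chains Z s p j"
proof -
  have "z \<sigma> = 0" if "card \<sigma> \<noteq> p" for \<sigma>
    by (intro ext poly_mapping_eqI) (use assms(2)[of \<sigma>] that in auto)
  then show ?thesis using assms by (auto simp: koszul_chains_def homogeneous_iff)
qed

lemma koszul_chains_mono: "Z \<subseteq> Z' \<Longrightarrow> koszul_chains Z s p j \<subseteq> koszul_chains Z' s p j"
  by (auto simp: koszul_chains_def)

lemma lookup_koszul_diff_empty_0: "lookup (koszul_diff z \<tau> b) 0 = 0"
  by (simp add: lookup_koszul_diff)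

context graded_submodule
begin

lemma koszul_diff_chains:
  assumes "z \<in> koszul_chains Z s (Suc p) j"
  shows "koszul_diff z \<in> koszul_chains Z s p j"
proof (rule koszul_chainsI)
  fix \<tau> b t
  have "koszul_diff z \<tau> = (\<Sum>w\<in>-\<tau>. (\<lambda>b.
      Poly_Mapping.single (Poly_Mapping.single w 1) (koszul_sign w \<tau>) * z (insert w \<tau>) b))"
    by (simp add: koszul_diff_def fun_eq_iff sum_fun_apply)
  moreover have "(\<lambda>b. c * z (insert w \<tau>) b) \<in> Z" for c w
    by (rule mult_mem) (rule koszul_chainsD(1)[OF assms])
  ultimately show "koszul_diff z \<tau> \<in> Z"
    by (simp add: sum_mem)
  assume "lookup (koszul_diff z \<tau> b) t \<noteq> 0"
  then obtain w where w: "w \<notin> \<tau>" "lookup t w \<noteq> 0"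
      "lookup (z (insert w \<tau>) b) (t - Poly_Mapping.single w 1) \<noteq> 0"
    unfolding lookup_koszul_diff by (auto elim!: sum.not_neutral_contains_not_neutral split: if_splits)
  have "t = (t - Poly_Mapping.single w 1) + Poly_Mapping.single w 1"
    using w(2) by (intro poly_mapping_eqI) (auto simp: lookup_add lookup_minus lookup_single when_def)
  then have "mono_deg t = mono_deg (t - Poly_Mapping.single w 1) + 1"
    by (metis mono_deg_add mono_deg_single)
  then show "card \<tau> = p \<and> int (mono_deg t) = j - s b - int p"
    using koszul_chainsD(4)[OF assms w(3)] w(1) by auto
qed

lemma subspace_koszul_chains: "chain.subspace (koszul_chains Z s p j)"
  unfolding chain.subspace_def
proof (intro conjI ballI allI)
  show "0 \<in> koszul_chains Z s p j" by (auto simp: koszul_chains_def zero_mem)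
  show "x + y \<in> koszul_chains Z s p j" if "x \<in> koszul_chains Z s p j" "y \<in> koszul_chains Z s p j" for x y
    using that by (auto simp: koszul_chains_def intro: add_mem homogeneous_add)
  show "chain_scale c x \<in> koszul_chains Z s p j" if x: "x \<in> koszul_chains Z s p j" for c x
  proof (rule koszul_chainsI)
    show "chain_scale c x \<sigma> \<in> Z" for \<sigma>
      using mult_mem[OF koszul_chainsD(1)[OF x]] by (simp add: chain_scale_def)
  qed (use koszul_chainsD(4)[OF x] in \<open>auto simp: chain_scale_def\<close>)
qed

lemma fin_subspace_koszul_chains: "chain.fin_subspace (koszul_chains Z s p j)"
proof -
  define e :: "'v set \<times> nat \<times> 'v mono \<Rightarrow> 'v set \<Rightarrow> nat \<Rightarrow> ('v, 'k) mpoly" where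
    "e = (\<lambda>(\<sigma>, b, t) \<sigma>' b'. if \<sigma> = \<sigma>' \<and> b = b' then Poly_Mapping.single t 1 else 0)"
  \<comment> \<open>For a negative degree, \<open>nat\<close> yields 0 and adds spare basis
    elements; only a finite spanning set is wanted.\<close>
  define T where "T = (UNIV :: 'v set set) \<times> (SIGMA b:{..<n}. {t :: 'v mono. mono_deg t = nat (j - s b - int p)})"
  have finT: "finite T"
    unfolding T_def by (intro finite_cartesian_product finite_SigmaI finite_mono_deg_eq) auto
  have "koszul_chains Z s p j \<subseteq> chain.span (e ` T)"
  proof
    fix z assume z: "z \<in> koszul_chains Z s p j"
    have "z = (\<Sum>x\<in>T. chain_scale (lookup (z (fst x) (fst (snd x))) (snd (snd x))) (e x))"
    proof (intro ext poly_mapping_eqI)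
      fix \<sigma> b t
      have sel: "c * lookup (e x \<sigma> b) t = (if x = (\<sigma>, b, t) then c else 0)" for x c
        by (auto simp: e_def lookup_single when_def split: prod.splits)
      have "lookup (z \<sigma> b) t = 0" if "(\<sigma>, b, t) \<notin> T"
      proof (rule ccontr)
        assume ne: "lookup (z \<sigma> b) t \<noteq> 0"
        have "z \<sigma> b = 0" if "b \<ge> n"
          using koszul_chainsD(1)[OF z, of \<sigma>] in_free that by (auto simp: free_module_def)
        then have "b < n" using ne by (cases "b < n") auto
        then show False using koszul_chainsD(4)[OF z ne] that by (auto simp: T_def)
      qed
      then show "lookup (z \<sigma> b) t =
          lookup ((\<Sum>x\<in>T. chain_scale (lookup (z (fst x) (fst (snd x))) (snd (snd x))) (e x)) \<sigma> b) t"
        by (simp add: sum_fun_apply lookup_sum chain_scale_def sel finT)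
    qed
    also have "\<dots> \<in> chain.span (e ` T)"
      by (intro chain.span_sum chain.span_scale chain.span_base) auto
    finally show "z \<in> chain.span (e ` T)" .
  qed
  then show ?thesis
    using subspace_koszul_chains finT unfolding chain.fin_subspace_def by (metis finite_imageI)
qed

lemma subspace_koszul_cycles: "chain.subspace (koszul_cycles Z s p j)"
proof -
  have "koszul_cycles Z s p j = {z \<in> koszul_chains Z s p j. koszul_diff z = 0} \<inter>
      {z. \<forall>b. lookup (z {} b) 0 = 0}"
    by (auto simp: koszul_cycles_def)
  moreover have "chain.subspace {z :: 'v set \<Rightarrow> nat \<Rightarrow> ('v, 'k) mpoly. \<forall>b. lookup (z {} b) 0 = 0}"
    by (simp add: chain.subspace_def chain_scale_def lookup_add)
  moreover have "chain.subspace {z \<in> koszul_chains Z s p j. koszul_diff z = 0}"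
    using chain.subspace_inter[OF subspace_koszul_chains chain.linear_subspace_kernel[OF linear_koszul_diff]]
    by (simp add: Int_def)
  ultimately show ?thesis
    using chain.subspace_inter by simp
qed

lemma fin_subspace_koszul_cycles: "chain.fin_subspace (koszul_cycles Z s p j)"
  by (rule chain.fin_subspace_subset[OF fin_subspace_koszul_chains subspace_koszul_cycles])
     (auto simp: koszul_cycles_def)

lemma subspace_koszul_boundaries: "chain.subspace (koszul_boundaries Z s p j)"
  unfolding koszul_boundaries_def
  by (rule chain.linear_subspace_image[OF linear_koszul_diff subspace_koszul_chains])

lemma koszul_boundaries_subset_cycles: "koszul_boundaries Z s p j \<subseteq> koszul_cycles Z s p j"
  by (auto simp: koszul_boundaries_def koszul_cycles_def koszul_diff_chains lookup_koszul_diff_empty_0)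

text \<open>This turns the vanishing of a number into exactness. Boundaries lie in cycles, and a
  basis of the boundaries as large as a basis of the cycles cannot be properly extended inside
  them.\<close>

lemma koszul_dim_eq_0_iff:
  "koszul_dim Z s p j = 0 \<longleftrightarrow> koszul_cycles Z s p j \<subseteq> koszul_boundaries Z s p j"
proof
  assume "koszul_dim Z s p j = 0"
  then have le: "chain.dim (koszul_cycles Z s p j) \<le> chain.dim (koszul_boundaries Z s p j)"
    by (simp add: koszul_dim_def)
  obtain B where B: "B \<subseteq> koszul_boundaries Z s p j" "chain.independent B"
      "koszul_boundaries Z s p j \<subseteq> chain.span B" "card B = chain.dim (koszul_boundaries Z s p j)"
    by (rule chain.basis_exists)
  have BC: "B \<subseteq> koszul_cycles Z s p j" using B(1) koszul_boundaries_subset_cycles by blast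
  obtain C where C: "B \<subseteq> C" "C \<subseteq> koszul_cycles Z s p j" "chain.independent C"
      "koszul_cycles Z s p j \<subseteq> chain.span C"
    by (rule chain.maximal_independent_subset_extend[OF BC B(2)])
  have "finite C" using chain.fin_subspace_independent_finite fin_subspace_koszul_cycles C by blast
  moreover have "card C = chain.dim (koszul_cycles Z s p j)"
    using chain.basis_card_eq_dim C by blast
  ultimately have "B = C" using le B C by (metis card_seteq)
  moreover have "chain.span B \<subseteq> koszul_boundaries Z s p j"
    by (rule chain.span_minimal[OF B(1) subspace_koszul_boundaries])
  ultimately show "koszul_cycles Z s p j \<subseteq> koszul_boundaries Z s p j" using C(4) by blast
next
  assume "koszul_cycles Z s p j \<subseteq> koszul_boundaries Z s p j"
  then show "koszul_dim Z s p j = 0"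
    using koszul_boundaries_subset_cycles[of p j] by (simp add: koszul_dim_def subset_antisym)
qed

end

section \<open>Cycles bounded by cones\<close>

lemma koszul_cone_zero [simp]: "koszul_cone U 0 = 0"
  by (intro ext poly_mapping_eqI) (simp add: lookup_koszul_cone Let_def)

lemma koszul_cone_chains:
  assumes z: "z \<in> koszul_chains Z s p j" and mem: "\<And>\<sigma>. koszul_cone U z \<sigma> \<in> Z'"
  shows "koszul_cone U z \<in> koszul_chains Z' s (Suc p) j"
proof (rule koszul_chainsI[OF mem])
  fix \<sigma> :: "'a set" and b t
  assume ne: "lookup (koszul_cone U z \<sigma> b) t \<noteq> 0"
  define u where "u = U (t + indicator_mono \<sigma>)"
  have u: "u \<in> \<sigma>" "lookup (z (\<sigma> - {u}) b) (t + Poly_Mapping.single u 1) \<noteq> 0"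
    using ne unfolding lookup_koszul_cone u_def by (auto simp: Let_def split: if_splits)
  have "card \<sigma> = Suc (card (\<sigma> - {u}))"
    by (rule card.remove) (use u(1) in auto)
  moreover have "mono_deg (t + Poly_Mapping.single u 1) = mono_deg t + 1"
    by (simp add: mono_deg_add)
  ultimately show "card \<sigma> = Suc p \<and> int (mono_deg t) = j - s b - int (Suc p)"
    using koszul_chainsD(4)[OF z u(2)] by linarith
qed

text \<open>For a cycle the second half of the homotopy vanishes, so \<open>z\<close> is the
  boundary of its cone. The coefficients of the cone are those of \<open>z\<close> divided by a
  variable and may leave \<open>Z\<close>, hence the separate \<open>Z'\<close>.\<close>

lemma koszul_cycle_is_boundary:
  assumes z: "z \<in> koszul_cycles Z s p j"
    and U: "\<And>\<sigma> b t. lookup (z \<sigma> b) t \<noteq> 0 \<Longrightarrow>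
      lookup (t + indicator_mono \<sigma>) (U (t + indicator_mono \<sigma>)) \<noteq> 0"
    and mem: "\<And>\<sigma>. koszul_cone U z \<sigma> \<in> Z'"
  shows "z \<in> koszul_boundaries Z' s p j"
proof -
  have "koszul_diff (koszul_cone U z) = z"
    using koszul_cone_homotopy[of z U] U z by (simp add: koszul_cycles_def)
  moreover have "koszul_cone U z \<in> koszul_chains Z' s (Suc p) j"
    using koszul_cone_chains[of z Z s p j U Z'] mem z unfolding koszul_cycles_def by simp
  ultimately show ?thesis
    unfolding koszul_boundaries_def by (metis imageI)
qed

text \<open>In a free module every division is allowed, so any variable dividing the multidegree
  serves as apex. Multidegree 0 has none; it occurs only for constants at the empty wedge, which
  \<open>koszul_cycles\<close> excludes.\<close>

lemma koszul_exact_free_module: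
  assumes z: "z \<in> koszul_cycles (free_module n) s p j"
  shows "z \<in> koszul_boundaries (free_module n) s p j"
proof (rule koszul_cycle_is_boundary[OF z, where U = "\<lambda>a. SOME x. lookup a x \<noteq> 0"])
  fix \<sigma> :: "'a set" and b t
  let ?a = "t + indicator_mono \<sigma>"
  assume ne: "lookup (z \<sigma> b) t \<noteq> 0"
  have "t \<noteq> 0 \<or> \<sigma> \<noteq> {}" using z ne unfolding koszul_cycles_def by auto
  then have "\<exists>x. lookup ?a x \<noteq> 0"
  proof
    assume "t \<noteq> 0"
    then show ?thesis by (auto simp: poly_mapping_eq_iff fun_eq_iff lookup_add)
  qed (auto simp: lookup_add lookup_indicator_mono)
  then show "lookup ?a (SOME x. lookup ?a x \<noteq> 0) \<noteq> 0" by (rule someI_ex)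
next
  fix \<sigma> :: "'a set"
  have "z \<rho> b = 0" if "b \<ge> n" for \<rho> b
    using z that by (auto simp: koszul_cycles_def koszul_chains_def free_module_def)
  then show "koszul_cone (\<lambda>a. SOME x. lookup a x \<noteq> 0) z \<sigma> \<in> free_module n"
    by (auto simp: free_module_def Let_def lookup_koszul_cone intro!: poly_mapping_eqI)
qed



section \<open>Dimension shifting\<close>

text \<open>An \<open>R\<close>-linear map of degree \<open>0\<close> from \<open>\<Oplus>\<^bsub>b<n'\<^esub> R(- s' b)\<close> to \<open>\<Oplus>\<^bsub>b<n\<^esub> R(- s b)\<close>.\<close>

locale graded_map =
  fixes n' :: nat and s' :: "nat \<Rightarrow> int" and n :: nat and s :: "nat \<Rightarrow> int"
    and D :: "(nat \<Rightarrow> ('v::finite, 'k::field) mpoly) \<Rightarrow> nat \<Rightarrow> ('v, 'k) mpoly"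
  assumes map_in_free: "D x \<in> free_module n"
    and map_add: "D (x + y) = D x + D y"
    and map_mult: "D (\<lambda>b. p * x b) = (\<lambda>b. p * D x b)"
    and map_component: "x \<in> free_module n' \<Longrightarrow> D (vec_component s' j x) = vec_component s j (D x)"
begin

lemma map_zero [simp]: "D 0 = 0"
  using map_add[of 0 0] by simp

lemma map_uminus: "D (- x) = - D x"
  using map_add[of x "- x"] by (simp add: eq_neg_iff_add_eq_0 add.commute)

lemma map_diff: "D (x - y) = D x - D y"
  using map_add[of x "- y"] map_uminus[of y] by simp

lemma map_sum: "D (sum f A) = (\<Sum>i\<in>A. D (f i))"
proof (induction A rule: infinite_finite_induct)
  case (insert x F)
  then show ?case by (simp only: sum.insert map_add not_False_eq_True)
qed (simp_all only: sum.infinite sum.empty map_zero not_False_eq_True)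

abbreviation "map_image \<equiv> D ` free_module n'"
abbreviation "map_kernel \<equiv> {x \<in> free_module n'. D x = 0}"

lemma graded_submodule_image: "graded_submodule n s map_image"
proof
  interpret F: graded_submodule n' s' "free_module n' :: (nat \<Rightarrow> ('v, 'k) mpoly) set"
    by (rule graded_submodule_free_module)
  show "map_image \<subseteq> free_module n" using map_in_free by blast
  show "0 \<in> map_image" using F.zero_mem map_zero by (metis image_eqI)
  show "x + y \<in> map_image" if "x \<in> map_image" "y \<in> map_image" for x y
    using that F.add_mem by (auto simp flip: map_add)
  show "(\<lambda>b. p * x b) \<in> map_image" if "x \<in> map_image" for p x
    using that F.mult_mem by (auto simp flip: map_mult)
  show "vec_component s j x \<in> map_image" if "x \<in> map_image" for j x
    using that F.component_mem by (auto simp flip: map_component)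
qed

lemma graded_submodule_kernel: "graded_submodule n' s' map_kernel"
proof
  interpret F: graded_submodule n' s' "free_module n' :: (nat \<Rightarrow> ('v, 'k) mpoly) set"
    by (rule graded_submodule_free_module)
  show "map_kernel \<subseteq> free_module n'" by blast
  show "0 \<in> map_kernel" by (simp add: F.zero_mem)
  show "x + y \<in> map_kernel" if "x \<in> map_kernel" "y \<in> map_kernel" for x y
    using that F.add_mem by (simp add: map_add)
  show "(\<lambda>b. p * x b) \<in> map_kernel" if "x \<in> map_kernel" for p x
    using that F.mult_mem by (simp add: map_mult) (simp add: fun_eq_iff)
  show "vec_component s' j x \<in> map_kernel" if "x \<in> map_kernel" for j x
    using that F.component_mem by (simp add: map_component)
qed

definition chain_map :: "('v set \<Rightarrow> nat \<Rightarrow> ('v, 'k) mpoly) \<Rightarrow> 'v set \<Rightarrow> nat \<Rightarrow> ('v, 'k) mpoly" where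
  "chain_map f = (\<lambda>\<sigma>. D (f \<sigma>))"

lemma linear_chain_map: "Vector_Spaces.linear chain_scale chain_scale chain_map"
  unfolding Vector_Spaces.linear_iff
proof (intro conjI allI)
  show "chain_map (x + y) = chain_map x + chain_map y" for x y
    by (simp add: chain_map_def map_add fun_eq_iff)
  show "chain_map (chain_scale c x) = chain_scale c (chain_map x)" for c x
    by (simp add: chain_map_def chain_scale_def map_mult)
qed (rule vector_space_chain_scale)+

lemma chain_map_diff: "chain_map (x - y) = chain_map x - chain_map y"
  by (simp add: chain_map_def map_diff fun_eq_iff)

lemma koszul_diff_chain_map: "koszul_diff (chain_map f) = chain_map (koszul_diff f)"
proof
  fix \<tau>
  let ?x = "\<lambda>w. Poly_Mapping.single (Poly_Mapping.single w 1) (koszul_sign w \<tau>) :: ('v, 'k) mpoly"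
  have "koszul_diff f \<tau> = (\<Sum>w\<in>-\<tau>. (\<lambda>b. ?x w * f (insert w \<tau>) b))"
    by (simp add: koszul_diff_def fun_eq_iff sum_fun_apply)
  then have "chain_map (koszul_diff f) \<tau> = (\<Sum>w\<in>-\<tau>. D (\<lambda>b. ?x w * f (insert w \<tau>) b))"
    by (simp add: chain_map_def map_sum)
  also have "\<dots> = (\<Sum>w\<in>-\<tau>. (\<lambda>b. ?x w * chain_map f (insert w \<tau>) b))"
    by (simp add: map_mult chain_map_def)
  also have "\<dots> = koszul_diff (chain_map f) \<tau>"
    by (simp add: koszul_diff_def fun_eq_iff sum_fun_apply)
  finally show "koszul_diff (chain_map f) \<tau> = chain_map (koszul_diff f) \<tau>" by simp
qed

lemma chain_map_chains:
  assumes f: "f \<in> koszul_chains Z s' p j" and Z: "Z \<subseteq> free_module n'"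
  shows "chain_map f \<in> koszul_chains (D ` Z) s p j"
  unfolding koszul_chains_def chain_map_def
proof (intro CollectI allI conjI impI)
  fix \<sigma> b
  show "D (f \<sigma>) \<in> D ` Z" using koszul_chainsD(1)[OF f] by blast
  show "D (f \<sigma>) = 0" if "card \<sigma> \<noteq> p" using koszul_chainsD(2)[OF f that] by simp
  have "vec_component s' (j - int p) (f \<sigma>) = f \<sigma>"
    by (rule vec_component_homogeneous) (use koszul_chainsD(3)[OF f] in \<open>simp add: algebra_simps\<close>)
  moreover have "f \<sigma> \<in> free_module n'" using koszul_chainsD(1)[OF f] Z by blast
  ultimately have "D (f \<sigma>) b = vec_component s (j - int p) (D (f \<sigma>)) b"
    using map_component[of "f \<sigma>" "j - int p"] by simp
  then have "D (f \<sigma>) b = hom_component (j - s b - int p) (D (f \<sigma>) b)"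
    by (simp add: vec_component_def algebra_simps)
  then show "homogeneous (j - s b - int p) (D (f \<sigma>) b)"
    using homogeneous_hom_component by metis
qed

text \<open>Arbitrary preimages need not be homogeneous. Their components of the right degree are
  still preimages, because \<open>D\<close> preserves degrees.\<close>

lemma chain_map_lift:
  assumes z: "z \<in> koszul_chains map_image s p j"
  obtains f where "f \<in> koszul_chains (free_module n') s' p j" "chain_map f = z"
proof -
  have "\<exists>x. x \<in> free_module n' \<and> D x = z \<sigma>" for \<sigma>
    using koszul_chainsD(1)[OF z, of \<sigma>] by (metis image_iff)
  then obtain g where g: "\<And>\<sigma>. g \<sigma> \<in> free_module n'" "\<And>\<sigma>. D (g \<sigma>) = z \<sigma>" by metis
  define f where "f \<sigma> = (if card \<sigma> = p then vec_component s' (j - int p) (g \<sigma>) else 0)" for \<sigma>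
  interpret F: graded_submodule n' s' "free_module n' :: (nat \<Rightarrow> ('v, 'k) mpoly) set"
    by (rule graded_submodule_free_module)
  have hom: "homogeneous (j - s' b - int p) (vec_component s' (j - int p) x b)" for b and x :: "nat \<Rightarrow> ('v, 'k) mpoly"
    using homogeneous_hom_component[of "j - int p - s' b"] by (simp add: vec_component_def algebra_simps)
  have "f \<in> koszul_chains (free_module n') s' p j"
    using F.component_mem[OF g(1)] F.zero_mem hom by (auto simp: koszul_chains_def f_def)
  moreover have "chain_map f = z"
  proof
    fix \<sigma>
    have "vec_component s (j - int p) (z \<sigma>) = z \<sigma>"
      by (rule vec_component_homogeneous) (use koszul_chainsD(3)[OF z] in \<open>simp add: algebra_simps\<close>)
    then show "chain_map f \<sigma> = z \<sigma>"
      using koszul_chainsD(2)[OF z, of \<sigma>] g map_component[OF g(1)] by (simp add: chain_map_def f_def)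
  qed
  ultimately show ?thesis by (rule that)
qed

text \<open>The connecting isomorphism as a correspondence: a chain \<open>f\<close> of the free module relates its image
  \<open>D f\<close>, a cycle over the image of \<open>D\<close>, to its boundary, a cycle over the kernel of \<open>D\<close>.\<close>

lemma koszul_dim_kernel: "koszul_dim map_kernel s' p j = koszul_dim map_image s (Suc p) j"
proof -
  interpret F: graded_submodule n' s' "free_module n' :: (nat \<Rightarrow> ('v, 'k) mpoly) set"
    by (rule graded_submodule_free_module)
  interpret I: graded_submodule n s map_image by (rule graded_submodule_image)
  interpret K: graded_submodule n' s' map_kernel by (rule graded_submodule_kernel)
  define \<Gamma> where "\<Gamma> = {f \<in> koszul_chains (free_module n') s' (Suc p) j. koszul_diff (chain_map f) = 0}"
  \<comment> \<open>In positive homological degree nothing sits at the empty wedge, so the condition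
    on constants in \<open>koszul_cycles\<close> holds there.\<close>
  have empty0: "f {} = 0" if "f \<in> koszul_chains Z t (Suc p) j" for f :: "'v set \<Rightarrow> nat \<Rightarrow> ('v, 'k) mpoly" and Z t
    using koszul_chainsD(2)[OF that, of "{}"] by simp
  have lin: "Vector_Spaces.linear chain_scale chain_scale (koszul_diff \<circ> chain_map)"
    using Vector_Spaces.linear_compose[OF linear_chain_map linear_koszul_diff] .
  have fin: "chain.fin_subspace \<Gamma>"
  proof (rule chain.fin_subspace_subset[OF F.fin_subspace_koszul_chains])
    show "chain.subspace \<Gamma>"
      using chain.subspace_inter[OF F.subspace_koszul_chains chain.linear_subspace_kernel[OF lin]]
      by (simp add: Int_def \<Gamma>_def)
  qed (auto simp: \<Gamma>_def)
  have im1: "chain_map ` \<Gamma> = koszul_cycles map_image s (Suc p) j"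
  proof
    show "chain_map ` \<Gamma> \<subseteq> koszul_cycles map_image s (Suc p) j"
    proof clarify
      fix f assume "f \<in> \<Gamma>"
      then have f: "chain_map f \<in> koszul_chains map_image s (Suc p) j" "koszul_diff (chain_map f) = 0"
        using chain_map_chains[OF _ order_refl] by (auto simp: \<Gamma>_def)
      then show "chain_map f \<in> koszul_cycles map_image s (Suc p) j"
        using empty0[OF f(1)] by (simp add: koszul_cycles_def)
    qed
    show "koszul_cycles map_image s (Suc p) j \<subseteq> chain_map ` \<Gamma>"
    proof
      fix z assume z: "z \<in> koszul_cycles map_image s (Suc p) j"
      then obtain f where "f \<in> koszul_chains (free_module n') s' (Suc p) j" "chain_map f = z"
        using chain_map_lift unfolding koszul_cycles_def by blast
      then show "z \<in> chain_map ` \<Gamma>" using z by (auto simp: \<Gamma>_def koszul_cycles_def)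
    qed
  qed
  have im2: "koszul_diff ` \<Gamma> = koszul_cycles map_kernel s' p j"
  proof
    show "koszul_diff ` \<Gamma> \<subseteq> koszul_cycles map_kernel s' p j"
    proof clarify
      fix f assume f: "f \<in> \<Gamma>"
      then have "koszul_diff f \<in> koszul_chains (free_module n') s' p j"
        using F.koszul_diff_chains by (auto simp: \<Gamma>_def)
      moreover have "D (koszul_diff f \<sigma>) = 0" for \<sigma>
        using f unfolding \<Gamma>_def koszul_diff_chain_map by (auto simp: chain_map_def fun_eq_iff)
      ultimately have "koszul_diff f \<in> koszul_chains map_kernel s' p j"
        by (auto simp: koszul_chains_def)
      then show "koszul_diff f \<in> koszul_cycles map_kernel s' p j"
        by (simp add: koszul_cycles_def lookup_koszul_diff_empty_0)
    qed
    show "koszul_cycles map_kernel s' p j \<subseteq> koszul_diff ` \<Gamma>"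
    proof
      fix y assume y: "y \<in> koszul_cycles map_kernel s' p j"
      then have "y \<in> koszul_cycles (free_module n') s' p j"
        using koszul_chains_mono[of map_kernel "free_module n'" s' p j] by (auto simp: koszul_cycles_def)
      then obtain f where f: "f \<in> koszul_chains (free_module n') s' (Suc p) j" "koszul_diff f = y"
        using koszul_exact_free_module unfolding koszul_boundaries_def by blast
      have "chain_map y = 0"
        using y by (auto simp: koszul_cycles_def koszul_chains_def chain_map_def)
      then have "f \<in> \<Gamma>" using f by (simp add: \<Gamma>_def koszul_diff_chain_map)
      then show "y \<in> koszul_diff ` \<Gamma>" using f(2) by blast
    qed
  qed
  have iff: "chain_map f \<in> koszul_boundaries map_image s (Suc p) j \<longleftrightarrow> koszul_diff f \<in> koszul_boundaries map_kernel s' p j"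
    if f: "f \<in> \<Gamma>" for f
  proof
    assume "chain_map f \<in> koszul_boundaries map_image s (Suc p) j"
    then obtain g where g: "g \<in> koszul_chains map_image s (Suc (Suc p)) j" "chain_map f = koszul_diff g"
      unfolding koszul_boundaries_def by blast
    \<comment> \<open>If \<open>D f\<close> is the boundary of \<open>g\<close>, subtracting from
      \<open>f\<close> the boundary of a lift \<open>h\<close> of \<open>g\<close> moves
      \<open>f\<close> into the kernel of \<open>D\<close> without changing its boundary.\<close>
    obtain h where h: "h \<in> koszul_chains (free_module n') s' (Suc (Suc p)) j" "chain_map h = g"
      using chain_map_lift[OF g(1)] .
    have "f - koszul_diff h \<in> koszul_chains (free_module n') s' (Suc p) j"
      using F.koszul_diff_chains[OF h(1)] f chain.subspace_diff[OF F.subspace_koszul_chains]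
      by (auto simp: \<Gamma>_def)
    moreover have "chain_map (f - koszul_diff h) = 0"
      using g(2) h(2) by (simp add: chain_map_diff flip: koszul_diff_chain_map)
    ultimately have "f - koszul_diff h \<in> koszul_chains map_kernel s' (Suc p) j"
      by (auto simp: koszul_chains_def chain_map_def fun_eq_iff)
    moreover have "koszul_diff f = koszul_diff (f - koszul_diff h)"
      by (simp add: koszul_diff_diff)
    ultimately show "koszul_diff f \<in> koszul_boundaries map_kernel s' p j"
      unfolding koszul_boundaries_def by (rule rev_image_eqI[where f = koszul_diff])
  next
    assume "koszul_diff f \<in> koszul_boundaries map_kernel s' p j"
    then obtain y where y: "y \<in> koszul_chains map_kernel s' (Suc p) j" "koszul_diff f = koszul_diff y"
      unfolding koszul_boundaries_def by blast
    \<comment> \<open>Conversely, \<open>f\<close> and \<open>y\<close> have the same boundary, so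
      they differ by a boundary of the free complex, and \<open>D\<close> kills
      \<open>y\<close>.\<close>
    have y': "y \<in> koszul_chains (free_module n') s' (Suc p) j"
      using y(1) koszul_chains_mono[of map_kernel "free_module n'"] by blast
    have fy: "f - y \<in> koszul_chains (free_module n') s' (Suc p) j"
      using y' f chain.subspace_diff[OF F.subspace_koszul_chains] by (auto simp: \<Gamma>_def)
    then have "f - y \<in> koszul_cycles (free_module n') s' (Suc p) j"
      using y(2) empty0[OF fy] by (simp add: koszul_cycles_def koszul_diff_diff)
    then have "f - y \<in> koszul_diff ` koszul_chains (free_module n') s' (Suc (Suc p)) j"
      unfolding koszul_boundaries_def[symmetric] by (rule koszul_exact_free_module)
    then obtain g where g: "f - y = koszul_diff g" "g \<in> koszul_chains (free_module n') s' (Suc (Suc p)) j"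
      by (rule imageE)
    have "chain_map y = 0"
      using y(1) by (auto simp: koszul_chains_def chain_map_def)
    then have "chain_map f = chain_map (f - y)" by (simp add: chain_map_diff)
    also have "\<dots> = koszul_diff (chain_map g)" using g(1) by (simp add: koszul_diff_chain_map)
    finally show "chain_map f \<in> koszul_boundaries map_image s (Suc p) j"
      using chain_map_chains[OF g(2) order_refl] unfolding koszul_boundaries_def by blast
  qed
  have "chain.dim (chain_map ` \<Gamma>) - chain.dim (koszul_boundaries map_image s (Suc p) j) =
      chain.dim (koszul_diff ` \<Gamma>) - chain.dim (koszul_boundaries map_kernel s' p j)"
  proof (rule dim_subquotient_eq[OF linear_chain_map linear_koszul_diff fin
        I.subspace_koszul_boundaries K.subspace_koszul_boundaries _ _ iff])
    show "koszul_boundaries map_image s (Suc p) j \<subseteq> chain_map ` \<Gamma>"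
      unfolding im1 by (rule I.koszul_boundaries_subset_cycles)
    show "koszul_boundaries map_kernel s' p j \<subseteq> koszul_diff ` \<Gamma>"
      unfolding im2 by (rule K.koszul_boundaries_subset_cycles)
  qed
  then show ?thesis by (simp add: koszul_dim_def im1 im2)
qed

end

lemma graded_map_mat_map:
  assumes "\<And>b c. b < n \<Longrightarrow> c < n' \<Longrightarrow> homogeneous (s' c - s b) (M b c)"
  shows "graded_map n' s' n s (mat_map n n' (M :: nat \<Rightarrow> nat \<Rightarrow> ('v::finite, 'k::field) mpoly))"
proof
  fix x y :: "nat \<Rightarrow> ('v, 'k) mpoly" and p :: "('v, 'k) mpoly" and j :: int
  show "mat_map n n' M x \<in> free_module n" by (simp add: mat_map_def free_module_def)
  show "mat_map n n' M (x + y) = mat_map n n' M x + mat_map n n' M y"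
    by (simp add: mat_map_def fun_eq_iff distrib_left sum.distrib)
  show "mat_map n n' M (\<lambda>b. p * x b) = (\<lambda>b. p * mat_map n n' M x b)"
    by (simp add: mat_map_def fun_eq_iff sum_distrib_left ac_simps)
  show "mat_map n n' M (vec_component s' j x) = vec_component s j (mat_map n n' M x)"
  proof
    fix b
    have "hom_component (j - s b) (M b c * x c) = M b c * hom_component (j - s' c) (x c)"
      if "b < n" "c < n'" for c
      using hom_component_mult[OF assms[OF that], of "j - s b" "x c"] by (simp add: algebra_simps)
    then show "mat_map n n' M (vec_component s' j x) b = vec_component s j (mat_map n n' M x) b"
      by (simp add: mat_map_def vec_component_def hom_component_sum)
  qed
qed



section \<open>Betti numbers as Koszul homology\<close>

lemma vector_space_pointwise_mult: "vector_space (\<lambda>c (x :: nat \<Rightarrow> 'k::field) b. c * x b)"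
  by unfold_locales (auto simp: fun_eq_iff algebra_simps)

interpretation vec: vector_space "\<lambda>c (x :: nat \<Rightarrow> 'k::field) b. c * x b"
  by (rule vector_space_pointwise_mult)

lemma lookup_mat_map_zero:
  fixes M :: "nat \<Rightarrow> nat \<Rightarrow> ('v, 'k::field) mpoly"
  shows "lookup (mat_map n n' M x b) 0 = mat_map n n' (\<lambda>b c. lookup (M b c) 0) (\<lambda>c. lookup (x c) 0) b"
  by (simp add: mat_map_def lookup_sum lookup_times_zero)

definition degree_part :: "nat \<Rightarrow> (nat \<Rightarrow> int) \<Rightarrow> int \<Rightarrow> (nat \<Rightarrow> 'k::field) set" where
  "degree_part n s j = {x \<in> free_module n. \<forall>b. x b \<noteq> 0 \<longrightarrow> s b = j}"

lemma subspace_degree_part: "vec.subspace (degree_part n s j)"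
  unfolding vec.subspace_def degree_part_def free_module_def
  by auto (metis add.right_neutral)

text \<open>Reduction modulo the variables; a chain of homological degree 0 is determined by its
  coefficient at the empty wedge.\<close>

definition const_part :: "('v::finite set \<Rightarrow> nat \<Rightarrow> ('v, 'k::field) mpoly) \<Rightarrow> nat \<Rightarrow> 'k" where
  "const_part f = (\<lambda>b. lookup (f {} b) 0)"

definition const_chain :: "(nat \<Rightarrow> 'k::field) \<Rightarrow> 'v::finite set \<Rightarrow> nat \<Rightarrow> ('v, 'k) mpoly" where
  "const_chain c = (\<lambda>\<sigma> b. if \<sigma> = {} then Poly_Mapping.single 0 (c b) else 0)"

lemma const_part_const_chain [simp]: "const_part (const_chain c) = c"
  by (simp add: const_part_def const_chain_def)

lemma linear_const_part: "Vector_Spaces.linear chain_scale (\<lambda>c x b. c * x b) const_part"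
  unfolding Vector_Spaces.linear_iff
  by (auto simp: const_part_def chain_scale_def lookup_add fun_eq_iff
      vector_space_chain_scale vector_space_pointwise_mult)

lemma const_part_in_degree_part:
  assumes "f \<in> koszul_chains (free_module n) s 0 j"
  shows "const_part f \<in> degree_part n s j"
proof -
  have "lookup (f {} b) 0 = 0" if "b \<ge> n" for b
    using koszul_chainsD(1)[OF assms, of "{}"] that by (simp add: free_module_def)
  moreover have "s b = j" if "lookup (f {} b) 0 \<noteq> 0" for b
    using koszul_chainsD(4)[OF assms that] by simp
  ultimately show ?thesis by (auto simp: degree_part_def free_module_def const_part_def)
qed

lemma const_chain_in_koszul_chains:
  assumes "c \<in> degree_part n s j"
  shows "const_chain c \<in> koszul_chains (free_module n) s 0 j"
proof (rule koszul_chainsI)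
  show "const_chain c \<sigma> \<in> free_module n" for \<sigma>
    using assms by (auto simp: const_chain_def free_module_def degree_part_def)
  show "card \<sigma> = 0 \<and> int (mono_deg t) = j - s b - int 0"
    if "lookup (const_chain c \<sigma> b) t \<noteq> 0" for \<sigma> b t
    using assms that by (auto simp: const_chain_def degree_part_def lookup_single when_def split: if_splits)
qed

text \<open>Let \<open>Z\<close> be the image of the map \<open>D\<close> given by \<open>M\<close>,
  in a free module \<open>F\<close>, and let \<open>m\<close> be the ideal of the variables. Koszul
  homology of \<open>Z\<close> in degree 0 is \<open>Z \<inter> m F\<close> modulo
  \<open>m Z\<close>. A preimage \<open>f\<close> of an element of \<open>Z \<inter> m F\<close> has
  its constant part in the kernel of the reduced matrix, and by exactness this part comes from the
  next reduced matrix precisely when \<open>D f\<close> lies in \<open>m Z\<close>.\<close>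

lemma koszul_dim_0_eq_tor_dim:
  fixes M M' :: "nat \<Rightarrow> nat \<Rightarrow> ('v::finite, 'k::field) mpoly"
  assumes M: "\<And>b c. b < n \<Longrightarrow> c < n' \<Longrightarrow> homogeneous (s' c - s b) (M b c)"
    and M': "\<And>b c. b < n' \<Longrightarrow> c < n'' \<Longrightarrow> homogeneous (s'' c - s' b) (M' b c)"
    and exact: "mat_map n' n'' M' ` free_module n'' = {x \<in> free_module n'. mat_map n n' M x = 0}"
  shows "vec.dim {x \<in> degree_part n' s' j. mat_map n n' (\<lambda>b c. lookup (M b c) 0) x = 0} -
      vec.dim (mat_map n' n'' (\<lambda>b c. lookup (M' b c) 0) ` degree_part n'' s'' j) =
    koszul_dim (mat_map n n' M ` free_module n') s 0 j"
proof -
  interpret D: graded_map n' s' n s "mat_map n n' M" by (rule graded_map_mat_map[OF M])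
  interpret D': graded_map n'' s'' n' s' "mat_map n' n'' M'" by (rule graded_map_mat_map[OF M'])
  interpret F: graded_submodule n' s' "free_module n' :: (nat \<Rightarrow> ('v, 'k) mpoly) set"
    by (rule graded_submodule_free_module)
  interpret I: graded_submodule n s D.map_image by (rule D.graded_submodule_image)
  let ?c = "mat_map n n' (\<lambda>b c. lookup (M b c) 0)"
  let ?c' = "mat_map n' n'' (\<lambda>b c. lookup (M' b c) 0)"
  have const_D: "const_part (D.chain_map f) = ?c (const_part f)" for f
    by (simp add: const_part_def D.chain_map_def lookup_mat_map_zero fun_eq_iff)
  have const_D': "const_part (D'.chain_map f) = ?c' (const_part f)" for f
    by (simp add: const_part_def D'.chain_map_def lookup_mat_map_zero fun_eq_iff)
  have const_koszul: "const_part (koszul_diff g) = 0" for g :: "'v set \<Rightarrow> nat \<Rightarrow> ('v, 'k) mpoly"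
    by (simp add: const_part_def lookup_koszul_diff_empty_0 fun_eq_iff)
  have const_diff: "const_part (f - g) = const_part f - const_part g" for f g :: "'v set \<Rightarrow> nat \<Rightarrow> ('v, 'k) mpoly"
    by (simp add: const_part_def fun_eq_iff lookup_minus)
  have diff0: "koszul_diff f = 0" if "f \<in> koszul_chains Z t 0 j" for f :: "'v set \<Rightarrow> nat \<Rightarrow> ('v, 'k) mpoly" and Z t
    using koszul_chainsD(2)[OF that] by (simp add: koszul_diff_def fun_eq_iff card_eq_0_iff)
  have cycles: "koszul_cycles Z t 0 j = {z \<in> koszul_chains Z t 0 j. const_part z = 0}" for Z :: "(nat \<Rightarrow> ('v, 'k) mpoly) set" and t
    using diff0 by (auto simp: koszul_cycles_def const_part_def fun_eq_iff)
  define \<Gamma> where "\<Gamma> = {f \<in> koszul_chains (free_module n') s' 0 j. const_part (D.chain_map f) = 0}"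
  interpret pc: vector_space_pair "chain_scale :: 'k \<Rightarrow> ('v set \<Rightarrow> nat \<Rightarrow> ('v, 'k) mpoly) \<Rightarrow> _"
      "\<lambda>c (x :: nat \<Rightarrow> 'k) b. c * x b"
    by (simp add: vector_space_pair_def vector_space_chain_scale vector_space_pointwise_mult)
  have lin: "Vector_Spaces.linear chain_scale (\<lambda>c x b. c * x b) (const_part \<circ> D.chain_map)"
    using Vector_Spaces.linear_compose[OF D.linear_chain_map linear_const_part] .
  have fin: "chain.fin_subspace \<Gamma>"
  proof (rule chain.fin_subspace_subset[OF F.fin_subspace_koszul_chains])
    show "chain.subspace \<Gamma>"
      using chain.subspace_inter[OF F.subspace_koszul_chains pc.linear_subspace_kernel[OF lin]]
      by (simp add: Int_def \<Gamma>_def)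
  qed (auto simp: \<Gamma>_def)
  have im1: "const_part ` \<Gamma> = {x \<in> degree_part n' s' j. ?c x = 0}"
  proof
    show "const_part ` \<Gamma> \<subseteq> {x \<in> degree_part n' s' j. ?c x = 0}"
      using const_part_in_degree_part by (auto simp: \<Gamma>_def const_D)
    show "{x \<in> degree_part n' s' j. ?c x = 0} \<subseteq> const_part ` \<Gamma>"
    proof clarify
      fix x assume x: "x \<in> degree_part n' s' j" "?c x = 0"
      then have "const_chain x \<in> \<Gamma>"
        using const_chain_in_koszul_chains by (simp add: \<Gamma>_def const_D)
      then show "x \<in> const_part ` \<Gamma>" by (metis const_part_const_chain imageI)
    qed
  qed
  have im2: "D.chain_map ` \<Gamma> = koszul_cycles D.map_image s 0 j"
  proof
    show "D.chain_map ` \<Gamma> \<subseteq> koszul_cycles D.map_image s 0 j"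
      using D.chain_map_chains[OF _ order_refl] by (auto simp: \<Gamma>_def cycles)
    show "koszul_cycles D.map_image s 0 j \<subseteq> D.chain_map ` \<Gamma>"
    proof
      fix z assume z: "z \<in> koszul_cycles D.map_image s 0 j"
      then have "z \<in> koszul_chains D.map_image s 0 j" by (simp add: cycles)
      then obtain f where "f \<in> koszul_chains (free_module n') s' 0 j" "D.chain_map f = z"
        by (rule D.chain_map_lift)
      then show "z \<in> D.chain_map ` \<Gamma>" using z by (auto simp: \<Gamma>_def cycles)
    qed
  qed
  have iff: "const_part f \<in> ?c' ` degree_part n'' s'' j \<longleftrightarrow> D.chain_map f \<in> koszul_boundaries D.map_image s 0 j"
    if f: "f \<in> \<Gamma>" for f
  proof
    assume "const_part f \<in> ?c' ` degree_part n'' s'' j"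
    then obtain x where x: "const_part f = ?c' x" "x \<in> degree_part n'' s'' j" by (rule imageE)
    define e where "e = D'.chain_map (const_chain x)"
    have e_im: "e \<in> koszul_chains D'.map_image s' 0 j"
      unfolding e_def by (rule D'.chain_map_chains[OF const_chain_in_koszul_chains[OF x(2)] order_refl])
    then have e: "e \<in> koszul_chains (free_module n') s' 0 j"
      using koszul_chains_mono[of D'.map_image "free_module n'" s' 0 j] D'.map_in_free by blast
    have "f - e \<in> koszul_chains (free_module n') s' 0 j"
      using e f chain.subspace_diff[OF F.subspace_koszul_chains] by (auto simp: \<Gamma>_def)
    \<comment> \<open>Without constant terms, \<open>f - e\<close> is a boundary of the free
      complex, while \<open>D\<close> kills \<open>e\<close> by exactness.\<close>
    moreover have "const_part (f - e) = 0"
      using x(1) by (simp add: const_diff e_def const_D')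
    ultimately have "f - e \<in> koszul_cycles (free_module n') s' 0 j" by (simp add: cycles)
    then have "f - e \<in> koszul_diff ` koszul_chains (free_module n') s' (Suc 0) j"
      unfolding koszul_boundaries_def[symmetric] by (rule koszul_exact_free_module)
    then obtain h where h: "f - e = koszul_diff h" "h \<in> koszul_chains (free_module n') s' (Suc 0) j"
      by (rule imageE)
    have "D.chain_map e = 0"
      using koszul_chainsD(1)[OF e_im] unfolding exact by (auto simp: D.chain_map_def)
    then have "D.chain_map f = D.chain_map (f - e)" by (simp add: D.chain_map_diff)
    also have "\<dots> = koszul_diff (D.chain_map h)" using h(1) by (simp add: D.koszul_diff_chain_map)
    finally show "D.chain_map f \<in> koszul_boundaries D.map_image s 0 j"
      using D.chain_map_chains[OF h(2) order_refl] unfolding koszul_boundaries_def by blast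
  next
    assume "D.chain_map f \<in> koszul_boundaries D.map_image s 0 j"
    then obtain g where g: "D.chain_map f = koszul_diff g" "g \<in> koszul_chains D.map_image s (Suc 0) j"
      unfolding koszul_boundaries_def by (rule imageE)
    obtain h where h: "h \<in> koszul_chains (free_module n') s' (Suc 0) j" "D.chain_map h = g"
      using D.chain_map_lift[OF g(2)] .
    have fh: "f - koszul_diff h \<in> koszul_chains (free_module n') s' 0 j"
      using F.koszul_diff_chains[OF h(1)] f chain.subspace_diff[OF F.subspace_koszul_chains]
      by (auto simp: \<Gamma>_def)
    moreover have "D.chain_map (f - koszul_diff h) = 0"
      using g(1) h(2) by (simp add: D.chain_map_diff flip: D.koszul_diff_chain_map)
    \<comment> \<open>Exactness in the other direction: what \<open>D\<close> kills comes from the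
      next free module, and \<open>koszul_diff h\<close> has no constant part.\<close>
    ultimately have "f - koszul_diff h \<in> koszul_chains D'.map_image s' 0 j"
      unfolding exact by (auto simp: koszul_chains_def D.chain_map_def fun_eq_iff)
    then obtain e where e: "e \<in> koszul_chains (free_module n'') s'' 0 j" "D'.chain_map e = f - koszul_diff h"
      by (rule D'.chain_map_lift)
    have "const_part f = const_part (f - koszul_diff h)" by (simp add: const_diff const_koszul)
    also have "\<dots> = ?c' (const_part e)" using e(2) const_D' by metis
    finally show "const_part f \<in> ?c' ` degree_part n'' s'' j"
      using const_part_in_degree_part[OF e(1)] by blast
  qed
  have linc': "Vector_Spaces.linear (\<lambda>c (x :: nat \<Rightarrow> 'k) b. c * x b) (\<lambda>c (x :: nat \<Rightarrow> 'k) b. c * x b) ?c'"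
    unfolding Vector_Spaces.linear_iff
    by (auto simp: vector_space_pointwise_mult mat_map_def fun_eq_iff sum.distrib distrib_left
        distrib_right sum_distrib_left ac_simps)
  interpret pv: vector_space_pair "\<lambda>c (x :: nat \<Rightarrow> 'k) b. c * x b" "\<lambda>c (x :: nat \<Rightarrow> 'k) b. c * x b" ..
  have "vec.dim (const_part ` \<Gamma>) - vec.dim (?c' ` degree_part n'' s'' j) =
      chain.dim (D.chain_map ` \<Gamma>) - chain.dim (koszul_boundaries D.map_image s 0 j)"
  proof (rule dim_subquotient_eq[OF linear_const_part D.linear_chain_map fin
        pv.linear_subspace_image[OF linc' subspace_degree_part] I.subspace_koszul_boundaries _ _ iff])
    show "koszul_boundaries D.map_image s 0 j \<subseteq> D.chain_map ` \<Gamma>"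
      unfolding im2 by (rule I.koszul_boundaries_subset_cycles)
    show "?c' ` degree_part n'' s'' j \<subseteq> const_part ` \<Gamma>"
    proof clarify
      fix x assume x: "x \<in> (degree_part n'' s'' j :: (nat \<Rightarrow> 'k) set)"
      define e where "e = D'.chain_map (const_chain x)"
      have e_im: "e \<in> koszul_chains D'.map_image s' 0 j"
        unfolding e_def by (rule D'.chain_map_chains[OF const_chain_in_koszul_chains[OF x] order_refl])
      then have "e \<in> koszul_chains (free_module n') s' 0 j"
        using koszul_chains_mono[of D'.map_image "free_module n'" s' 0 j] D'.map_in_free by blast
      moreover have "D.chain_map e = 0"
        using koszul_chainsD(1)[OF e_im] unfolding exact by (auto simp: D.chain_map_def)
      ultimately have "e \<in> \<Gamma>" by (simp add: \<Gamma>_def const_part_def fun_eq_iff)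
      moreover have "const_part e = ?c' x" by (simp add: e_def const_D')
      ultimately show "?c' x \<in> const_part ` \<Gamma>" by (metis imageI)
    qed
  qed
  then show ?thesis by (simp add: koszul_dim_def im1 im2)
qed

text \<open>An ideal as a submodule of the free module of rank 1, in the same format as the syzygy
  modules.\<close>

definition ideal_vec :: "('v, 'k::field) mpoly set \<Rightarrow> (nat \<Rightarrow> ('v, 'k) mpoly) set" where
  "ideal_vec I = {x. x 0 \<in> I \<and> (\<forall>b>0. x b = 0)}"

definition ideal_koszul_dim :: "('v::finite, 'k::field) mpoly set \<Rightarrow> nat \<Rightarrow> int \<Rightarrow> nat" where
  "ideal_koszul_dim I = koszul_dim (ideal_vec I) (\<lambda>_. 0)"

text \<open>Dimension shifting moves degree \<open>i\<close> over \<open>I\<close> to degree 0 over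
  the \<open>i\<close>-th syzygy module, where Koszul homology is \<open>Tor\<close>. The hypothesis
  \<open>proper\<close> makes the reduced augmentation zero, so that the whole bottom term counts as
  cycles.\<close>

lemma tor_dim_eq_ideal_koszul_dim:
  fixes F :: "('v::finite, 'k::field) mpoly free_complex"
  assumes F: "graded_free_resolution I F" and proper: "\<And>p. p \<in> I \<Longrightarrow> lookup p 0 = 0"
  shows "kdim (tor_cycles F i j) - kdim (tor_boundaries F i j) = ideal_koszul_dim I i j"
proof -
  \<comment> \<open>The ring is put in front of the resolution as term 0, with the augmentation as
    its matrix, so that \<open>I\<close> is the image of a map like the syzygy modules.\<close>
  define r where "r i = (case i of 0 \<Rightarrow> 1 | Suc q \<Rightarrow> rank F q)" for i
  define sh where "sh i = (case i of 0 \<Rightarrow> (\<lambda>_. 0) | Suc q \<Rightarrow> shift F q)" for i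
  define Mt where "Mt i = (case i of 0 \<Rightarrow> (\<lambda>b. aug F) | Suc q \<Rightarrow> dmat F q)" for i
  let ?D = "\<lambda>i. mat_map (r i) (r (Suc i)) (Mt i)"
  have hom: "homogeneous (sh (Suc i) c - sh i b) (Mt i b c)" if "b < r i" "c < r (Suc i)" for i b c
    using F that unfolding graded_free_resolution_def r_def sh_def Mt_def by (cases i) auto
  interpret D: graded_map "r (Suc q)" "sh (Suc q)" "r q" "sh q" "?D q" for q
    by (rule graded_map_mat_map[OF hom])
  have D0: "?D 0 x = (\<lambda>b. if b = 0 then aug_map F x else 0)" for x
    by (auto simp: mat_map_def aug_map_def r_def Mt_def fun_eq_iff)
  have DS: "?D (Suc i) = diff_map F i" for i
    by (simp add: diff_map_def r_def Mt_def)
  have exact: "?D (Suc i) ` free_module (r (Suc (Suc i))) = {x \<in> free_module (r (Suc i)). ?D i x = 0}" for i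
  proof (cases i)
    case 0
    have "?D 0 x = 0 \<longleftrightarrow> aug_map F x = 0" for x unfolding D0 by (auto simp: fun_eq_iff)
    then show ?thesis
      using F unfolding 0 DS by (simp add: graded_free_resolution_def r_def)
  next
    case (Suc q)
    show ?thesis
      using F unfolding Suc DS by (simp add: graded_free_resolution_def r_def)
  qed
  have im0: "?D 0 ` free_module (r (Suc 0)) = ideal_vec I"
  proof
    have augI: "aug_map F ` free_module (r (Suc 0)) = I"
      using F by (simp add: graded_free_resolution_def r_def)
    then show "?D 0 ` free_module (r (Suc 0)) \<subseteq> ideal_vec I"
      unfolding D0 ideal_vec_def by auto
    show "ideal_vec I \<subseteq> ?D 0 ` free_module (r (Suc 0))"
    proof
      fix y assume y: "y \<in> ideal_vec I"
      then have "y 0 \<in> aug_map F ` free_module (r (Suc 0))"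
        unfolding augI by (simp add: ideal_vec_def)
      then obtain x where x: "y 0 = aug_map F x" "x \<in> free_module (r (Suc 0))" by (rule imageE)
      have "y = ?D 0 x"
      proof
        show "y b = ?D 0 x b" for b using y x(1) unfolding D0 ideal_vec_def by (cases "b = 0") auto
      qed
      then show "y \<in> ?D 0 ` free_module (r (Suc 0))" using x(2) by (rule image_eqI)
    qed
  qed
  have shiftdim: "koszul_dim (?D q ` free_module (r (Suc q))) (sh q) p j =
      koszul_dim (?D (q + p) ` free_module (r (Suc (q + p)))) (sh (q + p)) 0 j" for q p
  proof (induction p arbitrary: q)
    case (Suc p)
    have "koszul_dim (?D q ` free_module (r (Suc q))) (sh q) (Suc p) j =
        koszul_dim (?D (Suc q) ` free_module (r (Suc (Suc q)))) (sh (Suc q)) p j"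
      unfolding exact by (rule D.koszul_dim_kernel[symmetric])
    then show ?case using Suc.IH[of "Suc q"] by simp
  qed simp
  have aug0: "lookup (aug F c) 0 = 0" if "c < rank F 0" for c
  proof -
    let ?e = "\<lambda>b. if b = c then 1 else 0 :: ('v, 'k) mpoly"
    have "aug F c = aug_map F ?e"
      using that by (simp add: aug_map_def if_distrib[of "(*) _"] cong: if_cong)
    moreover have "?e \<in> free_module (rank F 0)" using that by (auto simp: free_module_def)
    ultimately have "aug F c \<in> aug_map F ` free_module (rank F 0)" by (rule image_eqI)
    then have "aug F c \<in> I" using F unfolding graded_free_resolution_def by simp
    then show ?thesis by (rule proper)
  qed
  have cyc: "tor_cycles F i j = {x \<in> degree_part (r (Suc i)) (sh (Suc i)) j.
      mat_map (r i) (r (Suc i)) (\<lambda>b c. lookup (Mt i b c) 0) x = 0}"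
  proof (cases i)
    case 0
    have "mat_map (r 0) (r (Suc 0)) (\<lambda>b c. lookup (Mt 0 b c) 0) x = 0" for x
      by (simp add: mat_map_def r_def Mt_def aug0 fun_eq_iff)
    then show ?thesis
      by (simp add: 0 tor_cycles_def tor_chains_def degree_part_def r_def sh_def)
  next
    case (Suc q)
    then show ?thesis
      by (simp add: tor_cycles_def tor_chains_def degree_part_def r_def sh_def Mt_def tor_diff_def)
  qed
  have bnd: "tor_boundaries F i j = mat_map (r (Suc i)) (r (Suc (Suc i))) (\<lambda>b c. lookup (Mt (Suc i) b c) 0) `
      degree_part (r (Suc (Suc i))) (sh (Suc (Suc i))) j"
    by (simp add: tor_boundaries_def tor_chains_def degree_part_def r_def sh_def Mt_def tor_diff_def)
  have "kdim (tor_cycles F i j) - kdim (tor_boundaries F i j) =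
      koszul_dim (?D i ` free_module (r (Suc i))) (sh i) 0 j"
    unfolding kdim_def cyc bnd
    by (rule koszul_dim_0_eq_tor_dim[where s' = "sh (Suc i)" and s'' = "sh (Suc (Suc i))"])
       (use hom exact in auto)
  also have "\<dots> = koszul_dim (ideal_vec I) (\<lambda>_. 0) i j"
    using shiftdim[of 0 i] im0 by (simp add: sh_def)
  finally show ?thesis unfolding ideal_koszul_dim_def .
qed



section \<open>Existence of graded free resolutions\<close>

lemma (in graded_submodule) sum_components:
  assumes x: "x \<in> Z"
  obtains J where "finite J" "x = (\<Sum>j\<in>J. vec_component s j x)"
proof
  define J where "J = (\<Union>b\<in>{..<n}. (\<lambda>t. int (mono_deg t) + s b) ` keys (x b))"
  show "finite J" unfolding J_def by auto
  show "x = (\<Sum>j\<in>J. vec_component s j x)"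
  proof (intro ext poly_mapping_eqI)
    fix b t
    have "lookup (x b) t = 0" if "int (mono_deg t) + s b \<notin> J"
    proof (rule ccontr)
      assume ne: "lookup (x b) t \<noteq> 0"
      then have "b < n" using x in_free by (cases "b < n") (auto simp: free_module_def)
      moreover have "t \<in> keys (x b)" using ne by (simp add: in_keys_iff)
      ultimately have "int (mono_deg t) + s b \<in> J" unfolding J_def by blast
      then show False using that by simp
    qed
    moreover have "lookup ((\<Sum>j\<in>J. vec_component s j x) b) t =
        (\<Sum>j\<in>J. if j = int (mono_deg t) + s b then lookup (x b) t else 0)"
      by (auto simp: sum_fun_apply lookup_sum vec_component_def lookup_hom_component intro!: sum.cong)
    ultimately show "lookup (x b) t = lookup ((\<Sum>j\<in>J. vec_component s j x) b) t"
      using \<open>finite J\<close> by simp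
  qed
qed

text \<open>Graded Nakayama: an element outside the finitely many degrees in which there are minimal
  generators is a combination of elements of lower degree.\<close>

lemma (in graded_submodule) exists_presentation:
  assumes fin: "finite {j. koszul_dim Z s 0 j \<noteq> 0}"
  obtains n' s' M where "\<And>b c. b < n \<Longrightarrow> c < n' \<Longrightarrow> homogeneous (s' c - s b) (M b c)"
    and "mat_map n n' M ` free_module n' = Z"
proof -
  \<comment> \<open>Minimal generators live in the degrees of the first set. The degrees
    \<open>s b\<close> are added because elements with a constant coefficient are not Koszul cycles
    and so are invisible to \<open>koszul_dim\<close>.\<close>
  define B where "B = {j. koszul_dim Z s 0 j \<noteq> 0} \<union> s ` {..<n}"
  have "finite B" using fin by (simp add: B_def)
  have "\<exists>C. finite C \<and> C \<subseteq> koszul_chains Z s 0 j \<and> koszul_chains Z s 0 j \<subseteq> chain.span C" for j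
    using chain.basis_exists[of "koszul_chains Z s 0 j"]
      chain.fin_subspace_independent_finite[OF fin_subspace_koszul_chains[of 0 j]] by metis
  then obtain C where C: "\<And>j. finite (C j)" "\<And>j. C j \<subseteq> koszul_chains Z s 0 j"
      "\<And>j. koszul_chains Z s 0 j \<subseteq> chain.span (C j)" by metis
  obtain gs where gs: "set gs = (SIGMA j:B. (\<lambda>z. z {}) ` C j)"
    using finite_list[of "SIGMA j:B. (\<lambda>z. z {}) ` C j"] \<open>finite B\<close> C(1) by blast
  define n' where "n' = length gs"
  define s' where "s' c = fst (gs ! c)" for c
  define M where "M b c = snd (gs ! c) b" for b c
  have col: "(\<lambda>b. M b c) \<in> Z \<and> (\<forall>b. homogeneous (s' c - s b) (M b c))" if "c < n'" for c
  proof -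
    have "gs ! c \<in> (SIGMA j:B. (\<lambda>z. z {}) ` C j)" using that gs nth_mem unfolding n'_def by blast
    then obtain z where "z \<in> C (s' c)" "snd (gs ! c) = z {}" unfolding s'_def by auto
    then have "snd (gs ! c) = z {}" "z \<in> koszul_chains Z s 0 (s' c)" using C(2) by blast+
    then show ?thesis
      using koszul_chainsD(1,3)[of z Z s 0 "s' c"] unfolding M_def by simp
  qed
  have hom: "homogeneous (s' c - s b) (M b c)" if "b < n" "c < n'" for b c
    using col that by blast
  interpret D: graded_map n' s' n s "mat_map n n' M" by (rule graded_map_mat_map[OF hom])
  interpret I: graded_submodule n s D.map_image by (rule D.graded_submodule_image)
  have gen: "snd g \<in> D.map_image" if g: "g \<in> set gs" for g
  proof -
    obtain c where c: "c < n'" "g = gs ! c" using g unfolding n'_def by (metis in_set_conv_nth)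
    let ?e = "\<lambda>b. if b = c then 1 else 0 :: ('v, 'k) mpoly"
    have "snd g b = 0" if "b \<ge> n" for b
      using col[OF c(1)] in_free that c(2) unfolding M_def free_module_def by auto
    then have "snd g = mat_map n n' M ?e"
      using c by (auto simp: mat_map_def M_def fun_eq_iff if_distrib[of "(*) _"] cong: if_cong)
    moreover have "?e \<in> free_module n'" using c(1) by (auto simp: free_module_def)
    ultimately show ?thesis by (rule image_eqI)
  qed
  have sub: "D.map_image \<subseteq> Z"
  proof clarify
    fix x :: "nat \<Rightarrow> ('v, 'k) mpoly"
    assume "x \<in> free_module n'"
    have "M b c = 0" if "b \<ge> n" "c < n'" for b c
      using col[OF that(2)] in_free that(1) unfolding free_module_def by auto
    then have "mat_map n n' M x = (\<Sum>c<n'. (\<lambda>b. x c * M b c))"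
      by (auto simp: mat_map_def fun_eq_iff sum_fun_apply mult.commute)
    also have "\<dots> \<in> Z" using col mult_mem by (intro sum_mem) auto
    finally show "mat_map n n' M x \<in> Z" .
  qed
  \<comment> \<open>A lower bound for all degrees in the free module, on which the induction rests;
    the inserted 0 keeps the set nonempty for \<open>n = 0\<close>.\<close>
  define L where "L = Min (insert 0 (s ` {..<n}))"
  have L: "L \<le> s b" if "b < n" for b
    unfolding L_def using that by (intro Min_le) auto
  have hom_gen: "z {} \<in> D.map_image" if "z \<in> koszul_chains Z s 0 j" for z j
    using that
  proof (induction "nat (j - L)" arbitrary: j z rule: less_induct)
    case less
    show ?case
    proof (cases "j \<in> B")
      case True
      have "chain.subspace {z :: 'v set \<Rightarrow> nat \<Rightarrow> ('v, 'k) mpoly. z {} \<in> D.map_image}"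
        unfolding chain.subspace_def
        using I.zero_mem I.add_mem I.mult_mem by (auto simp: chain_scale_def)
      moreover have "C j \<subseteq> {z. z {} \<in> D.map_image}"
      proof
        fix z assume "z \<in> C j"
        then have "(j, z {}) \<in> set gs" using True unfolding gs by blast
        then show "z \<in> {z. z {} \<in> D.map_image}" using gen[of "(j, z {})"] by simp
      qed
      ultimately show ?thesis using less.prems C(3)[of j] chain.span_minimal by blast
    next
      case False
      have c0: "lookup (z {} b) 0 = 0" for b
      proof (rule ccontr)
        assume ne: "lookup (z {} b) 0 \<noteq> 0"
        then have "b < n" using koszul_chainsD(1)[OF less.prems, of "{}"] in_free
          by (cases "b < n") (auto simp: free_module_def)
        then show False using koszul_chainsD(4)[OF less.prems ne] False by (auto simp: B_def)
      qed
      have "koszul_diff z = 0"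
        using koszul_chainsD(2)[OF less.prems] by (simp add: koszul_diff_def fun_eq_iff card_eq_0_iff)
      then have "z \<in> koszul_cycles Z s 0 j" using less.prems c0 by (simp add: koszul_cycles_def)
      moreover have "koszul_dim Z s 0 j = 0" using False by (simp add: B_def)
      ultimately have "z \<in> koszul_diff ` koszul_chains Z s (Suc 0) j"
        unfolding koszul_dim_eq_0_iff koszul_boundaries_def by blast
      then obtain g where g: "z = koszul_diff g" "g \<in> koszul_chains Z s (Suc 0) j" by (rule imageE)
      have gw: "g {w} \<in> D.map_image" for w
      \<comment> \<open>The measure \<open>nat (j - L)\<close> does not decrease for
        \<open>j \<le> L\<close>, but then \<open>g {w}\<close> has degree below \<open>L\<close>
        and is 0.\<close>
      proof (cases "j \<le> L")
        case True
        have "g {w} = 0"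
        proof (intro ext poly_mapping_eqI)
          fix b t
          show "lookup (g {w} b) t = lookup ((0 :: nat \<Rightarrow> ('v, 'k) mpoly) b) t"
          proof (cases "b < n")
            case True
            then show ?thesis using koszul_chainsD(4)[OF g(2), of "{w}" b t] L[of b] \<open>j \<le> L\<close> by fastforce
          next
            case False
            then show ?thesis using koszul_chainsD(1)[OF g(2), of "{w}"] in_free by (auto simp: free_module_def)
          qed
        qed
        then show ?thesis by (simp add: I.zero_mem)
      next
        case False
        define y where "y = (\<lambda>\<sigma> :: 'v set. if \<sigma> = {} then g {w} else 0)"
        have "y \<in> koszul_chains Z s 0 (j - 1)"
          using koszul_chainsD(1)[OF g(2)] koszul_chainsD(3)[OF g(2), where \<sigma> = "{w}"] zero_mem
          by (auto simp: koszul_chains_def y_def card_eq_0_iff algebra_simps)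
        moreover have "nat (j - 1 - L) < nat (j - L)" using False by simp
        ultimately have "y {} \<in> D.map_image" using less.hyps by blast
        then show ?thesis by (simp add: y_def)
      qed
      have "z {} = (\<Sum>w\<in>UNIV. (\<lambda>b. Poly_Mapping.single (Poly_Mapping.single w 1) (koszul_sign w {}) * g {w} b))"
        unfolding g(1) by (simp add: koszul_diff_def fun_eq_iff sum_fun_apply)
      also have "\<dots> \<in> D.map_image"
      proof (rule I.sum_mem)
        show "(\<lambda>b. Poly_Mapping.single (Poly_Mapping.single w 1) (koszul_sign w {}) * g {w} b) \<in> D.map_image" for w
          by (rule I.mult_mem) (rule gw)
      qed
      finally show ?thesis .
    qed
  qed
  have "Z \<subseteq> D.map_image"
  proof
    fix x assume x: "x \<in> Z"
    obtain J where J: "finite J" "x = (\<Sum>j\<in>J. vec_component s j x)" using sum_components[OF x] .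
    have "vec_component s j x \<in> D.map_image" for j
    proof -
      define y where "y = (\<lambda>\<sigma> :: 'v set. if \<sigma> = {} then vec_component s j x else 0)"
      have "y \<in> koszul_chains Z s 0 j"
        using component_mem[OF x] zero_mem homogeneous_hom_component
        by (auto simp: koszul_chains_def y_def card_eq_0_iff vec_component_def)
      then have "y {} \<in> D.map_image" by (rule hom_gen)
      then show ?thesis by (simp add: y_def)
    qed
    then have "(\<Sum>j\<in>J. vec_component s j x) \<in> D.map_image" by (intro I.sum_mem)
    then show "x \<in> D.map_image" by (subst J(2))
  qed
  with sub have "D.map_image = Z" by (rule subset_antisym)
  then show ?thesis using that[of n' s' M] hom by blast
qed

text \<open>Presentations of successive kernels are chained by dependent choice. Finiteness is
  demanded for every \<open>p\<close> because degree \<open>p\<close> over a kernel is degree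
  \<open>p + 1\<close> over the image before it, so the invariant passes on.\<close>

theorem graded_free_resolution_exists:
  fixes I :: "('v::finite, 'k::field) mpoly set"
  assumes I: "graded_submodule 1 (\<lambda>_. 0) (ideal_vec I)"
    and fin: "\<And>p. finite {j. ideal_koszul_dim I p j \<noteq> 0}"
  shows "\<exists>F. graded_free_resolution I F"
proof -
  let ?P = "\<lambda>q (n, s, Z, n', s', M). graded_submodule n s (Z :: (nat \<Rightarrow> ('v, 'k) mpoly) set) \<and>
     (\<forall>p. finite {j. koszul_dim Z s p j \<noteq> 0}) \<and>
     (\<forall>b<n. \<forall>c<n'. homogeneous (s' c - s b) (M b c)) \<and> mat_map n n' M ` free_module n' = Z \<and>
     (q = 0 \<longrightarrow> n = 1 \<and> s = (\<lambda>_. 0 :: int) \<and> Z = ideal_vec I)"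
  let ?Q = "\<lambda>q :: nat. \<lambda>(n, s :: nat \<Rightarrow> int, Z :: (nat \<Rightarrow> ('v, 'k) mpoly) set, n', s', M) (n1, s1, Z1, n1' :: nat, s1' :: nat \<Rightarrow> int,
      M1 :: nat \<Rightarrow> nat \<Rightarrow> ('v, 'k) mpoly). n1 = n' \<and> s1 = s' \<and> Z1 = {x \<in> free_module n'. mat_map n n' M x = 0}"
  have "\<exists>f. \<forall>q. ?P q (f q) \<and> ?Q q (f q) (f (Suc q))"
  proof (rule dependent_nat_choice)
    interpret graded_submodule 1 "\<lambda>_. 0" "ideal_vec I" by (rule I)
    obtain n' s' M where "\<And>b c. b < 1 \<Longrightarrow> c < n' \<Longrightarrow> homogeneous (s' c - 0) (M b c)"
        and "mat_map 1 n' M ` free_module n' = ideal_vec I"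
      by (rule exists_presentation[OF fin[of 0, unfolded ideal_koszul_dim_def]]) blast
    then have "?P 0 (1, \<lambda>_. 0, ideal_vec I, n', s', M)"
      using I fin by (simp add: ideal_koszul_dim_def)
    then show "\<exists>x. ?P 0 x" by (rule exI)
  next
    fix x and q :: nat assume x: "?P q x"
    obtain n s Z n' s' M where [simp]: "x = (n, s, Z, n', s', M)" by (cases x)
    have hom: "\<And>b c. b < n \<Longrightarrow> c < n' \<Longrightarrow> homogeneous (s' c - s b) (M b c)" using x by simp
    interpret D: graded_map n' s' n s "mat_map n n' M" by (rule graded_map_mat_map[OF hom])
    interpret K: graded_submodule n' s' D.map_kernel by (rule D.graded_submodule_kernel)
    have finK: "finite {j. koszul_dim D.map_kernel s' p j \<noteq> 0}" for p
      using x D.koszul_dim_kernel by simp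
    obtain n1 s1 M1 where "\<And>b c. b < n' \<Longrightarrow> c < n1 \<Longrightarrow> homogeneous (s1 c - s' b) (M1 b c)"
        and "mat_map n' n1 M1 ` free_module n1 = D.map_kernel"
      by (rule K.exists_presentation[OF finK]) blast
    then have "?P (Suc q) (n', s', D.map_kernel, n1, s1, M1) \<and> ?Q q x (n', s', D.map_kernel, n1, s1, M1)"
      using finK K.graded_submodule_axioms by simp
    then show "\<exists>y. ?P (Suc q) y \<and> ?Q q x y" by (rule exI)
  qed
  then obtain f where PQ: "\<forall>q. ?P q (f q) \<and> ?Q q (f q) (f (Suc q))" by (rule exE)
  have f: "?P q (f q)" "?Q q (f q) (f (Suc q))" for q
    using PQ[THEN spec, of q] by (rule conjunct1, rule conjunct2)
  define n where "n q = fst (f q)" for q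
  define s where "s q = fst (snd (f q))" for q
  define Z where "Z q = fst (snd (snd (f q)))" for q
  define M where "M q = snd (snd (snd (snd (snd (f q)))))" for q
  have step: "fst (snd (snd (snd (f q)))) = n (Suc q)" "fst (snd (snd (snd (snd (f q))))) = s (Suc q)"
    "Z (Suc q) = {x \<in> free_module (n (Suc q)). mat_map (n q) (n (Suc q)) (M q) x = 0}" for q
    using f(2)[of q] unfolding n_def s_def Z_def M_def by (auto simp: split_beta)
  have hom: "homogeneous (s (Suc q) c - s q b) (M q b c)" if "b < n q" "c < n (Suc q)" for q b c
    using f(1)[of q] that step(1,2)[of q, symmetric] unfolding n_def[of q] s_def[of q] M_def
    by (auto simp: split_beta)
  have img: "mat_map (n q) (n (Suc q)) (M q) ` free_module (n (Suc q)) = Z q" for q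
    using f(1)[of q] step(1)[of q, symmetric] unfolding n_def[of q] Z_def M_def
    by (auto simp: split_beta)
  have init: "n 0 = 1" "s 0 = (\<lambda>_. 0)" "Z 0 = ideal_vec I"
    using f(1)[of 0] unfolding n_def s_def Z_def by (auto simp: split_beta)
  define F where "F = \<lparr>rank = (\<lambda>q. n (Suc q)), shift = (\<lambda>q. s (Suc q)), aug = M 0 0, dmat = (\<lambda>q. M (Suc q))\<rparr>"
  have D0: "mat_map (n 0) (n (Suc 0)) (M 0) x = (\<lambda>b. if b = 0 then aug_map F x else 0)" for x
    by (auto simp: mat_map_def aug_map_def F_def init fun_eq_iff)
  have rk: "rank F q = n (Suc q)" for q
    by (simp add: F_def)
  have DS: "diff_map F q = mat_map (n (Suc q)) (n (Suc (Suc q))) (M (Suc q))" for q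
    by (simp add: diff_map_def F_def)
  have aug: "aug_map F ` free_module (rank F 0) = I"
  proof
    have r: "rank F 0 = n (Suc 0)" by (simp add: F_def)
    show "aug_map F ` free_module (rank F 0) \<subseteq> I"
    proof clarify
      fix x :: "nat \<Rightarrow> ('v, 'k) mpoly" assume "x \<in> free_module (rank F 0)"
      then have "mat_map (n 0) (n (Suc 0)) (M 0) x \<in> ideal_vec I"
        using img[of 0] unfolding init(3) r by blast
      then show "aug_map F x \<in> I" unfolding D0 ideal_vec_def by simp
    qed
    show "I \<subseteq> aug_map F ` free_module (rank F 0)"
    proof
      fix p assume "p \<in> I"
      then have "(\<lambda>b. if b = 0 then p else 0) \<in> ideal_vec I" by (simp add: ideal_vec_def)
      then have "(\<lambda>b. if b = 0 then p else 0) \<in> mat_map (n 0) (n (Suc 0)) (M 0) ` free_module (n (Suc 0))"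
        using img[of 0] init(3) by simp
      then obtain x where x: "(\<lambda>b. if b = 0 then p else 0) = mat_map (n 0) (n (Suc 0)) (M 0) x"
          "x \<in> free_module (n (Suc 0))" by (rule imageE)
      have "p = aug_map F x" using fun_cong[OF x(1), of 0] unfolding D0 by simp
      then show "p \<in> aug_map F ` free_module (rank F 0)" using x(2) r by (intro image_eqI) auto
    qed
  qed
  have "mat_map (n 0) (n (Suc 0)) (M 0) x = 0 \<longleftrightarrow> aug_map F x = 0" for x
    unfolding D0 by (auto simp: fun_eq_iff)
  then have ex0: "diff_map F 0 ` free_module (rank F (Suc 0)) = {x \<in> free_module (rank F 0). aug_map F x = 0}"
    using img[of "Suc 0"] step(3)[of 0] by (simp add: DS rk)
  have exS: "diff_map F (Suc q) ` free_module (rank F (Suc (Suc q))) =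
      {x \<in> free_module (rank F (Suc q)). diff_map F q x = 0}" for q
    using img[of "Suc (Suc q)"] step(3)[of "Suc q"] by (simp add: DS rk)
  have hom0: "homogeneous (shift F 0 b) (aug F b)" if "b < rank F 0" for b
    using hom[of 0 0 b] that by (simp add: F_def init)
  have homS: "homogeneous (shift F (Suc q) c - shift F q b) (dmat F q b c)"
    if "b < rank F q" "c < rank F (Suc q)" for q b c
    using hom[of b "Suc q" c] that by (simp add: F_def)
  have "graded_free_resolution I F"
    unfolding graded_free_resolution_def
    by (intro conjI allI impI hom0 homS aug ex0 exS)
  then show ?thesis ..
qed

lemma betti_eq_ideal_koszul_dim:
  fixes I :: "('v::finite, 'k::field) mpoly set"
  assumes "graded_submodule 1 (\<lambda>_. 0) (ideal_vec I)"
    and "\<And>p. finite {j. ideal_koszul_dim I p j \<noteq> 0}"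
    and "\<And>p. p \<in> I \<Longrightarrow> lookup p 0 = 0"
  shows "betti I i j = ideal_koszul_dim I i j"
  unfolding betti_def Let_def
  by (rule tor_dim_eq_ideal_koszul_dim[OF someI_ex assms(3)])
     (use graded_free_resolution_exists assms(1,2) in blast)+



section \<open>Koszul homology of monomial ideals\<close>

text \<open>An ideal when \<open>M\<close> is \<open>dvd_closed\<close>. With the set of monomials
  as the datum, sums and intersections of monomial ideals become unions and intersections of
  sets.\<close>

definition monomial_span :: "'v mono set \<Rightarrow> ('v, 'k::field) mpoly set" where
  "monomial_span M = {p. keys p \<subseteq> M}"

definition multiples :: "'v mono set \<Rightarrow> 'v mono set" where
  "multiples A = {t. \<exists>s\<in>A. mono_dvd s t}"

definition dvd_closed :: "'v mono set \<Rightarrow> bool" where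
  "dvd_closed M \<longleftrightarrow> (\<forall>s t. s \<in> M \<longrightarrow> mono_dvd s t \<longrightarrow> t \<in> M)"

lemma dvd_closed_multiples: "dvd_closed (multiples A)"
  unfolding dvd_closed_def multiples_def using mono_dvd_trans by blast

lemma subset_multiples: "A \<subseteq> multiples A"
  unfolding multiples_def using mono_dvd_refl by blast

lemma multiples_Un: "multiples (A \<union> B) = multiples A \<union> multiples B"
  unfolding multiples_def by blast

lemma mono_dvd_zero_iff: "mono_dvd s 0 \<longleftrightarrow> s = 0"
  by (auto simp: mono_dvd_iff poly_mapping_eq_iff fun_eq_iff)

lemma zero_in_multiples_iff: "0 \<in> multiples A \<longleftrightarrow> 0 \<in> A"
  by (simp add: multiples_def mono_dvd_zero_iff)

lemma mono_dvd_minus_single: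
  assumes "mono_dvd s t" "lookup s u < lookup t u"
  shows "mono_dvd s (t - Poly_Mapping.single u 1)"
  unfolding mono_dvd_iff
proof
  fix x
  show "lookup s x \<le> lookup (t - Poly_Mapping.single u 1) x"
    using assms by (cases "x = u") (auto simp: mono_dvd_iff lookup_minus lookup_single)
qed

lemma monomial_in_monomial_span [simp]: "(monomial t :: ('v, 'k::field) mpoly) \<in> monomial_span M \<longleftrightarrow> t \<in> M"
  by (simp add: monomial_def monomial_span_def)

lemma monomial_span_mult:
  assumes "dvd_closed M" "p \<in> monomial_span M"
  shows "q * p \<in> monomial_span M"
proof -
  have "t \<in> M" if t: "t \<in> keys (q * p)" for t
  proof -
    obtain a b where "t = a + b" "b \<in> keys p" using keys_mult[of q p] t by blast
    then show ?thesis
      using assms unfolding dvd_closed_def monomial_span_def mono_dvd_def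
      by (metis (mono_tags, lifting) add.commute mem_Collect_eq subsetD)
  qed
  then show ?thesis by (auto simp: monomial_span_def)
qed

lemma monomial_span_add:
  "p \<in> monomial_span M \<Longrightarrow> q \<in> monomial_span M \<Longrightarrow> p + q \<in> monomial_span M"
  using keys_add[of p q] by (auto simp: monomial_span_def)

lemma monomial_span_Int: "monomial_span M \<inter> monomial_span N = monomial_span (M \<inter> N)"
  by (auto simp: monomial_span_def)

lemma module_mult_self: "module ((*) :: 'a::comm_ring_1 \<Rightarrow> 'a \<Rightarrow> 'a)"
  by unfold_locales (auto simp: algebra_simps)

text \<open>\<open>X\<close> may contain more than monomials: in \<open>L_ideal\<close> the
  generating set consists of whole ideals multiplied by a monomial.\<close>

lemma ideal_gen_eq_monomial_span:
  fixes X :: "('v, 'k::field) mpoly set"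
  assumes sub: "X \<subseteq> monomial_span (multiples B)" and gen: "monomial ` B \<subseteq> X"
  shows "ideal_gen X = monomial_span (multiples B)"
proof -
  interpret ring: module "(*) :: ('v, 'k) mpoly \<Rightarrow> _" by (rule module_mult_self)
  have "ring.subspace (monomial_span (multiples B))"
    unfolding ring.subspace_def
  proof (intro conjI ballI allI)
    show "0 \<in> monomial_span (multiples B)" by (simp add: monomial_span_def)
  qed (auto intro: monomial_span_add monomial_span_mult[OF dvd_closed_multiples])
  then have "ring.span X \<subseteq> monomial_span (multiples B)"
    by (rule ring.span_minimal[OF sub])
  moreover have "p \<in> ring.span X" if p: "p \<in> monomial_span (multiples B)" for p
  proof -
    have "Poly_Mapping.single t (lookup p t) \<in> ring.span X" if t: "t \<in> keys p" for t
    proof -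
      obtain s u where s: "s \<in> B" "t = s + u"
        using p t unfolding monomial_span_def multiples_def mono_dvd_def by blast
      have "Poly_Mapping.single u (lookup p t) * monomial s \<in> ring.span X"
        using s gen by (intro ring.span_scale ring.span_base) auto
      then show ?thesis by (simp add: monomial_def mult_single s add.commute)
    qed
    then have "(\<Sum>t\<in>keys p. Poly_Mapping.single t (lookup p t)) \<in> ring.span X"
      by (rule ring.span_sum)
    moreover have "(\<Sum>t\<in>keys p. Poly_Mapping.single t (lookup p t)) = p"
      by (intro poly_mapping_eqI) (auto simp: lookup_sum lookup_single when_def in_keys_iff)
    ultimately show ?thesis by simp
  qed
  ultimately show ?thesis unfolding ideal_gen_def by blast
qed

lemma graded_submodule_monomial_span:
  assumes "dvd_closed M"
  shows "graded_submodule 1 (\<lambda>_. 0) (ideal_vec (monomial_span M :: ('v::finite, 'k::field) mpoly set))"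
proof
  fix x y :: "nat \<Rightarrow> ('v, 'k) mpoly" and p :: "('v, 'k) mpoly" and j
  show "ideal_vec (monomial_span M) \<subseteq> free_module 1"
    by (auto simp: ideal_vec_def free_module_def)
  show "0 \<in> ideal_vec (monomial_span M)"
    by (simp add: ideal_vec_def monomial_span_def)
  show "x + y \<in> ideal_vec (monomial_span M)"
    if "x \<in> ideal_vec (monomial_span M)" "y \<in> ideal_vec (monomial_span M)"
    using that by (simp add: ideal_vec_def monomial_span_add)
  show "(\<lambda>b. p * x b) \<in> ideal_vec (monomial_span M)" if "x \<in> ideal_vec (monomial_span M)"
    using that by (simp add: ideal_vec_def monomial_span_mult[OF assms])
  show "vec_component (\<lambda>_. 0) j x \<in> ideal_vec (monomial_span M)" if "x \<in> ideal_vec (monomial_span M)"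
    using that by (auto simp: ideal_vec_def monomial_span_def vec_component_def in_keys_iff
        lookup_hom_component subset_iff)
qed

section \<open>Koszul homology in terms of sets of monomials\<close>

abbreviation mono_chains :: "'v::finite mono set \<Rightarrow> nat \<Rightarrow> int \<Rightarrow> ('v set \<Rightarrow> nat \<Rightarrow> ('v, 'k::field) mpoly) set" where
  "mono_chains M \<equiv> koszul_chains (ideal_vec (monomial_span M)) (\<lambda>_. 0)"

abbreviation mono_cycles :: "'v::finite mono set \<Rightarrow> nat \<Rightarrow> int \<Rightarrow> ('v set \<Rightarrow> nat \<Rightarrow> ('v, 'k::field) mpoly) set" where
  "mono_cycles M \<equiv> koszul_cycles (ideal_vec (monomial_span M)) (\<lambda>_. 0)"

abbreviation mono_boundaries :: "'v::finite mono set \<Rightarrow> nat \<Rightarrow> int \<Rightarrow> ('v set \<Rightarrow> nat \<Rightarrow> ('v, 'k::field) mpoly) set" where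
  "mono_boundaries M \<equiv> koszul_boundaries (ideal_vec (monomial_span M)) (\<lambda>_. 0)"

definition mono_koszul_dim :: "'k::field itself \<Rightarrow> 'v::finite mono set \<Rightarrow> nat \<Rightarrow> int \<Rightarrow> nat" where
  "mono_koszul_dim k M = ideal_koszul_dim (monomial_span M :: ('v, 'k) mpoly set)"

lemma ideal_vec_monomial_span_iff:
  "x \<in> ideal_vec (monomial_span M) \<longleftrightarrow> (\<forall>b t. lookup (x b) t \<noteq> 0 \<longrightarrow> b = 0 \<and> t \<in> M)"
proof
  assume "x \<in> ideal_vec (monomial_span M)"
  then show "\<forall>b t. lookup (x b) t \<noteq> 0 \<longrightarrow> b = 0 \<and> t \<in> M"
    by (auto simp: ideal_vec_def monomial_span_def in_keys_iff subset_iff) (metis lookup_zero not_gr_zero)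
next
  assume *: "\<forall>b t. lookup (x b) t \<noteq> 0 \<longrightarrow> b = 0 \<and> t \<in> M"
  have "x b = 0" if "b > 0" for b
    by (rule poly_mapping_eqI) (use * that in auto)
  then show "x \<in> ideal_vec (monomial_span M)"
    using * by (auto simp: ideal_vec_def monomial_span_def in_keys_iff)
qed

lemma mono_chains_iff:
  "z \<in> mono_chains M p j \<longleftrightarrow> (\<forall>\<sigma> b t. lookup (z \<sigma> b) t \<noteq> 0 \<longrightarrow>
     b = 0 \<and> t \<in> M \<and> card \<sigma> = p \<and> int (mono_deg t) = j - int p)"
proof
  assume z: "z \<in> mono_chains M p j"
  show "\<forall>\<sigma> b t. lookup (z \<sigma> b) t \<noteq> 0 \<longrightarrow>
     b = 0 \<and> t \<in> M \<and> card \<sigma> = p \<and> int (mono_deg t) = j - int p"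
    using koszul_chainsD(1)[OF z] koszul_chainsD(4)[OF z]
    unfolding ideal_vec_monomial_span_iff by simp
next
  assume *: "\<forall>\<sigma> b t. lookup (z \<sigma> b) t \<noteq> 0 \<longrightarrow>
     b = 0 \<and> t \<in> M \<and> card \<sigma> = p \<and> int (mono_deg t) = j - int p"
  show "z \<in> mono_chains M p j"
    by (rule koszul_chainsI) (use * in \<open>simp_all add: ideal_vec_monomial_span_iff\<close>)
qed

lemma mono_cycles_eq:
  assumes "0 \<notin> M"
  shows "mono_cycles M p j = {z \<in> mono_chains M p j. koszul_diff z = 0}"
  using assms unfolding koszul_cycles_def mono_chains_iff by blast

text \<open>The cone divides coefficient monomials by the apex. A wedge that already contains the
  apex is killed by wedging with it, so no division has to be justified there.\<close>

lemma mono_cycle_is_boundary: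
  fixes M N :: "'v::finite mono set"
  assumes z: "z \<in> mono_cycles M p j"
    and U: "\<And>\<sigma> t. t \<in> M \<Longrightarrow> card \<sigma> = p \<Longrightarrow> int (mono_deg t) = j - int p \<Longrightarrow>
      lookup (t + indicator_mono \<sigma>) (U (t + indicator_mono \<sigma>)) \<noteq> 0 \<and>
      (U (t + indicator_mono \<sigma>) \<notin> \<sigma> \<longrightarrow> t - Poly_Mapping.single (U (t + indicator_mono \<sigma>)) 1 \<in> N)"
  shows "z \<in> mono_boundaries N p j"
proof (rule koszul_cycle_is_boundary[OF z])
  have ch: "b = 0 \<and> t \<in> M \<and> card \<sigma> = p \<and> int (mono_deg t) = j - int p" if "lookup (z \<sigma> b) t \<noteq> 0" for \<sigma> b t
    using z that unfolding koszul_cycles_def mono_chains_iff by blast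
  show "lookup (t + indicator_mono \<sigma>) (U (t + indicator_mono \<sigma>)) \<noteq> 0" if "lookup (z \<sigma> b) t \<noteq> 0" for \<sigma> b t
    using U ch[OF that] by blast
  show "koszul_cone U z \<sigma> \<in> ideal_vec (monomial_span N)" for \<sigma>
    unfolding ideal_vec_monomial_span_iff
  proof (intro allI impI)
    fix b t assume ne: "lookup (koszul_cone U z \<sigma> b) t \<noteq> 0"
    define u where "u = U (t + indicator_mono \<sigma>)"
    have u: "u \<in> \<sigma>" "lookup (z (\<sigma> - {u}) b) (t + Poly_Mapping.single u 1) \<noteq> 0"
      using ne unfolding lookup_koszul_cone u_def by (auto simp: Let_def split: if_splits)
    have "t + Poly_Mapping.single u 1 + indicator_mono (\<sigma> - {u}) = t + indicator_mono \<sigma>"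
      using u(1) by (intro poly_mapping_eqI) (auto simp: lookup_add lookup_indicator_mono lookup_single when_def)
    then have "t + Poly_Mapping.single u 1 - Poly_Mapping.single u 1 \<in> N"
      using U[of "t + Poly_Mapping.single u 1" "\<sigma> - {u}"] ch[OF u(2)] by (simp add: u_def)
    then show "b = 0 \<and> t \<in> N" using ch[OF u(2)] by simp
  qed
qed

lemma mono_koszul_dim_eq_0_iff:
  fixes k :: "'k::field itself" and M :: "'v::finite mono set"
  assumes "dvd_closed M"
  shows "mono_koszul_dim k M p j = 0 \<longleftrightarrow>
    (mono_cycles M p j :: ('v set \<Rightarrow> nat \<Rightarrow> ('v, 'k) mpoly) set) \<subseteq> mono_boundaries M p j"
proof -
  interpret graded_submodule 1 "\<lambda>_. 0" "ideal_vec (monomial_span M :: ('v, 'k) mpoly set)"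
    by (rule graded_submodule_monomial_span[OF assms])
  show ?thesis unfolding mono_koszul_dim_def ideal_koszul_dim_def by (rule koszul_dim_eq_0_iff)
qed

text \<open>Sorting monomials into those in \<open>M\<close> and the rest, which lie in
  \<open>N\<close>, writes a chain over \<open>M \<union> N\<close> as a sum; the dimension count
  then applies.\<close>

lemma mono_koszul_dim_Un:
  fixes k :: "'k::field itself" and M N :: "'v::finite mono set"
  assumes M: "dvd_closed M" "0 \<notin> M" and N: "dvd_closed N" "0 \<notin> N"
    and null: "\<And>p z :: 'v set \<Rightarrow> nat \<Rightarrow> ('v, 'k) mpoly. z \<in> mono_cycles (M \<inter> N) p j \<Longrightarrow>
      z \<in> mono_boundaries M p j \<and> z \<in> mono_boundaries N p j"
  shows "mono_koszul_dim k (M \<union> N) p j = mono_koszul_dim k M p j + mono_koszul_dim k N p j +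
    (case p of 0 \<Rightarrow> 0 | Suc q \<Rightarrow> mono_koszul_dim k (M \<inter> N) q j)"
proof -
  let ?K = "\<lambda>M p. mono_chains M p j :: ('v set \<Rightarrow> nat \<Rightarrow> ('v, 'k) mpoly) set"
  have dim: "mono_koszul_dim k X p j = chain.dim {z \<in> ?K X p. koszul_diff z = 0} - chain.dim (koszul_diff ` ?K X (Suc p))"
    if "0 \<notin> X" for X p
    unfolding mono_koszul_dim_def ideal_koszul_dim_def koszul_dim_def koszul_boundaries_def mono_cycles_eq[OF that] ..
  have Int: "?K M p \<inter> ?K N p = ?K (M \<inter> N) p" for p
    by (auto simp: mono_chains_iff)
  have sum: "{a + b |a b. a \<in> ?K M p \<and> b \<in> ?K N p} = ?K (M \<union> N) p" for p
  proof
    show "{a + b |a b. a \<in> ?K M p \<and> b \<in> ?K N p} \<subseteq> ?K (M \<union> N) p"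
    proof clarify
      fix a b assume ab: "a \<in> ?K M p" "b \<in> ?K N p"
      show "a + b \<in> ?K (M \<union> N) p"
        unfolding mono_chains_iff
      proof (intro allI impI)
        fix \<sigma> c t assume "lookup ((a + b) \<sigma> c) t \<noteq> 0"
        then have "lookup (a \<sigma> c) t \<noteq> 0 \<or> lookup (b \<sigma> c) t \<noteq> 0" by (auto simp: lookup_add)
        then show "c = 0 \<and> t \<in> M \<union> N \<and> card \<sigma> = p \<and> int (mono_deg t) = j - int p"
          using ab unfolding mono_chains_iff by blast
      qed
    qed
    show "?K (M \<union> N) p \<subseteq> {a + b |a b. a \<in> ?K M p \<and> b \<in> ?K N p}"
    proof
      fix z assume z: "z \<in> ?K (M \<union> N) p"
      define a where "a = (\<lambda>\<sigma> c. restrict_poly M (z \<sigma> c))"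
      have "a \<in> ?K M p" "z - a \<in> ?K N p"
        using z by (auto simp: mono_chains_iff a_def lookup_restrict_poly lookup_minus split: if_splits)
      moreover have "z = a + (z - a)" by simp
      ultimately show "z \<in> {a + b |a b. a \<in> ?K M p \<and> b \<in> ?K N p}" by blast
    qed
  qed
  interpret M: graded_submodule 1 "\<lambda>_. 0" "ideal_vec (monomial_span M :: ('v, 'k) mpoly set)"
    by (rule graded_submodule_monomial_span[OF M(1)])
  interpret N: graded_submodule 1 "\<lambda>_. 0" "ideal_vec (monomial_span N :: ('v, 'k) mpoly set)"
    by (rule graded_submodule_monomial_span[OF N(1)])
  have d0: "koszul_diff z = 0" if "z \<in> ?K X 0" for z X
    using koszul_chainsD(2)[OF that] by (simp add: koszul_diff_def fun_eq_iff card_eq_0_iff)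
  have "0 \<notin> M \<inter> N" "0 \<notin> M \<union> N" using M(2) N(2) by auto
  have null': "x \<in> koszul_diff ` ?K M (Suc p) \<and> x \<in> koszul_diff ` ?K N (Suc p)"
    if "x \<in> ?K M p" "x \<in> ?K N p" "koszul_diff x = 0" for p x
  proof -
    have "x \<in> ?K (M \<inter> N) p" using that(1,2) Int by blast
    then have "x \<in> mono_cycles (M \<inter> N) p j" using that(3) mono_cycles_eq[OF \<open>0 \<notin> M \<inter> N\<close>] by blast
    then show ?thesis using null unfolding koszul_boundaries_def by blast
  qed
  show ?thesis
    unfolding dim[OF M(2)] dim[OF N(2)] dim[OF \<open>0 \<notin> M \<inter> N\<close>] dim[OF \<open>0 \<notin> M \<union> N\<close>] Int[symmetric] sum[symmetric]
  proof (rule chain.Mayer_Vietoris_dims[where d = koszul_diff and A = "?K M" and B = "?K N", OF linear_koszul_diff])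
    show "chain.fin_subspace (?K M p)" "chain.fin_subspace (?K N p)" for p
      by (rule M.fin_subspace_koszul_chains, rule N.fin_subspace_koszul_chains)
    show "koszul_diff ` ?K M (Suc p) \<subseteq> ?K M p" "koszul_diff ` ?K N (Suc p) \<subseteq> ?K N p" for p
      using M.koszul_diff_chains N.koszul_diff_chains by blast+
  qed (use d0 null' in auto)
qed

text \<open>Multiplication by \<open>m\<close> is an isomorphism of Koszul complexes that raises the
  degree by that of \<open>m\<close>.\<close>

lemma mono_koszul_dim_translate:
  fixes k :: "'k::field itself" and M :: "'v::finite mono set"
  assumes M: "dvd_closed M" "0 \<notin> M"
  shows "mono_koszul_dim k ((+) m ` M) p j = mono_koszul_dim k M p (j - int (mono_deg m))"
proof -
  define d where "d = int (mono_deg m)"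
  define f :: "('v set \<Rightarrow> nat \<Rightarrow> ('v, 'k) mpoly) \<Rightarrow> 'v set \<Rightarrow> nat \<Rightarrow> ('v, 'k) mpoly" where
    "f z = (\<lambda>\<sigma> b. Poly_Mapping.single m 1 * z \<sigma> b)" for z
  interpret M: graded_submodule 1 "\<lambda>_. 0" "ideal_vec (monomial_span M :: ('v, 'k) mpoly set)"
    by (rule graded_submodule_monomial_span[OF M(1)])
  have lin: "Vector_Spaces.linear chain_scale chain_scale f"
    unfolding Vector_Spaces.linear_iff
    by (auto simp: vector_space_chain_scale f_def chain_scale_def fun_eq_iff distrib_left ac_simps)
  have f_diff: "koszul_diff (f z) = f (koszul_diff z)" for z
    by (simp add: f_def koszul_diff_def fun_eq_iff sum_distrib_left ac_simps)
  have lookup_f: "lookup (f z \<sigma> b) (m + t) = lookup (z \<sigma> b) t" for z \<sigma> b t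
    by (simp add: f_def lookup_single_mult_add)
  have lookup_f_ne: "\<exists>t'. t = m + t' \<and> lookup (z \<sigma> b) t' \<noteq> 0" if ne: "lookup (f z \<sigma> b) t \<noteq> 0" for z \<sigma> b t
  proof -
    have "mono_dvd m t"
      using ne lookup_single_mult_not_dvd unfolding f_def by blast
    then show ?thesis using ne lookup_f unfolding mono_dvd_def by metis
  qed
  have inj: "z = z'" if "f z = f z'" for z z'
    by (intro ext poly_mapping_eqI) (metis lookup_f that)
  have im: "f ` mono_chains M p (j - d) = mono_chains ((+) m ` M) p j" for p
  proof
    show "f ` mono_chains M p (j - d) \<subseteq> mono_chains ((+) m ` M) p j"
    proof clarify
      fix z :: "'v set \<Rightarrow> nat \<Rightarrow> ('v, 'k) mpoly" assume z: "z \<in> mono_chains M p (j - d)"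
      show "f z \<in> mono_chains ((+) m ` M) p j"
        unfolding mono_chains_iff
      proof (intro allI impI)
        fix \<sigma> b t assume "lookup (f z \<sigma> b) t \<noteq> 0"
        then obtain t' where "t = m + t'" "lookup (z \<sigma> b) t' \<noteq> 0" using lookup_f_ne by blast
        then show "b = 0 \<and> t \<in> (+) m ` M \<and> card \<sigma> = p \<and> int (mono_deg t) = j - int p"
          using z unfolding mono_chains_iff by (auto simp: mono_deg_add d_def)
      qed
    qed
    show "mono_chains ((+) m ` M) p j \<subseteq> f ` mono_chains M p (j - d)"
    proof
      fix y :: "'v set \<Rightarrow> nat \<Rightarrow> ('v, 'k) mpoly" assume y: "y \<in> mono_chains ((+) m ` M) p j"
      define z where "z \<sigma> b = Abs_poly_mapping (\<lambda>t. lookup (y \<sigma> b) (m + t))" for \<sigma> b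
      have lookup_z: "lookup (z \<sigma> b) t = lookup (y \<sigma> b) (m + t)" for \<sigma> b t
      proof -
        have "{t. lookup (y \<sigma> b) (m + t) \<noteq> 0} = (+) m -` keys (y \<sigma> b)" by (auto simp: in_keys_iff)
        then have "finite {t. lookup (y \<sigma> b) (m + t) \<noteq> 0}" by (simp add: finite_vimageI)
        then show ?thesis by (simp add: z_def)
      qed
      have "z \<in> mono_chains M p (j - d)"
        unfolding mono_chains_iff
      proof (intro allI impI)
        fix \<sigma> b t assume "lookup (z \<sigma> b) t \<noteq> 0"
        then have "lookup (y \<sigma> b) (m + t) \<noteq> 0" by (simp add: lookup_z)
        then show "b = 0 \<and> t \<in> M \<and> card \<sigma> = p \<and> int (mono_deg t) = j - d - int p"
          using y[unfolded mono_chains_iff, rule_format, of \<sigma> b "m + t"] by (auto simp: mono_deg_add d_def)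
      qed
      moreover have "y = f z"
      proof (intro ext poly_mapping_eqI)
        fix \<sigma> b t
        show "lookup (y \<sigma> b) t = lookup (f z \<sigma> b) t"
        proof (cases "mono_dvd m t")
          case True
          then show ?thesis by (auto simp: mono_dvd_def lookup_f lookup_z)
        next
          case False
          then have "lookup (y \<sigma> b) t = 0" using y unfolding mono_chains_iff mono_dvd_def by blast
          then show ?thesis using False by (simp add: f_def lookup_single_mult_not_dvd)
        qed
      qed
      ultimately show "y \<in> f ` mono_chains M p (j - d)" by (intro image_eqI)
    qed
  qed
  have zero: "0 \<notin> (+) m ` M"
  proof
    assume "0 \<in> (+) m ` M"
    then obtain t where "t \<in> M" "0 = m + t" by blast
    then show False using M(2) by (metis mono_deg_add mono_deg_eq_0_iff add_is_0 mono_deg_zero)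
  qed
  have f_diff_0: "koszul_diff (f z) = 0 \<longleftrightarrow> koszul_diff z = 0" for z
    unfolding f_diff using inj[of "koszul_diff z" 0] chain.linear_0[OF lin] by auto
  have cyc: "mono_cycles ((+) m ` M) p j = f ` mono_cycles M p (j - d)"
    unfolding mono_cycles_eq[OF M(2)] mono_cycles_eq[OF zero] im[symmetric]
    using f_diff_0 by blast
  have bnd: "mono_boundaries ((+) m ` M) p j = f ` mono_boundaries M p (j - d)"
    unfolding koszul_boundaries_def im[symmetric] by (auto simp: image_image f_diff)
  have inj_on: "inj_on f X" for X by (auto intro: inj_onI inj)
  show ?thesis
    unfolding mono_koszul_dim_def ideal_koszul_dim_def koszul_dim_def cyc bnd d_def[symmetric]
    using chain.dim_image_of_inj[OF lin M.fin_subspace_koszul_cycles inj_on]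
      chain.dim_image_of_inj[OF lin chain.fin_subspace_subset[OF M.fin_subspace_koszul_cycles
          M.subspace_koszul_boundaries M.koszul_boundaries_subset_cycles] inj_on]
    by simp
qed

text \<open>A cone whose apex is a variable that exceeds \<open>m\<close> in the multidegree.\<close>

lemma multiples_cycle_is_boundary:
  fixes M :: "'v::finite mono set"
  assumes z: "z \<in> mono_cycles M p j" and M: "M \<subseteq> multiples {m}"
    and ne: "\<And>\<sigma> t. t \<in> M \<Longrightarrow> card \<sigma> = p \<Longrightarrow> int (mono_deg t) = j - int p \<Longrightarrow> t + indicator_mono \<sigma> \<noteq> m"
  shows "z \<in> mono_boundaries (multiples {m}) p j"
proof (rule mono_cycle_is_boundary[OF z, where U = "\<lambda>a. SOME u. lookup m u < lookup a u"])
  fix \<sigma> :: "'v set" and t :: "'v mono" assume t: "t \<in> M" "card \<sigma> = p" "int (mono_deg t) = j - int p"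
  let ?a = "t + indicator_mono \<sigma>"
  define u where "u = (SOME u. lookup m u < lookup ?a u)"
  have dvd: "mono_dvd m t" using t(1) M by (auto simp: multiples_def)
  have "\<exists>u. lookup m u < lookup ?a u"
  proof (rule ccontr)
    assume "\<nexists>u. lookup m u < lookup ?a u"
    then have "?a = m"
      using dvd by (intro poly_mapping_eqI) (auto simp: mono_dvd_iff lookup_add not_less intro!: antisym trans_le_add1)
    then show False using ne[OF t] by simp
  qed
  then have u: "lookup m u < lookup ?a u" unfolding u_def by (rule someI_ex)
  have "t - Poly_Mapping.single u 1 \<in> multiples {m}" if "u \<notin> \<sigma>"
    using mono_dvd_minus_single[OF dvd, of u] u that by (simp add: multiples_def lookup_add lookup_indicator_mono)
  then show "lookup ?a (SOME u. lookup m u < lookup ?a u) \<noteq> 0 \<and>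
      ((SOME u. lookup m u < lookup ?a u) \<notin> \<sigma> \<longrightarrow>
        t - Poly_Mapping.single (SOME u. lookup m u < lookup ?a u) 1 \<in> multiples {m})"
    using u unfolding u_def[symmetric] by auto
qed

text \<open>A principal ideal is free of rank 1. In every multidegree other than \<open>m\<close> a
  cone exists; in multidegree \<open>m\<close> the only chains are the scalar multiples of the
  generator, and nothing bounds them.\<close>

lemma mono_koszul_dim_principal:
  fixes k :: "'k::field itself" and m :: "'v::finite mono"
  assumes m: "m \<noteq> 0"
  shows "mono_koszul_dim k (multiples {m}) p j = (if p = 0 \<and> j = int (mono_deg m) then 1 else 0)"
proof (cases "p = 0 \<and> j = int (mono_deg m)")
  case False
  have "t + indicator_mono \<sigma> \<noteq> m"
    if "t \<in> multiples {m}" "card \<sigma> = p" "int (mono_deg t) = j - int p" for \<sigma> t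
  proof
    assume eq: "t + indicator_mono \<sigma> = m"
    have "mono_deg m = mono_deg t + p" using that(2) by (simp add: mono_deg_add mono_deg_indicator_mono flip: eq)
    moreover have "mono_deg m \<le> mono_deg t"
      using that(1) unfolding multiples_def mono_dvd_def by (auto simp: mono_deg_add)
    ultimately show False using False that(3) by auto
  qed
  then have "z \<in> mono_boundaries (multiples {m}) p j" if "z \<in> mono_cycles (multiples {m}) p j" for z :: "'v set \<Rightarrow> nat \<Rightarrow> ('v, 'k) mpoly"
    by (rule multiples_cycle_is_boundary[OF that order_refl])
  then show ?thesis
    unfolding mono_koszul_dim_eq_0_iff[OF dvd_closed_multiples] if_not_P[OF False] by blast
next
  case True
  define e :: "'v set \<Rightarrow> nat \<Rightarrow> ('v, 'k) mpoly" where
    "e = (\<lambda>\<sigma> b. if \<sigma> = {} \<and> b = 0 then Poly_Mapping.single m 1 else 0)"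
  have 0: "0 \<notin> multiples {m}" using m by (simp add: zero_in_multiples_iff)
  have eqm: "t = m" if "t \<in> multiples {m}" "mono_deg t = mono_deg m" for t
    using that unfolding multiples_def mono_dvd_def by (auto simp: mono_deg_add mono_deg_eq_0_iff)
  have "mono_cycles (multiples {m}) p j = chain.span {e}"
  proof
    show "mono_cycles (multiples {m}) p j \<subseteq> chain.span {e}"
    proof
      fix z :: "'v set \<Rightarrow> nat \<Rightarrow> ('v, 'k) mpoly" assume "z \<in> mono_cycles (multiples {m}) p j"
      then have z: "\<And>\<sigma> b t. lookup (z \<sigma> b) t \<noteq> 0 \<Longrightarrow> b = 0 \<and> t = m \<and> \<sigma> = {}"
        using True eqm unfolding mono_cycles_eq[OF 0] mono_chains_iff by (auto simp: card_eq_0_iff)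
      have "z = chain_scale (lookup (z {} 0) m) e"
      proof (intro ext poly_mapping_eqI)
        fix \<sigma> b t
        show "lookup (z \<sigma> b) t = lookup (chain_scale (lookup (z {} 0) m) e \<sigma> b) t"
          using z[of \<sigma> b t] by (auto simp: chain_scale_def e_def lookup_single when_def)
      qed
      then show "z \<in> chain.span {e}" by (metis chain.span_base chain.span_scale singletonI)
    qed
    interpret graded_submodule 1 "\<lambda>_. 0" "ideal_vec (monomial_span (multiples {m}) :: ('v, 'k) mpoly set)"
      by (rule graded_submodule_monomial_span[OF dvd_closed_multiples])
    have "e \<in> mono_chains (multiples {m}) p j"
      using True subset_multiples[of "{m}"] by (auto simp: mono_chains_iff e_def lookup_single when_def split: if_splits)
    moreover have "koszul_diff e = 0"
      by (simp add: koszul_diff_def e_def fun_eq_iff)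
    ultimately have "{e} \<subseteq> mono_cycles (multiples {m}) p j" unfolding mono_cycles_eq[OF 0] by simp
    then show "chain.span {e} \<subseteq> mono_cycles (multiples {m}) p j"
      by (rule chain.span_minimal[OF _ subspace_koszul_cycles])
  qed
  moreover have "e \<noteq> 0"
  proof
    assume "e = 0"
    then have "lookup (e {} 0) m = 0" by simp
    then show False by (simp add: e_def)
  qed
  ultimately have "chain.dim (mono_cycles (multiples {m}) p j :: ('v set \<Rightarrow> nat \<Rightarrow> ('v, 'k) mpoly) set) = 1"
    using chain.dim_span_eq_card_independent[of "{e}"] by simp
  moreover have "mono_boundaries (multiples {m}) p j = ({0} :: ('v set \<Rightarrow> nat \<Rightarrow> ('v, 'k) mpoly) set)"
  proof -
    have "z = 0" if "z \<in> mono_chains (multiples {m}) (Suc p) j" for z :: "'v set \<Rightarrow> nat \<Rightarrow> ('v, 'k) mpoly"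
    proof (intro ext poly_mapping_eqI)
      fix \<sigma> b t
      have "mono_deg m \<le> mono_deg t" if "t \<in> multiples {m}"
        using that unfolding multiples_def mono_dvd_def by (auto simp: mono_deg_add)
      then show "lookup (z \<sigma> b) t = lookup ((0 :: 'v set \<Rightarrow> nat \<Rightarrow> ('v, 'k) mpoly) \<sigma> b) t"
        using that True unfolding mono_chains_iff by fastforce
    qed
    moreover have "0 \<in> (mono_chains (multiples {m}) (Suc p) j :: ('v set \<Rightarrow> nat \<Rightarrow> ('v, 'k) mpoly) set)"
      by (simp add: mono_chains_iff)
    ultimately have "mono_chains (multiples {m}) (Suc p) j = ({0} :: ('v set \<Rightarrow> nat \<Rightarrow> ('v, 'k) mpoly) set)" by blast
    then show ?thesis by (simp add: koszul_boundaries_def)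
  qed
  moreover have "chain.dim ({0} :: ('v set \<Rightarrow> nat \<Rightarrow> ('v, 'k) mpoly) set) = 0"
    using chain.dim_le_card[of "{0}" "{}"] by simp
  ultimately show ?thesis
    using True by (simp add: mono_koszul_dim_def ideal_koszul_dim_def koszul_dim_def)
qed

section \<open>Squarefree ideals: vanishing in large degrees\<close>

definition squarefree_monos :: "'v mono set \<Rightarrow> bool" where
  "squarefree_monos A \<longleftrightarrow> 0 \<notin> A \<and> (\<forall>s\<in>A. \<forall>x. lookup s x \<le> 1)"

text \<open>In degrees larger than the number of variables, some variable has exponent at least \<open>2\<close> in
  the multidegree and serves as the apex of a cone.\<close>

lemma squarefree_mono_koszul_dim_finite:
  fixes k :: "'k::field itself" and A :: "'v::finite mono set"
  assumes A: "squarefree_monos A"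
  shows "finite {j. mono_koszul_dim k (multiples A) p j \<noteq> 0}"
proof (rule finite_subset)
  show "{j. mono_koszul_dim k (multiples A) p j \<noteq> 0} \<subseteq> {0..int (card (UNIV :: 'v set))}"
  proof
    fix j assume "j \<in> {j. mono_koszul_dim k (multiples A) p j \<noteq> 0}"
    then have ne: "mono_koszul_dim k (multiples A) p j \<noteq> 0" by simp
    have False if j: "j \<notin> {0..int (card (UNIV :: 'v set))}"
    proof -
      have "z \<in> mono_boundaries (multiples A) p j" if z: "z \<in> mono_cycles (multiples A) p j"
        for z :: "'v set \<Rightarrow> nat \<Rightarrow> ('v, 'k) mpoly"
      proof (rule mono_cycle_is_boundary[OF z, where U = "\<lambda>a. SOME u. 1 < lookup a u"])
        fix \<sigma> :: "'v set" and t :: "'v mono"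
        assume t: "t \<in> multiples A" "card \<sigma> = p" "int (mono_deg t) = j - int p"
        let ?a = "t + indicator_mono \<sigma>"
        define u where "u = (SOME u. 1 < lookup ?a u)"
        have deg: "int (mono_deg ?a) = j" using t by (simp add: mono_deg_add mono_deg_indicator_mono)
        have "\<exists>u. 1 < lookup ?a u"
        proof (rule ccontr)
          assume "\<nexists>u. 1 < lookup ?a u"
          then have "mono_deg ?a \<le> (\<Sum>u\<in>(UNIV :: 'v set). 1)"
            unfolding mono_deg_eq_sum_UNIV by (intro sum_mono) (simp add: not_less)
          then show False using deg j by auto
        qed
        then have u: "1 < lookup ?a u" unfolding u_def by (rule someI_ex)
        obtain s where s: "s \<in> A" "mono_dvd s t" using t(1) unfolding multiples_def by blast
        have "t - Poly_Mapping.single u 1 \<in> multiples A" if "u \<notin> \<sigma>"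
        proof -
          \<comment> \<open>Off \<open>\<sigma>\<close> the exponent above 1 belongs to
            \<open>t\<close> itself, while the squarefree \<open>s\<close> has exponent at most
            1.\<close>
          have "lookup s u < lookup t u"
            using u that s(1) A unfolding squarefree_monos_def
            by (auto simp: lookup_add lookup_indicator_mono intro: le_less_trans)
          then show ?thesis using mono_dvd_minus_single[OF s(2)] s(1) unfolding multiples_def by blast
        qed
        then show "lookup ?a (SOME u. 1 < lookup ?a u) \<noteq> 0 \<and> ((SOME u. 1 < lookup ?a u) \<notin> \<sigma> \<longrightarrow>
            t - Poly_Mapping.single (SOME u. 1 < lookup ?a u) 1 \<in> multiples A)"
          using u unfolding u_def[symmetric] by auto
      qed
      then have "mono_koszul_dim k (multiples A) p j = 0"
        unfolding mono_koszul_dim_eq_0_iff[OF dvd_closed_multiples] by blast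
      then show False using ne by simp
    qed
    then show "j \<in> {0..int (card (UNIV :: 'v set))}" by blast
  qed
qed simp

lemma betti_squarefree:
  fixes k :: "'k::field itself" and A :: "'v::finite mono set"
  assumes A: "squarefree_monos A"
  shows "betti (monomial_span (multiples A) :: ('v, 'k) mpoly set) i j = mono_koszul_dim k (multiples A) i j"
  unfolding mono_koszul_dim_def
proof (rule betti_eq_ideal_koszul_dim)
  show "graded_submodule 1 (\<lambda>_. 0) (ideal_vec (monomial_span (multiples A) :: ('v, 'k) mpoly set))"
    by (rule graded_submodule_monomial_span[OF dvd_closed_multiples])
  show "finite {j. ideal_koszul_dim (monomial_span (multiples A) :: ('v, 'k) mpoly set) p j \<noteq> 0}" for p
    using squarefree_mono_koszul_dim_finite[OF A, of k p] by (simp add: mono_koszul_dim_def)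
  have "0 \<notin> multiples A" using A by (simp add: squarefree_monos_def zero_in_multiples_iff)
  then show "lookup p 0 = 0" if "p \<in> monomial_span (multiples A)" for p :: "('v, 'k) mpoly"
    using that by (auto simp: monomial_span_def in_keys_iff subset_iff)
qed



text \<open>A cone needs one apex per multidegree, so \<open>u\<close> has to serve every pair
  \<open>t'\<close>, \<open>\<sigma>'\<close> with the same sum; it can then be chosen as a function
  of that sum.\<close>

lemma mono_cycle_is_boundary_ex:
  fixes M N :: "'v::finite mono set"
  assumes z: "z \<in> mono_cycles M p j"
    and ex: "\<And>\<sigma> t. t \<in> M \<Longrightarrow> \<exists>u. lookup (t + indicator_mono \<sigma>) u \<noteq> 0 \<and>
      (\<forall>t'\<in>M. \<forall>\<sigma>'. t' + indicator_mono \<sigma>' = t + indicator_mono \<sigma> \<longrightarrow> u \<notin> \<sigma>' \<longrightarrow>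
        t' - Poly_Mapping.single u 1 \<in> N)"
  shows "z \<in> mono_boundaries N p j"
proof -
  let ?Q = "\<lambda>a u. lookup a u \<noteq> 0 \<and>
      (\<forall>t'\<in>M. \<forall>\<sigma>'. t' + indicator_mono \<sigma>' = a \<longrightarrow> u \<notin> \<sigma>' \<longrightarrow> t' - Poly_Mapping.single u 1 \<in> N)"
  have Q: "?Q (t + indicator_mono \<sigma>) (SOME u. ?Q (t + indicator_mono \<sigma>) u)" if "t \<in> M" for t \<sigma>
    using ex[OF that] by (rule someI_ex)
  show ?thesis
    by (rule mono_cycle_is_boundary[OF z, where U = "\<lambda>a. SOME u. ?Q a u"]) (use Q in blast)
qed


section \<open>Splittings\<close>

lemma lookup_mono_lcm: "lookup (mono_lcm S) x = Max ((\<lambda>t. lookup t x) ` S)"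
  by (simp add: mono_lcm_def)

lemma min_gens_monomial_span:
  "min_gens (monomial_span M :: ('v, 'k::field) mpoly set) = {t \<in> M. \<forall>s\<in>M. mono_dvd s t \<longrightarrow> s = t}"
  by (auto simp: min_gens_def)

lemma exists_minimal_divisor:
  fixes t :: "'v::finite mono"
  assumes "t \<in> M"
  shows "\<exists>w. w \<in> min_gens (monomial_span M :: ('v, 'k::field) mpoly set) \<and> mono_dvd w t"
  using assms
proof (induction "mono_deg t" arbitrary: t rule: less_induct)
  case less
  show ?case
  proof (cases "t \<in> min_gens (monomial_span M :: ('v, 'k) mpoly set)")
    case True
    then show ?thesis using mono_dvd_refl by blast
  next
    case False
    then obtain s where s: "s \<in> M" "mono_dvd s t" "s \<noteq> t"
      using less.prems unfolding min_gens_monomial_span by blast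
    then obtain u where "t = s + u" "u \<noteq> 0" unfolding mono_dvd_def by auto
    then have "mono_deg s < mono_deg t"
      using mono_deg_eq_0_iff[of u] by (simp add: mono_deg_add)
    then show ?thesis using less.hyps[of s] s mono_dvd_trans by blast
  qed
qed

lemma finite_divisors: "finite {s :: 'v::finite mono. mono_dvd s t}"
proof -
  have "{s. mono_dvd s t} \<subseteq> (\<Union>d\<in>{..mono_deg t}. {s. mono_deg s = d})"
    by (auto simp: mono_dvd_def mono_deg_add)
  then show ?thesis by (rule finite_subset) (simp add: finite_mono_deg_eq)
qed

text \<open>The least common multiples of the generators dividing \<open>a\<close> and of their images under the
  splitting function differ in some variable; this variable is the apex of a cone in multidegree \<open>a\<close>.\<close>

lemma splitting_function_null:
  fixes P N :: "'v::finite mono set" and \<psi> :: "'v mono \<Rightarrow> 'v mono"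
  defines "G \<equiv> min_gens (monomial_span P :: ('v, 'k::field) mpoly set)"
  assumes N: "dvd_closed N"
    and \<psi>: "\<And>w. w \<in> G \<Longrightarrow> \<psi> w \<in> N \<and> mono_dvd (\<psi> w) w"
    and lcm: "\<And>S. S \<subseteq> G \<Longrightarrow> S \<noteq> {} \<Longrightarrow>
      mono_dvd (mono_lcm (\<psi> ` S)) (mono_lcm S) \<and> mono_lcm (\<psi> ` S) \<noteq> mono_lcm S"
    and z: "(z :: 'v set \<Rightarrow> nat \<Rightarrow> ('v, 'k) mpoly) \<in> mono_cycles P p j"
  shows "z \<in> mono_boundaries N p j"
proof (rule mono_cycle_is_boundary_ex[OF z])
  fix \<sigma> and t :: "'v mono"
  assume t: "t \<in> P"
  define a where "a = t + indicator_mono \<sigma>"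
  \<comment> \<open>Every monomial of \<open>P\<close> occurring in multidegree \<open>a\<close> is
    a multiple of some \<open>w\<close> in \<open>S\<close>, so strictness for this one set controls
    the whole multidegree.\<close>
  define S where "S = {w \<in> G. mono_dvd w a}"
  have minS: "\<exists>w\<in>S. mono_dvd w t'" if t': "t' \<in> P" "t' + indicator_mono \<sigma>' = a" for t' \<sigma>'
  proof -
    obtain w where w: "w \<in> G" "mono_dvd w t'"
      using exists_minimal_divisor[OF t'(1)] unfolding G_def by blast
    have "mono_dvd t' a" using t'(2) unfolding mono_dvd_def by metis
    then show ?thesis using w mono_dvd_trans unfolding S_def by blast
  qed
  have fin: "finite S" unfolding S_def by (rule finite_subset[OF _ finite_divisors[of a]]) auto
  have ne: "S \<noteq> {}" using minS[OF t] a_def by blast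
  have L: "mono_dvd (mono_lcm (\<psi> ` S)) (mono_lcm S)" "mono_lcm (\<psi> ` S) \<noteq> mono_lcm S"
    using lcm[OF _ ne] by (auto simp: S_def)
  have "\<exists>x. lookup (mono_lcm (\<psi> ` S)) x \<noteq> lookup (mono_lcm S) x"
    using L(2) by (auto simp: poly_mapping_eq_iff fun_eq_iff)
  then obtain x where x: "lookup (mono_lcm (\<psi> ` S)) x < lookup (mono_lcm S) x"
    using L(1) unfolding mono_dvd_iff by (metis le_neq_implies_less)
  have "lookup (mono_lcm S) x \<le> lookup a x"
    unfolding lookup_mono_lcm using fin ne by (subst Max_le_iff) (auto simp: S_def mono_dvd_iff)
  then have xa: "lookup (mono_lcm (\<psi> ` S)) x < lookup a x" using x by simp
  have "t' - Poly_Mapping.single x 1 \<in> N"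
    if t': "t' \<in> P" "t' + indicator_mono \<sigma>' = a" "x \<notin> \<sigma>'" for t' \<sigma>'
  proof -
    obtain w where w: "w \<in> S" "mono_dvd w t'" using minS[OF t'(1,2)] by blast
    \<comment> \<open>Strictness puts the exponent of \<open>\<psi> w\<close> at \<open>x\<close>
      below that of \<open>a\<close>, which \<open>t'\<close> attains because \<open>x\<close> is
      not in \<open>\<sigma>'\<close>.\<close>
    have "lookup (\<psi> w) x \<le> lookup (mono_lcm (\<psi> ` S)) x"
      unfolding lookup_mono_lcm using fin w(1) by (intro Max_ge) auto
    also have "\<dots> < lookup t' x"
      using xa t'(3) by (simp add: lookup_add lookup_indicator_mono flip: t'(2))
    finally have "mono_dvd (\<psi> w) (t' - Poly_Mapping.single x 1)"
      using \<psi>[of w] w mono_dvd_trans unfolding S_def by (intro mono_dvd_minus_single) blast+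
    then show ?thesis using \<psi>[of w] w(1) N unfolding S_def dvd_closed_def by blast
  qed
  then show "\<exists>u. lookup (t + indicator_mono \<sigma>) u \<noteq> 0 \<and>
      (\<forall>t'\<in>P. \<forall>\<sigma>'. t' + indicator_mono \<sigma>' = t + indicator_mono \<sigma> \<longrightarrow> u \<notin> \<sigma>' \<longrightarrow>
        t' - Poly_Mapping.single u 1 \<in> N)"
    using xa unfolding a_def by (intro exI[of _ x]) auto
qed

text \<open>The formula of Eliahou and Kervaire for the Betti numbers of a splitting.\<close>

theorem splitting_mono_koszul_dim:
  fixes k :: "'k::field itself" and M N :: "'v::finite mono set"
  assumes split: "splitting I (monomial_span M) (monomial_span N :: ('v, 'k) mpoly set)"
    and M: "dvd_closed M" "0 \<notin> M" and N: "dvd_closed N" "0 \<notin> N"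
  shows "mono_koszul_dim k (M \<union> N) p j = mono_koszul_dim k M p j + mono_koszul_dim k N p j +
    (case p of 0 \<Rightarrow> 0 | Suc q \<Rightarrow> mono_koszul_dim k (M \<inter> N) q j)"
proof -
  let ?G = "\<lambda>X. min_gens (monomial_span X :: ('v, 'k) mpoly set)"
  let ?split = "\<lambda>\<phi> \<psi>. (\<forall>w\<in>?G (M \<inter> N). \<phi> w \<in> ?G M \<and> \<psi> w \<in> ?G N \<and> w = mono_lcm {\<phi> w, \<psi> w}) \<and>
    (\<forall>S. S \<subseteq> ?G (M \<inter> N) \<longrightarrow> S \<noteq> {} \<longrightarrow>
      mono_dvd (mono_lcm (\<phi> ` S)) (mono_lcm S) \<and> mono_lcm (\<phi> ` S) \<noteq> mono_lcm S \<and>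
      mono_dvd (mono_lcm (\<psi> ` S)) (mono_lcm S) \<and> mono_lcm (\<psi> ` S) \<noteq> mono_lcm S)"
  have "\<exists>\<phi> \<psi>. ?split \<phi> \<psi>"
    using split unfolding splitting_def monomial_span_Int by (elim conjE)
  then obtain \<phi> \<psi> where \<phi>\<psi>: "?split \<phi> \<psi>" by (elim exE)
  have w: "\<phi> w \<in> ?G M \<and> \<psi> w \<in> ?G N \<and> w = mono_lcm {\<phi> w, \<psi> w}" if "w \<in> ?G (M \<inter> N)" for w
    using \<phi>\<psi> that by (elim conjE) (rule bspec)
  have S: "mono_dvd (mono_lcm (\<phi> ` S)) (mono_lcm S) \<and> mono_lcm (\<phi> ` S) \<noteq> mono_lcm S \<and>
      mono_dvd (mono_lcm (\<psi> ` S)) (mono_lcm S) \<and> mono_lcm (\<psi> ` S) \<noteq> mono_lcm S"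
    if "S \<subseteq> ?G (M \<inter> N)" "S \<noteq> {}" for S
    using \<phi>\<psi>[THEN conjunct2, rule_format, OF that] .
  \<comment> \<open>Property (a) of the splitting function enters as divisibility of
    \<open>w\<close> by its two values.\<close>
  have dvd: "mono_dvd a (mono_lcm {a, b})" "mono_dvd b (mono_lcm {a, b})" for a b :: "'v mono"
    by (simp_all add: mono_dvd_iff lookup_mono_lcm)
  have \<phi>: "\<phi> w \<in> M \<and> mono_dvd (\<phi> w) w" if "w \<in> ?G (M \<inter> N)" for w
    using w[OF that] dvd(1)[of "\<phi> w" "\<psi> w"] by (simp add: min_gens_monomial_span)
  have \<psi>: "\<psi> w \<in> N \<and> mono_dvd (\<psi> w) w" if "w \<in> ?G (M \<inter> N)" for w
    using w[OF that] dvd(2)[of "\<psi> w" "\<phi> w"] by (simp add: min_gens_monomial_span)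
  show ?thesis
  proof (rule mono_koszul_dim_Un[OF M N])
    fix p and z :: "'v set \<Rightarrow> nat \<Rightarrow> ('v, 'k) mpoly"
    assume z: "z \<in> mono_cycles (M \<inter> N) p j"
    have "z \<in> mono_boundaries M p j"
      by (rule splitting_function_null[OF M(1) \<phi> _ z]) (use S in blast)+
    moreover have "z \<in> mono_boundaries N p j"
      by (rule splitting_function_null[OF N(1) \<psi> _ z]) (use S in blast)+
    ultimately show "z \<in> mono_boundaries M p j \<and> z \<in> mono_boundaries N p j" ..
  qed
qed


section \<open>Squarefree monomial ideals\<close>

lemma indicator_mono_dvd_iff: "mono_dvd (indicator_mono e) t \<longleftrightarrow> e \<subseteq> keys t"
  by (auto simp: mono_dvd_iff lookup_indicator_mono in_keys_iff Suc_le_eq One_nat_def)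

text \<open>A squarefree monomial ideal is represented by the set of supports of its generators.\<close>

abbreviation set_multiples :: "'v::finite set set \<Rightarrow> 'v mono set" where
  "set_multiples E \<equiv> multiples (indicator_mono ` E)"

lemma set_multiples_iff: "t \<in> set_multiples E \<longleftrightarrow> (\<exists>e\<in>E. e \<subseteq> keys t)"
  by (auto simp: multiples_def indicator_mono_dvd_iff)

lemma indicator_mono_eq_0_iff: "indicator_mono e = 0 \<longleftrightarrow> e = {}"
  by (auto simp: poly_mapping_eq_iff fun_eq_iff lookup_indicator_mono)

lemma squarefree_indicator_monos: "{} \<notin> E \<Longrightarrow> squarefree_monos (indicator_mono ` E)"
  by (auto simp: squarefree_monos_def lookup_indicator_mono indicator_mono_eq_0_iff
      dest!: sym[of "0 :: _ mono"])

lemma zero_notin_set_multiples: "{} \<notin> E \<Longrightarrow> 0 \<notin> set_multiples E"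
  by (simp add: set_multiples_iff)

lemma keys_minus_single: "keys t - {u} \<subseteq> keys (t - Poly_Mapping.single u 1 :: 'v mono)"
  by (auto simp: in_keys_iff lookup_minus lookup_single when_def split: if_splits)

lemma keys_minus_single_ge_2:
  "2 \<le> lookup t u \<Longrightarrow> keys t \<subseteq> keys (t - Poly_Mapping.single u 1 :: 'v mono)"
  by (auto simp: in_keys_iff lookup_minus lookup_single when_def)

text \<open>Supports disjoint from \<open>m\<close> are not affected by dividing out
  \<open>indicator_mono m\<close>; hence intersecting with the principal ideal amounts to
  multiplying by its generator.\<close>

lemma translate_set_multiples:
  assumes disj: "\<And>e. e \<in> E \<Longrightarrow> e \<inter> m = {}"
  shows "(+) (indicator_mono m) ` set_multiples E = set_multiples {m} \<inter> set_multiples E"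
proof
  show "(+) (indicator_mono m) ` set_multiples E \<subseteq> set_multiples {m} \<inter> set_multiples E"
  proof clarify
    fix t assume "t \<in> set_multiples E"
    then obtain e where e: "e \<in> E" "e \<subseteq> keys t" unfolding set_multiples_iff by blast
    have "keys t \<subseteq> keys (indicator_mono m + t)" "m \<subseteq> keys (indicator_mono m + t)"
      by (auto simp: in_keys_iff lookup_add lookup_indicator_mono)
    then show "indicator_mono m + t \<in> set_multiples {m} \<inter> set_multiples E"
      using e unfolding Int_iff set_multiples_iff by blast
  qed
  show "set_multiples {m} \<inter> set_multiples E \<subseteq> (+) (indicator_mono m) ` set_multiples E"
  proof
    fix t assume t: "t \<in> set_multiples {m} \<inter> set_multiples E"
    then have "mono_dvd (indicator_mono m) t"
      by (simp add: multiples_def)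
    then obtain u where u: "t = indicator_mono m + u" unfolding mono_dvd_def by blast
    obtain e where e: "e \<in> E" "e \<subseteq> keys t" using t by (auto simp: set_multiples_iff)
    have "e \<subseteq> keys u"
    proof
      fix x assume "x \<in> e"
      then have "x \<in> keys t" "x \<notin> m" using e(2) disj[OF e(1)] by auto
      then show "x \<in> keys u" by (simp add: u in_keys_iff lookup_add lookup_indicator_mono)
    qed
    then have "u \<in> set_multiples E" using e(1) by (auto simp: set_multiples_iff)
    then show "t \<in> (+) (indicator_mono m) ` set_multiples E" using u by blast
  qed
qed

text \<open>For a proper ideal these are the Betti numbers of the quotient ring with the homological
  index lowered by 1; its generator 1 accounts for the value at index -1 and degree 0.\<close>

definition mono_koszul_dim_ext :: "'k::field itself \<Rightarrow> 'v::finite mono set \<Rightarrow> int \<Rightarrow> int \<Rightarrow> nat" where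
  "mono_koszul_dim_ext k M p j =
     (if 0 \<le> p then mono_koszul_dim k M (nat p) j else if p = - 1 \<and> j = 0 then 1 else 0)"

text \<open>For the quotient rings, this is the effect of tensoring a resolution with a complex of
  length 1. Here the ideal splits into \<open>(y)\<close> and the old ideal, whose intersection is
  \<open>y\<close> times the old ideal; for \<open>p = 0\<close> the convention at index -1 supplies
  the generator \<open>y\<close>.\<close>

lemma mono_koszul_dim_ext_insert_variable:
  fixes k :: "'k::field itself" and E :: "'v::finite set set"
  assumes y: "y \<notin> \<Union>E" and E: "{} \<notin> E"
  shows "mono_koszul_dim_ext k (set_multiples (insert {y} E)) p j =
    mono_koszul_dim_ext k (set_multiples E) p j + mono_koszul_dim_ext k (set_multiples E) (p - 1) (j - 1)"
proof (cases "0 \<le> p")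
  case False
  then show ?thesis by (auto simp: mono_koszul_dim_ext_def)
next
  case True
  then obtain q where p: "p = int q" using nonneg_int_cases by blast
  let ?M = "set_multiples {{y}}" and ?N = "set_multiples E"
  have un: "set_multiples (insert {y} E) = ?M \<union> ?N"
    unfolding set_eq_iff Un_iff set_multiples_iff by blast
  have int: "?M \<inter> ?N = (+) (indicator_mono {y}) ` ?N"
    using y by (intro translate_set_multiples[symmetric]) auto
  have 0: "0 \<notin> ?M" "0 \<notin> ?N"
    using zero_notin_set_multiples[of "{{y}}"] zero_notin_set_multiples[OF E] by simp_all
  \<comment> \<open>Every monomial of the intersection contains a variable other than
    \<open>y\<close>, so no multidegree here equals that of \<open>y\<close>.\<close>
  have M: "z \<in> mono_boundaries ?M q j" if z: "z \<in> mono_cycles (?M \<inter> ?N) q j"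
    for q and z :: "'v set \<Rightarrow> nat \<Rightarrow> ('v, 'k) mpoly"
  proof -
    have "t + indicator_mono \<sigma> \<noteq> indicator_mono {y}" if t: "t \<in> ?M \<inter> ?N" for t \<sigma>
    proof
      assume eq: "t + indicator_mono \<sigma> = indicator_mono {y}"
      obtain e where e: "e \<in> E" "e \<subseteq> keys t" using t unfolding Int_iff set_multiples_iff by blast
      then obtain x where "x \<in> e" using E by (metis all_not_in_conv)
      then have "x \<noteq> y" "x \<in> keys t" using y e by blast+
      then have "x \<noteq> y" "lookup t x \<noteq> 0" by (simp_all add: in_keys_iff)
      moreover have "lookup t x + lookup (indicator_mono \<sigma>) x = lookup (indicator_mono {y}) x"
        using eq by (metis lookup_add)
      ultimately show False by (simp add: lookup_indicator_mono)
    qed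
    moreover have "?M \<inter> ?N \<subseteq> multiples {indicator_mono {y}}" by simp
    ultimately have "z \<in> mono_boundaries (multiples {indicator_mono {y}}) q j"
      by (intro multiples_cycle_is_boundary[OF z]) auto
    then show ?thesis by simp
  qed
  \<comment> \<open>The apex is \<open>y\<close>: dividing by it leaves the generators of the old
    ideal intact, as they avoid \<open>y\<close>.\<close>
  have N: "z \<in> mono_boundaries ?N q j" if z: "z \<in> mono_cycles (?M \<inter> ?N) q j"
    for q and z :: "'v set \<Rightarrow> nat \<Rightarrow> ('v, 'k) mpoly"
  proof (rule mono_cycle_is_boundary[OF z, where U = "\<lambda>_. y"])
    fix \<sigma> and t :: "'v mono"
    assume t: "t \<in> ?M \<inter> ?N"
    then obtain e where e: "e \<in> E" "e \<subseteq> keys t" "y \<in> keys t"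
      unfolding Int_iff set_multiples_iff by blast
    then have "e \<subseteq> keys (t - Poly_Mapping.single y 1)"
      using keys_minus_single[of t y] y by blast
    then show "lookup (t + indicator_mono \<sigma>) y \<noteq> 0 \<and> (y \<notin> \<sigma> \<longrightarrow> t - Poly_Mapping.single y 1 \<in> ?N)"
      using e by (auto simp: lookup_add in_keys_iff set_multiples_iff)
  qed
  have "mono_koszul_dim k (?M \<union> ?N) q j = mono_koszul_dim k ?M q j + mono_koszul_dim k ?N q j +
      (case q of 0 \<Rightarrow> 0 | Suc r \<Rightarrow> mono_koszul_dim k (?M \<inter> ?N) r j)"
    using M N by (intro mono_koszul_dim_Un dvd_closed_multiples 0) auto
  moreover have "mono_koszul_dim k ?M q j = (if q = 0 \<and> j = 1 then 1 else 0)"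
    using mono_koszul_dim_principal[of "indicator_mono {y}" k q j]
    by (simp add: indicator_mono_eq_0_iff mono_deg_indicator_mono)
  moreover have "mono_koszul_dim k (?M \<inter> ?N) r j = mono_koszul_dim k ?N r (j - 1)" for r
    unfolding int using mono_koszul_dim_translate[OF dvd_closed_multiples 0(2), of k "indicator_mono {y}" r j]
    by (simp add: mono_deg_indicator_mono)
  moreover have "nat (int (Suc r) - 1) = r" for r
    by simp
  ultimately show ?thesis
    unfolding un by (cases q) (simp_all add: p mono_koszul_dim_ext_def del: of_nat_Suc)
qed

text \<open>Pascal's rule in the shape of the induction on the number of variables: each new
  variable leaves the shift alone or raises it by 1.\<close>

lemma sum_choose_Suc:
  fixes f :: "nat \<Rightarrow> nat"
  shows "(\<Sum>l\<le>Suc n. (Suc n choose l) * f l) =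
    (\<Sum>l\<le>n. (n choose l) * f l) + (\<Sum>l\<le>n. (n choose l) * f (Suc l))"
proof -
  have "(\<Sum>l\<le>Suc n. (Suc n choose l) * f l) = f 0 + (\<Sum>l\<le>n. (Suc n choose Suc l) * f (Suc l))"
    by (subst sum.atMost_Suc_shift) simp
  also have "\<dots> = (f 0 + (\<Sum>l\<le>n. (n choose Suc l) * f (Suc l))) + (\<Sum>l\<le>n. (n choose l) * f (Suc l))"
    by (simp add: distrib_right sum.distrib)
  also have "f 0 + (\<Sum>l\<le>n. (n choose Suc l) * f (Suc l)) = (\<Sum>l\<le>Suc n. (n choose l) * f l)"
    by (subst sum.atMost_Suc_shift) simp
  finally show ?thesis by simp
qed

lemma mono_koszul_dim_ext_insert_variables:
  fixes k :: "'k::field itself" and E :: "'v::finite set set"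
  assumes W: "W \<inter> \<Union>E = {}" and E: "{} \<notin> E"
  shows "mono_koszul_dim_ext k (set_multiples ((\<lambda>y. {y}) ` W \<union> E)) p j =
    (\<Sum>l\<le>card W. (card W choose l) * mono_koszul_dim_ext k (set_multiples E) (p - int l) (j - int l))"
  using finite[of W] W
proof (induction W arbitrary: p j rule: finite_induct)
  case (insert y W)
  let ?h = "mono_koszul_dim_ext k (set_multiples E)"
  let ?E = "(\<lambda>y. {y}) ` W \<union> E"
  have "y \<notin> \<Union>?E" "{} \<notin> ?E" using insert E by auto
  then have "mono_koszul_dim_ext k (set_multiples (insert {y} ?E)) p j =
      mono_koszul_dim_ext k (set_multiples ?E) p j + mono_koszul_dim_ext k (set_multiples ?E) (p - 1) (j - 1)"
    by (rule mono_koszul_dim_ext_insert_variable)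
  also have "\<dots> = (\<Sum>l\<le>card W. (card W choose l) * ?h (p - int l) (j - int l)) +
      (\<Sum>l\<le>card W. (card W choose l) * ?h (p - int (Suc l)) (j - int (Suc l)))"
    using insert by (simp add: algebra_simps)
  also have "\<dots> = (\<Sum>l\<le>Suc (card W). (Suc (card W) choose l) * ?h (p - int l) (j - int l))"
    by (rule sum_choose_Suc[symmetric])
  finally show ?case using insert.hyps by simp
qed simp


section \<open>Edge ideals\<close>

lemma var_mult_var:
  "x \<noteq> y \<Longrightarrow> (var x * var y :: ('v::finite, 'k::field) mpoly) = monomial (indicator_mono {x, y})"
  by (simp add: var_def monomial_def mult_single indicator_mono_def)

lemma card_2_graph_edges:
  assumes "\<forall>e\<in>edges G. card e = 2"
  shows "{} \<notin> edges G" "{x, y} \<in> edges G \<Longrightarrow> x \<noteq> y" "e \<in> edges G \<Longrightarrow> \<exists>x y. x \<noteq> y \<and> e = {x, y}"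
  using assms by (fastforce simp: card_2_iff)+

lemma edge_ideal_eq_monomial_span:
  fixes G :: "'v::finite graph" and k :: "'k::field itself"
  assumes G: "\<forall>e\<in>edges G. card e = 2"
  shows "edge_ideal k G = monomial_span (set_multiples (edges G))"
  unfolding edge_ideal_def
proof (rule ideal_gen_eq_monomial_span)
  have eq: "{var x * var y :: ('v, 'k) mpoly |x y. {x, y} \<in> edges G} = monomial ` indicator_mono ` edges G"
  proof
    show "{var x * var y :: ('v, 'k) mpoly |x y. {x, y} \<in> edges G} \<subseteq> monomial ` indicator_mono ` edges G"
    proof clarify
      fix x y assume xy: "{x, y} \<in> edges G"
      then have "x \<noteq> y" by (rule card_2_graph_edges(2)[OF G])
      then show "(var x * var y :: ('v, 'k) mpoly) \<in> monomial ` indicator_mono ` edges G"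
        using xy by (simp add: var_mult_var)
    qed
    show "monomial ` indicator_mono ` edges G \<subseteq> {var x * var y :: ('v, 'k) mpoly |x y. {x, y} \<in> edges G}"
    proof clarify
      fix e assume e: "e \<in> edges G"
      then obtain x y where xy: "x \<noteq> y" "e = {x, y}" using card_2_graph_edges(3)[OF G] by blast
      then have "monomial (indicator_mono e) = (var x * var y :: ('v, 'k) mpoly)"
        by (simp add: var_mult_var)
      then show "\<exists>x y. (monomial (indicator_mono e) :: ('v, 'k) mpoly) = var x * var y \<and> {x, y} \<in> edges G"
        using e xy by blast
    qed
  qed
  show "{var x * var y :: ('v, 'k) mpoly |x y. {x, y} \<in> edges G} \<subseteq> monomial_span (set_multiples (edges G))"
    unfolding eq using subset_multiples[of "indicator_mono ` edges G"] by auto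
  show "monomial ` indicator_mono ` edges G \<subseteq> {var x * var y :: ('v, 'k) mpoly |x y. {x, y} \<in> edges G}"
    using eq by simp
qed

lemma betti_edge_ideal:
  fixes G :: "'v::finite graph" and k :: "'k::field itself"
  assumes G: "\<forall>e\<in>edges G. card e = 2"
  shows "betti (edge_ideal k G) i j = mono_koszul_dim k (set_multiples (edges G)) i j"
  unfolding edge_ideal_eq_monomial_span[OF G]
  by (rule betti_squarefree[OF squarefree_indicator_monos[OF card_2_graph_edges(1)[OF G]]])

lemma betti_ext_edge_ideal:
  fixes G :: "'v::finite graph" and k :: "'k::field itself"
  assumes G: "\<forall>e\<in>edges G. card e = 2"
  shows "betti_ext (edge_ideal k G) i j = mono_koszul_dim_ext k (set_multiples (edges G)) i j"
  by (simp add: betti_ext_def mono_koszul_dim_ext_def betti_edge_ideal[OF G])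

text \<open>The intersection enters one homological degree lower, and dividing out
  \<open>u v\<close> lowers the degree by 2; this gives the offsets -1 and -2. The variables of
  \<open>W\<close> then produce the binomial sum.\<close>

lemma splitting_edge_betti:
  fixes k :: "'k::field itself" and G :: "'v::finite graph"
  defines "H u v \<equiv> delete_verts G (neighbors G u \<union> neighbors G v)"
    and "n u v \<equiv> card (neighbors G u \<union> neighbors G v) - 2"
  assumes G: "\<forall>e\<in>edges G. card e = 2" and split: "splitting_edge k G u v" and i: "1 \<le> i"
  shows "betti (edge_ideal k G) i j = betti (edge_ideal k (delete_edge G {u, v})) i j +
    (\<Sum>l = 0..i. (n u v choose l) * betti_ext (edge_ideal k (H u v)) (int i - int l - 1) (j - 2 - int l))"
proof -
  let ?m = "{u, v}"
  let ?M = "set_multiples {?m}" and ?N = "set_multiples (edges (delete_edge G ?m))"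
  let ?NN = "neighbors G u \<union> neighbors G v"
  let ?h = "mono_koszul_dim k" and ?hx = "mono_koszul_dim_ext k (set_multiples (edges (H u v)))"
  have uv: "?m \<in> edges G" using split by (simp add: splitting_edge_def)
  then have "u \<noteq> v" using card_2_graph_edges(2)[OF G] by blast
  have delG: "\<forall>e\<in>edges (delete_edge G ?m). card e = 2"
    using G by (simp add: delete_edge_def)
  have HG: "\<forall>e\<in>edges (H u v). card e = 2"
    using G by (simp add: H_def delete_verts_def)
  have J: "ideal_gen {var u * var v} = (monomial_span ?M :: ('v, 'k) mpoly set)"
    by (rule ideal_gen_eq_monomial_span)
      (use subset_multiples[of "{indicator_mono ?m}"] in \<open>auto simp: var_mult_var[OF \<open>u \<noteq> v\<close>]\<close>)
  have un: "set_multiples (edges G) = ?M \<union> ?N"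
  proof -
    have "edges G = {?m} \<union> edges (delete_edge G ?m)" using uv by (auto simp: delete_edge_def)
    then show ?thesis using multiples_Un image_Un by metis
  qed
  have 0: "0 \<notin> ?M" "0 \<notin> ?N"
    using zero_notin_set_multiples[of "{?m}"] zero_notin_set_multiples[OF card_2_graph_edges(1)[OF delG]]
    by simp_all
  have "splitting (edge_ideal k G) (monomial_span ?M) (monomial_span ?N :: ('v, 'k) mpoly set)"
    using split unfolding splitting_edge_def J edge_ideal_eq_monomial_span[OF delG] by blast
  then have "?h (?M \<union> ?N) i j = ?h ?M i j + ?h ?N i j + (case i of 0 \<Rightarrow> 0 | Suc q \<Rightarrow> ?h (?M \<inter> ?N) q j)"
    by (rule splitting_mono_koszul_dim) (use 0 dvd_closed_multiples in auto)
  moreover have "?h ?M i j = 0"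
    using mono_koszul_dim_principal[of "indicator_mono ?m" k i j] i by (simp add: indicator_mono_eq_0_iff)
  moreover have "?h (?M \<inter> ?N) (i - 1) j =
      (\<Sum>l = 0..i. (n u v choose l) * ?hx (int i - int l - 1) (j - 2 - int l))"
  proof -
    define W where "W = ?NN - ?m"
    let ?E = "(\<lambda>y. {y}) ` W \<union> edges (H u v)"
    \<comment> \<open>\<open>u\<close> and \<open>v\<close> are neighbors of each other, which is
      the origin of the 2 subtracted in \<open>n\<close>.\<close>
    have "u \<in> ?NN" "v \<in> ?NN" using uv by (auto simp: neighbors_def insert_commute)
    then have card: "card W = n u v"
      unfolding W_def n_def using \<open>u \<noteq> v\<close> by (simp add: card_Diff_subset)
    have Hdisj: "e \<inter> ?NN = {}" if "e \<in> edges (H u v)" for e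
      using that by (simp add: H_def delete_verts_def)
    have disj: "e \<inter> ?m = {}" if "e \<in> ?E" for e
      using that Hdisj \<open>u \<in> ?NN\<close> \<open>v \<in> ?NN\<close> unfolding W_def by blast
    have E0: "{} \<notin> edges (H u v)" using card_2_graph_edges(1)[OF HG] by blast
    \<comment> \<open>Among multiples of \<open>u v\<close>, an edge other than
      \<open>{u, v}\<close> that meets a neighborhood may be replaced by a single variable of
      \<open>W\<close>: either it joins \<open>u\<close> or \<open>v\<close> to \<open>W\<close>, or
      it has a vertex in \<open>W\<close> anyway. The remaining edges are those of
      \<open>H\<close>.\<close>
    have iff: "(\<exists>f\<in>edges G - {?m}. f \<subseteq> T) \<longleftrightarrow> (\<exists>e\<in>?E. e \<subseteq> T)" if T: "?m \<subseteq> T" for T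
    proof
      assume "\<exists>f\<in>edges G - {?m}. f \<subseteq> T"
      then obtain f where f: "f \<in> edges G" "f \<noteq> ?m" "f \<subseteq> T" by blast
      show "\<exists>e\<in>?E. e \<subseteq> T"
      proof (cases "f \<inter> ?NN = {}")
        case True
        then have "f \<in> edges (H u v)" using f(1) by (simp add: H_def delete_verts_def)
        then show ?thesis using f(3) by blast
      next
        case False
        obtain x y where xy: "x \<noteq> y" "f = {x, y}" using card_2_graph_edges(3)[OF G] f(1) by blast
        have "\<exists>w\<in>f. w \<in> W"
        proof (cases "f \<inter> ?m = {}")
          case True
          then show ?thesis using False unfolding W_def by blast
        next
          case False
          have nb: "b \<in> neighbors G a" if "{a, b} \<in> edges G" for a b using that by (simp add: neighbors_def)
          have "\<exists>a b. f = {a, b} \<and> a \<in> ?m \<and> a \<noteq> b" using False xy by (auto simp: insert_commute)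
          then obtain a b where ab: "f = {a, b}" "a \<in> ?m" "a \<noteq> b" by blast
          then have "b \<notin> ?m" using f(2) by auto
          moreover have "b \<in> ?NN" using ab f(1) nb[of a b] by auto
          ultimately show ?thesis using ab(1) unfolding W_def by blast
        qed
        then show ?thesis using f(3) by blast
      qed
    next
      assume "\<exists>e\<in>?E. e \<subseteq> T"
      then consider y where "y \<in> W" "y \<in> T" | e where "e \<in> edges (H u v)" "e \<subseteq> T" by blast
      then show "\<exists>f\<in>edges G - {?m}. f \<subseteq> T"
      proof cases
        case 1
        then obtain a where a: "a \<in> ?m" "{a, y} \<in> edges G" "y \<notin> ?m" unfolding W_def neighbors_def by blast
        then have "{a, y} \<in> edges G - {?m}" "{a, y} \<subseteq> T" using T 1 by auto
        then show ?thesis by blast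
      next
        case 2
        then have "e \<in> edges G" "u \<notin> e"
          using Hdisj[of e] \<open>u \<in> ?NN\<close> by (auto simp: H_def delete_verts_def)
        then show ?thesis using 2 by blast
      qed
    qed
    have "?M \<inter> ?N = set_multiples {?m} \<inter> set_multiples ?E"
    proof (intro set_eqI)
      fix t
      show "t \<in> ?M \<inter> ?N \<longleftrightarrow> t \<in> set_multiples {?m} \<inter> set_multiples ?E"
      proof (cases "?m \<subseteq> keys t")
        case True
        have "edges (delete_edge G ?m) = edges G - {?m}" by (simp add: delete_edge_def)
        then show ?thesis using iff[OF True] unfolding Int_iff set_multiples_iff by simp
      next
        case False
        then show ?thesis unfolding Int_iff set_multiples_iff by blast
      qed
    qed
    also have "\<dots> = (+) (indicator_mono ?m) ` set_multiples ?E"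
      using disj by (rule translate_set_multiples[symmetric])
    finally have "?h (?M \<inter> ?N) (i - 1) j = ?h (set_multiples ?E) (i - 1) (j - 2)"
      using mono_koszul_dim_translate[of "set_multiples ?E" k "indicator_mono ?m" "i - 1" j]
        dvd_closed_multiples zero_notin_set_multiples[of ?E] E0 \<open>u \<noteq> v\<close>
      by (auto simp: mono_deg_indicator_mono)
    also have "\<dots> = mono_koszul_dim_ext k (set_multiples ?E) (int i - 1) (j - 2)"
      using i by (simp add: mono_koszul_dim_ext_def nat_diff_distrib One_nat_def)
    also have "\<dots> = (\<Sum>l\<le>card W. (card W choose l) * ?hx (int i - 1 - int l) (j - 2 - int l))"
      using Hdisj by (intro mono_koszul_dim_ext_insert_variables E0) (auto simp: W_def)
    \<comment> \<open>Terms with \<open>l > i\<close> have homological index below -1, and terms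
      with \<open>l > card W\<close> a zero binomial coefficient, so the bound \<open>card W\<close>
      can be exchanged for \<open>i\<close>.\<close>
    also have "\<dots> = (\<Sum>l\<in>{..card W} \<inter> {0..i}. (card W choose l) * ?hx (int i - 1 - int l) (j - 2 - int l))"
      by (rule sum.mono_neutral_right) (auto simp: mono_koszul_dim_ext_def)
    also have "\<dots> = (\<Sum>l = 0..i. (card W choose l) * ?hx (int i - 1 - int l) (j - 2 - int l))"
      by (rule sum.mono_neutral_left) auto
    finally show ?thesis unfolding card by (simp add: algebra_simps)
  qed
  ultimately show ?thesis
    unfolding betti_edge_ideal[OF G] betti_edge_ideal[OF delG] betti_ext_edge_ideal[OF HG] un
    using i by (cases i) simp_all
qed

text \<open>The supports of the generators are unions because \<open>v\<close>, respectively
  \<open>v\<close> and \<open>w\<close>, does not occur in the edges it is multiplied with.\<close>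

lemma L_ideal_eq_monomial_span:
  fixes k :: "'k::field itself" and G :: "'v::finite graph"
  assumes G: "\<forall>e\<in>edges G. card e = 2"
  shows "L_ideal k G v = monomial_span (set_multiples
    (insert v ` edges (nbhd_subgraph G v) \<union>
     (\<Union>w\<in>neighbors G v. (\<union>) {v, w} ` edges (delete_verts G (neighbors G v \<union> neighbors G w)))))"
    (is "_ = monomial_span (set_multiples (?A \<union> ?B))")
proof -
  let ?D = "\<lambda>w. delete_verts G (neighbors G v \<union> neighbors G w)"
  have nG: "\<forall>e\<in>edges (nbhd_subgraph G v). card e = 2"
    using G by (simp add: nbhd_subgraph_def)
  have dG: "\<forall>e\<in>edges (?D w). card e = 2" for w
    using G by (simp add: delete_verts_def)
  have nv: "v \<notin> e" if "e \<in> edges (nbhd_subgraph G v)" for e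
    using that by (simp add: nbhd_subgraph_def)
  \<comment> \<open>As \<open>w\<close> is adjacent to \<open>v\<close>, the vertex \<open>v\<close>
    lies in the neighborhood of \<open>w\<close>, so the deleted set contains both.\<close>
  have vw: "v \<in> neighbors G w" "v \<noteq> w" if "w \<in> neighbors G v" for w
    using that card_2_graph_edges(2)[OF G] by (auto simp: neighbors_def insert_commute)
  have dv: "e \<inter> {v, w} = {}" if "w \<in> neighbors G v" "e \<in> edges (?D w)" for e w
    using that vw by (auto simp: delete_verts_def)
  have ind: "monomial (indicator_mono (a \<union> b)) = (monomial (indicator_mono a) * monomial (indicator_mono b) :: ('v, 'k) mpoly)"
    if "a \<inter> b = {}" for a b :: "'v set"
    using that by (simp add: monomial_def mult_single indicator_mono_def sum.union_disjoint)
  have var: "var v = (monomial (indicator_mono {v}) :: ('v, 'k) mpoly)"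
    by (simp add: var_def indicator_mono_def)
  have mem: "monomial (indicator_mono a) * p \<in> (monomial_span (set_multiples E) :: ('v, 'k) mpoly set)"
    if p: "p \<in> monomial_span (set_multiples E')" and E: "\<And>e. e \<in> E' \<Longrightarrow> a \<union> e \<in> E" for p a E E'
  proof -
    have "t \<in> set_multiples E" if t: "t \<in> keys (monomial (indicator_mono a) * p)" for t
    proof -
      obtain r s where rs: "t = r + s" "r \<in> keys (monomial (indicator_mono a) :: ('v, 'k) mpoly)" "s \<in> keys p"
        using keys_mult[of "monomial (indicator_mono a)" p] t by blast
      have r: "r = indicator_mono a" using rs(2) by (simp add: monomial_def)
      have "s \<in> set_multiples E'" using rs(3) p by (auto simp: monomial_span_def)
      then obtain e where "e \<in> E'" "e \<subseteq> keys s" by (auto simp: set_multiples_iff)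
      then have "a \<union> e \<in> E" "a \<union> e \<subseteq> keys t"
        using E by (auto simp: rs(1) r in_keys_iff lookup_add lookup_indicator_mono)
      then show ?thesis unfolding set_multiples_iff by blast
    qed
    then show ?thesis by (auto simp: monomial_span_def)
  qed
  show ?thesis
    unfolding L_ideal_def
  proof (rule ideal_gen_eq_monomial_span)
    show "(*) (var v) ` edge_ideal k (nbhd_subgraph G v) \<union>
        (\<Union>w\<in>neighbors G v. (*) (var v * var w) ` edge_ideal k (?D w))
      \<subseteq> (monomial_span (set_multiples (?A \<union> ?B)) :: ('v, 'k) mpoly set)"
    proof (intro Un_least UN_least)
      show "(*) (var v) ` edge_ideal k (nbhd_subgraph G v) \<subseteq> monomial_span (set_multiples (?A \<union> ?B))"
        unfolding edge_ideal_eq_monomial_span[OF nG] var by (auto intro!: mem)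
      show "(*) (var v * var w) ` edge_ideal k (?D w) \<subseteq> monomial_span (set_multiples (?A \<union> ?B))"
        if w: "w \<in> neighbors G v" for w
        unfolding edge_ideal_eq_monomial_span[OF dG] var_mult_var[OF vw(2)[OF w]] using w by (auto intro!: mem)
    qed
    show "monomial ` indicator_mono ` (?A \<union> ?B) \<subseteq> (*) (var v) ` edge_ideal k (nbhd_subgraph G v) \<union>
        (\<Union>w\<in>neighbors G v. (*) (var v * var w) ` edge_ideal k (?D w))"
    proof clarify
      fix e assume e: "e \<in> ?A \<union> ?B"
        and not: "monomial (indicator_mono e) \<notin>
          (\<Union>w\<in>neighbors G v. (*) (var v * var w) ` edge_ideal k (?D w))"
      from e show "monomial (indicator_mono e) \<in> (*) (var v) ` edge_ideal k (nbhd_subgraph G v)"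
      proof
        assume "e \<in> ?A"
        then obtain f where f: "f \<in> edges (nbhd_subgraph G v)" "e = {v} \<union> f" by auto
        have "monomial (indicator_mono e) = (var v * monomial (indicator_mono f) :: ('v, 'k) mpoly)"
          unfolding f(2) var using nv[OF f(1)] by (intro ind) auto
        moreover have "monomial (indicator_mono f) \<in> edge_ideal k (nbhd_subgraph G v)"
          unfolding edge_ideal_eq_monomial_span[OF nG]
          using f(1) subset_multiples[of "indicator_mono ` edges (nbhd_subgraph G v)"] by auto
        ultimately show ?thesis by (rule image_eqI)
      next
        assume "e \<in> ?B"
        then obtain w f where f: "w \<in> neighbors G v" "f \<in> edges (?D w)" "e = {v, w} \<union> f" by auto
        have "monomial (indicator_mono e) = (var v * var w * monomial (indicator_mono f) :: ('v, 'k) mpoly)"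
          unfolding f(3) var_mult_var[OF vw(2)[OF f(1)]] using dv[OF f(1,2)] by (intro ind) auto
        moreover have "monomial (indicator_mono f) \<in> edge_ideal k (?D w)"
          unfolding edge_ideal_eq_monomial_span[OF dG]
          using f(2) subset_multiples[of "indicator_mono ` edges (?D w)"] by auto
        ultimately have "monomial (indicator_mono e) \<in> (*) (var v * var w) ` edge_ideal k (?D w)"
          by (rule image_eqI)
        then show ?thesis using not f(1) by blast
      qed
    qed
  qed
qed

text \<open>The star at \<open>v\<close> and the graph without \<open>v\<close> give
  \<open>J\<close> and \<open>K\<close>. Both nullity statements come from explicit cones; on the
  side of \<open>K\<close> the apex is \<open>v\<close>, which the generators of \<open>K\<close>
  avoid.\<close>

lemma splitting_vertex_betti:
  fixes k :: "'k::field itself" and G :: "'v::finite graph"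
  assumes G: "\<forall>e\<in>edges G. card e = 2"
  shows "betti (edge_ideal k G) i j = betti (edge_ideal k (complete_bipartite {v} (neighbors G v))) i j +
    betti (edge_ideal k (delete_verts G {v})) i j + (if i = 0 then 0 else betti (L_ideal k G v) (i - 1) j)"
proof -
  let ?N = "neighbors G v"
  let ?S = "complete_bipartite {v} ?N" and ?D = "delete_verts G {v}"
  let ?J = "set_multiples (edges ?S)" and ?K = "set_multiples (edges ?D)"
  let ?h = "mono_koszul_dim k"
  have vw: "v \<noteq> w" if "w \<in> ?N" for w
    using that card_2_graph_edges(2)[OF G] by (auto simp: neighbors_def)
  have SG: "\<forall>e\<in>edges ?S. card e = 2"
    using vw by (auto simp: complete_bipartite_def)
  have DG: "\<forall>e\<in>edges ?D. card e = 2"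
    using G by (simp add: delete_verts_def)
  have J_iff: "t \<in> ?J \<longleftrightarrow> v \<in> keys t \<and> (\<exists>w\<in>?N. w \<in> keys t)" for t
    by (auto simp: set_multiples_iff complete_bipartite_def)
  have K_iff: "t \<in> ?K \<longleftrightarrow> (\<exists>f\<in>edges G. v \<notin> f \<and> f \<subseteq> keys t)" for t
    by (auto simp: set_multiples_iff delete_verts_def)
  have un: "set_multiples (edges G) = ?J \<union> ?K"
  proof (intro set_eqI)
    fix t
    have at_v: "\<exists>w\<in>?N. e = {v, w}" if "e \<in> edges G" "v \<in> e" for e
      using card_2_graph_edges(3)[OF G that(1)] that by (auto simp: neighbors_def insert_commute)
    show "t \<in> set_multiples (edges G) \<longleftrightarrow> t \<in> ?J \<union> ?K"
    proof
      assume "t \<in> set_multiples (edges G)"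
      then obtain e where e: "e \<in> edges G" "e \<subseteq> keys t" unfolding set_multiples_iff by blast
      show "t \<in> ?J \<union> ?K"
      proof (cases "v \<in> e")
        case True
        then show ?thesis using at_v[OF e(1)] e(2) unfolding Un_iff J_iff by blast
      next
        case False
        then show ?thesis using e unfolding Un_iff K_iff by blast
      qed
    next
      assume "t \<in> ?J \<union> ?K"
      then consider w where "v \<in> keys t" "w \<in> ?N" "w \<in> keys t" | f where "f \<in> edges G" "f \<subseteq> keys t"
        unfolding Un_iff J_iff K_iff by blast
      then show "t \<in> set_multiples (edges G)"
      proof cases
        case 1
        then have "{v, w} \<in> edges G" "{v, w} \<subseteq> keys t" by (auto simp: neighbors_def)
        then show ?thesis unfolding set_multiples_iff by blast
      next
        case 2
        then show ?thesis unfolding set_multiples_iff by blast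
      qed
    qed
  qed
  have 0: "0 \<notin> ?J" "0 \<notin> ?K"
    using zero_notin_set_multiples[OF card_2_graph_edges(1)[OF SG]]
      zero_notin_set_multiples[OF card_2_graph_edges(1)[OF DG]] by simp_all
  have nullK: "z \<in> mono_boundaries ?K p j" if z: "z \<in> mono_cycles (?J \<inter> ?K) p j"
    for p and z :: "'v set \<Rightarrow> nat \<Rightarrow> ('v, 'k) mpoly"
  proof (rule mono_cycle_is_boundary[OF z, where U = "\<lambda>_. v"])
    fix \<sigma> and t :: "'v mono"
    assume t: "t \<in> ?J \<inter> ?K"
    then obtain f where f: "f \<in> edges G" "v \<notin> f" "f \<subseteq> keys t" unfolding Int_iff K_iff by blast
    have "f \<subseteq> keys (t - Poly_Mapping.single v 1)" using f keys_minus_single[of t v] by blast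
    then have "t - Poly_Mapping.single v 1 \<in> ?K" using f unfolding K_iff by blast
    moreover have "lookup t v \<noteq> 0" using t by (auto simp: J_iff in_keys_iff)
    ultimately show "lookup (t + indicator_mono \<sigma>) v \<noteq> 0 \<and> (v \<notin> \<sigma> \<longrightarrow> t - Poly_Mapping.single v 1 \<in> ?K)"
      by (simp add: lookup_add)
  qed
  have nullJ: "z \<in> mono_boundaries ?J p j" if z: "z \<in> mono_cycles (?J \<inter> ?K) p j"
    for p and z :: "'v set \<Rightarrow> nat \<Rightarrow> ('v, 'k) mpoly"
  proof (rule mono_cycle_is_boundary_ex[OF z])
    fix \<sigma> and t :: "'v mono"
    assume t: "t \<in> ?J \<inter> ?K"
    define a where "a = t + indicator_mono \<sigma>"
    have a: "x \<in> keys a" if "t' + indicator_mono \<sigma>' = a" "x \<in> keys t'" for t' \<sigma>' x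
      using that by (auto simp: in_keys_iff lookup_add)
    have a_eq: "lookup t' x = lookup a x" if "t' + indicator_mono \<sigma>' = a" "x \<notin> \<sigma>'" for t' \<sigma>' x
      using that by (auto simp: lookup_add lookup_indicator_mono)
    \<comment> \<open>The star ideal contains \<open>t / u\<close> if \<open>u = v\<close> occurs twice, or if \<open>u\<close> is not a vertex of the star,
      or if \<open>t\<close> has a second neighbour of \<open>v\<close> to replace \<open>u\<close>.\<close>
    consider (double) "2 \<le> lookup a v"
      | (outside) x where "x \<in> keys a" "x \<noteq> v" "x \<notin> ?N"
      | (inside) "keys a \<subseteq> insert v ?N" by blast
    then have "\<exists>u\<in>keys a. \<forall>t'\<in>?J \<inter> ?K. \<forall>\<sigma>'. t' + indicator_mono \<sigma>' = a \<longrightarrow> u \<notin> \<sigma>' \<longrightarrow>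
        t' - Poly_Mapping.single u 1 \<in> ?J"
    proof cases
      case double
      have "t' - Poly_Mapping.single v 1 \<in> ?J"
        if "t' \<in> ?J" "t' + indicator_mono \<sigma>' = a" "v \<notin> \<sigma>'" for t' \<sigma>'
        using keys_minus_single_ge_2[of t' v] double a_eq[OF that(2,3)] that(1) unfolding J_iff by auto
      moreover have "v \<in> keys a" using double by (simp add: in_keys_iff)
      ultimately show ?thesis by blast
    next
      case outside
      have "t' - Poly_Mapping.single x 1 \<in> ?J" if "t' \<in> ?J" for t'
        using keys_minus_single[of t' x] outside that unfolding J_iff by blast
      then show ?thesis using outside by blast
    next
      case inside
      obtain w where w: "w \<in> ?N" "w \<in> keys t" using t unfolding Int_iff J_iff by blast
      have "t' - Poly_Mapping.single w 1 \<in> ?J"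
        if t': "t' \<in> ?J \<inter> ?K" "t' + indicator_mono \<sigma>' = a" for t' \<sigma>'
      proof -
        obtain f where f: "f \<in> edges G" "v \<notin> f" "f \<subseteq> keys t'" using t'(1) unfolding Int_iff K_iff by blast
        \<comment> \<open>The edge \<open>f\<close> avoids \<open>v\<close> and so has both ends
          among the neighbors of \<open>v\<close>; one of them differs from \<open>w\<close> and
          survives the division by \<open>w\<close>.\<close>
        have fN: "f \<subseteq> ?N" using f a[OF t'(2)] inside by blast
        obtain x y where "x \<noteq> y" "f = {x, y}" using card_2_graph_edges(3)[OF G f(1)] by blast
        then obtain w' where w': "w' \<in> f" "w' \<noteq> w" by blast
        have "w' \<in> keys (t' - Poly_Mapping.single w 1)" "v \<in> keys (t' - Poly_Mapping.single w 1)"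
          using keys_minus_single[of t' w] w' f(3) t'(1) vw[OF w(1)] unfolding Int_iff J_iff by blast+
        then show ?thesis using fN w'(1) unfolding J_iff by blast
      qed
      moreover have "w \<in> keys a" using a[of t \<sigma> w] w(2) by (simp add: a_def)
      ultimately show ?thesis by blast
    qed
    then show "\<exists>u. lookup (t + indicator_mono \<sigma>) u \<noteq> 0 \<and>
        (\<forall>t'\<in>?J \<inter> ?K. \<forall>\<sigma>'. t' + indicator_mono \<sigma>' = t + indicator_mono \<sigma> \<longrightarrow> u \<notin> \<sigma>' \<longrightarrow>
          t' - Poly_Mapping.single u 1 \<in> ?J)"
      unfolding a_def by (metis in_keys_iff)
  qed
  define LE where "LE = insert v ` edges (nbhd_subgraph G v) \<union>
     (\<Union>w\<in>?N. (\<union>) {v, w} ` edges (delete_verts G (?N \<union> neighbors G w)))"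
  have L: "?J \<inter> ?K = set_multiples LE"
  proof (intro set_eqI iffI)
    fix t assume t: "t \<in> ?J \<inter> ?K"
    then obtain w f where w: "v \<in> keys t" "w \<in> ?N" "w \<in> keys t" and f: "f \<in> edges G" "v \<notin> f" "f \<subseteq> keys t"
      unfolding Int_iff J_iff K_iff by blast
    \<comment> \<open>If \<open>f\<close> meets \<open>N(v)\<close>, then \<open>v f\<close> is a
      generator of \<open>L\<close>. If \<open>f\<close> meets \<open>N(w)\<close> in
      \<open>x\<close>, the edge from \<open>w\<close> to \<open>x\<close> takes the place of
      \<open>f\<close>. Otherwise \<open>f\<close> lies in the graph attached to
      \<open>w\<close>.\<close>
    consider "f \<inter> ?N \<noteq> {}" | x where "x \<in> f" "x \<in> neighbors G w"
      | "f \<inter> (?N \<union> neighbors G w) = {}" by blast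
    then show "t \<in> set_multiples LE"
    proof cases
      case 1
      then have "insert v f \<in> LE" using f by (simp add: LE_def nbhd_subgraph_def)
      then show ?thesis using w f unfolding set_multiples_iff by blast
    next
      case 2
      have "x \<noteq> v" using 2 f by blast
      then have "{w, x} \<in> edges (nbhd_subgraph G v)"
        using 2 w(2) vw[OF w(2)] by (auto simp: nbhd_subgraph_def neighbors_def)
      then have "insert v {w, x} \<in> LE" unfolding LE_def by blast
      moreover have "insert v {w, x} \<subseteq> keys t" using w f 2 by blast
      ultimately show ?thesis unfolding set_multiples_iff by blast
    next
      case 3
      then have "{v, w} \<union> f \<in> LE" using f(1) w(2) unfolding LE_def delete_verts_def by auto
      moreover have "{v, w} \<union> f \<subseteq> keys t" using w f by blast
      ultimately show ?thesis unfolding set_multiples_iff by blast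
    qed
  next
    fix t assume "t \<in> set_multiples LE"
    then obtain e where e: "e \<in> LE" "e \<subseteq> keys t" unfolding set_multiples_iff by blast
    then consider (touching) f where "f \<in> edges (nbhd_subgraph G v)" "e = insert v f"
      | (far) w f where "w \<in> ?N" "f \<in> edges (delete_verts G (?N \<union> neighbors G w))" "e = {v, w} \<union> f"
      unfolding LE_def by blast
    then show "t \<in> ?J \<inter> ?K"
    proof cases
      case touching
      then have "f \<in> edges G" "f \<inter> ?N \<noteq> {}" "v \<notin> f" by (simp_all add: nbhd_subgraph_def)
      then show ?thesis using touching(2) e(2) unfolding Int_iff J_iff K_iff by blast
    next
      case far
      then have "f \<in> edges G" "v \<notin> f"
        by (auto simp: delete_verts_def neighbors_def insert_commute)
      then show ?thesis using far(1,3) e(2) unfolding Int_iff J_iff K_iff by blast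
    qed
  qed
  have "{} \<notin> LE" by (auto simp: LE_def)
  have betti_L: "betti (L_ideal k G v) p j = ?h (?J \<inter> ?K) p j" for p
    using betti_squarefree[OF squarefree_indicator_monos[OF \<open>{} \<notin> LE\<close>], where k = k]
    unfolding L_ideal_eq_monomial_span[OF G] L LE_def by simp
  have "?h (?J \<union> ?K) i j = ?h ?J i j + ?h ?K i j + (case i of 0 \<Rightarrow> 0 | Suc q \<Rightarrow> ?h (?J \<inter> ?K) q j)"
    using nullJ nullK by (intro mono_koszul_dim_Un dvd_closed_multiples 0) auto
  then show ?thesis
    unfolding betti_edge_ideal[OF G] betti_edge_ideal[OF SG] betti_edge_ideal[OF DG] betti_L un
    by (cases i) simp_all
qed

theorem theorem1p1:
  fixes k :: "'k::field itself"
    and G :: "'v::finite graph"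
  assumes "simple_graph G" and "verts G = UNIV"
  shows
    "(\<forall>u v. splitting_edge k G u v \<longrightarrow>
        (let H = delete_verts G (neighbors G u \<union> neighbors G v);
             n = card (neighbors G u \<union> neighbors G v) - 2
         in \<forall>i::nat. \<forall>j::nat. 1 \<le> i \<longrightarrow>
              betti (edge_ideal k G) i (int j) =
                betti (edge_ideal k (delete_edge G {u, v})) i (int j) +
                (\<Sum>l = 0..i. (n choose l) *
                   betti_ext (edge_ideal k H) (int i - int l - 1) (int j - 2 - int l))))
     \<and>
     (\<forall>v. splitting_vertex G v \<longrightarrow>
        (\<forall>i::nat. \<forall>j::nat.
           betti (edge_ideal k G) i (int j) =
             betti (edge_ideal k (complete_bipartite {v} (neighbors G v))) i (int j) +
             betti (edge_ideal k (delete_verts G {v})) i (int j) +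
             (if i = 0 then 0 else betti (L_ideal k G v) (i - 1) (int j))))"
proof (intro conjI allI impI)
  have two: "\<forall>e\<in>edges G. card e = 2"
    using assms(1) by (simp add: simple_graph_def)
  show "let H = delete_verts G (neighbors G u \<union> neighbors G v);
             n = card (neighbors G u \<union> neighbors G v) - 2
         in \<forall>i::nat. \<forall>j::nat. 1 \<le> i \<longrightarrow>
              betti (edge_ideal k G) i (int j) =
                betti (edge_ideal k (delete_edge G {u, v})) i (int j) +
                (\<Sum>l = 0..i. (n choose l) *
                   betti_ext (edge_ideal k H) (int i - int l - 1) (int j - 2 - int l))"
    if "splitting_edge k G u v" for u v
    using splitting_edge_betti[OF two that] by simp
  show "betti (edge_ideal k G) i (int j) =
             betti (edge_ideal k (complete_bipartite {v} (neighbors G v))) i (int j) +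
             betti (edge_ideal k (delete_verts G {v})) i (int j) +
             (if i = 0 then 0 else betti (L_ideal k G v) (i - 1) (int j))" for v i j
    by (rule splitting_vertex_betti[OF two])
qed

end
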